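(* Let $\Lambda$ be a nonempty set, let $\{E_\lambda\mid\lambda\in\Lambda\}$ and $\{F_\lambda\mid\lambda\in\Lambda\}$ be families of Banach spaces, let $\{T_\lambda:E_\lambda\to F_\lambda\mid\lambda\in\Lambda\}$ be a family of Asplund operators with $\sup_\lambda\|T_\lambda\|<\infty$, and let $p=1$ or $p=\infty$. The following are equivalent: (i) $\mathrm{Sz}\big((\bigoplus_{\lambda\in\Lambda}T_\lambda)_p\big)<\infty$ (that is, $(\bigoplus_{\lambda\in\Lambda}T_\lambda)_p$ is Asplund). (ii) $\mathrm{Sz}\big((\bigoplus_{\lambda\in\Lambda}T_\lambda)_p\big)=\sup\{\mathrm{Sz}(T_\lambda)\mid\lambda\in\Lambda\}$. (iii) $(\|T_\lambda\|)_{\lambda\in\Lambda}\in c_0(\Lambda)$.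
   Context: Banach spaces are over $\mathbb R$ or $\mathbb C$; operators are bounded and linear; $B_X$ is the closed unit ball of $X$. Szlenk index. For a Banach space $E$, a $w^*$-compact set $K\subseteq E^*$ and $\varepsilon>0$, let $s_\varepsilon(K)=\{x\in K\mid \operatorname{diam}(K\cap V)>\varepsilon\text{ for every }w^*\text{-open }V\ni x\}$ (norm diameter). Set $s^0_\varepsilon(K)=K$, $s_\varepsilon^{\alpha+1}(K)=s_\varepsilon(s_\varepsilon^\alpha(K))$, and $s_\varepsilon^\alpha(K)=\bigcap_{\beta<\alpha}s_\varepsilon^\beta(K)$ for limit ordinals $\alpha$. $\mathrm{Sz}_\varepsilon(K)$ is the class of all ordinals $\alpha$ with $s^\alpha_\varepsilon(K)\neq\emptyset$ (i.e. the least ordinal $\alpha$ with $s^\alpha_\varepsilon(K)=\emptyset$ if one exists; otherwise it is the class of all ordinals and we write $\mathrm{Sz}_\varepsilon(K)=\infty$, larger than every ordinal). $\mathrm{Sz}(K)=\bigcup_{\varepsilon>0}\mathrm{Sz}_\varepsilon(K)=\sup_{\varepsilon>0}\mathrm{Sz}_\varepsilon(K)$. For an operator $T:E\to F$, $\mathrm{Sz}(T)=\mathrm{Sz}(T^*B_{F^*})$. Direct sums. $(\bigoplus_\lambda E_\lambda)_p$ is the $\ell_p$-direct sum, and $(\bigoplus_\lambda T_\lambda)_p:(\bigoplus_\lambda E_\lambda)_p\to(\bigoplus_\lambda F_\lambda)_p$ is the operator $(x_\lambda)_\lambda\mapsto(T_\lambda x_\lambda)_\lambda$. Asplund operators. $T:E\to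 F$ is Asplund if for every finite positive measure space $(\Omega,\Sigma,\mu)$, every operator $S:F\to L_\infty(\Omega,\Sigma,\mu)$ and every $\varepsilon>0$ there is $B\in\Sigma$ with $\mu(B)>\mu(\Omega)-\varepsilon$ such that $\{f\chi_B\mid f\in ST(B_E)\}$ is relatively compact in $L_\infty(\Omega,\Sigma,\mu)$. It is known that $T$ is Asplund if and only if $\mathrm{Sz}(T)<\infty$. *)

theory Defs
  imports "HOL-Analysis.Analysis" "HOL-Algebra.Module"
begin

section \<open>Scalars\<close>

text \<open>The instances are exactly \<open>\<real>\<close> and \<open>\<complex>\<close>, up to isometric field isomorphism: the axiom describes
  the field, and a multiplicative norm on it must be the usual modulus.\<close>

class real_or_complex = real_normed_field + euclidean_space +
  assumes real_or_complex:
    "(\<forall>z. \<exists>a. z = a *\<^sub>R 1) \<or>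
     (\<exists>i. i * i = - 1 \<and> (\<forall>z. \<exists>a b. z = a *\<^sub>R 1 + b *\<^sub>R i))"

instance real :: real_or_complex
  by standard simp

instance complex :: real_or_complex
proof
  have "\<exists>a b. z = a *\<^sub>R 1 + b *\<^sub>R \<i>" for z :: complex
    by (intro exI[of _ "Re z"] exI[of _ "Im z"]) (simp add: complex_eq_iff)
  then show "(\<forall>z::complex. \<exists>a. z = a *\<^sub>R 1) \<or>
      (\<exists>i::complex. i * i = - 1 \<and> (\<forall>z. \<exists>a b. z = a *\<^sub>R 1 + b *\<^sub>R i))"
    by (metis i_squared power2_eq_square)
qed


section \<open>Banach spaces and operators\<close>

text \<open>Spaces are structures with explicit carriers, so that a family may have a different space at
  each index. The ring fields \<open>mult\<close> and \<open>one\<close> inherited from \<open>module\<close> carry no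
  information, except in the scalar field.\<close>

record ('k, 'a) nspace = "('k, 'a) module" +
  nrm :: "'a \<Rightarrow> real"

definition scalars :: "('k::real_or_complex, 'k) nspace" where
  "scalars = \<lparr>carrier = UNIV, mult = (*), one = 1, zero = 0, add = (+), smult = (*), nrm = norm\<rparr>"

locale normed_space = module scalars X
  for X :: "('k::real_or_complex, 'a) nspace" (structure) +
  assumes nrm_eq_0: "x \<in> carrier X \<Longrightarrow> nrm X x = 0 \<longleftrightarrow> x = \<zero>\<^bsub>X\<^esub>"
    and nrm_triangle: "\<lbrakk>x \<in> carrier X; y \<in> carrier X\<rbrakk> \<Longrightarrow> nrm X (x \<oplus>\<^bsub>X\<^esub> y) \<le> nrm X x + nrm X y"
    and nrm_smult: "x \<in> carrier X \<Longrightarrow> nrm X (c \<odot>\<^bsub>X\<^esub> x) = norm c * nrm X x"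

text \<open>The case distinction is needed because \<^locale>\<open>Metric_space\<close> asks for nonnegativity and
  symmetry on the whole type.\<close>

definition ndist :: "('k::real_or_complex, 'a) nspace \<Rightarrow> 'a \<Rightarrow> 'a \<Rightarrow> real" where
  "ndist X x y = (if x \<in> carrier X \<and> y \<in> carrier X then nrm X (x \<ominus>\<^bsub>X\<^esub> y) else 0)"

locale banach_space = normed_space +
  assumes complete: "Metric_space.mcomplete (carrier X) (ndist X)"

definition relatively_compact :: "('k::real_or_complex, 'a) nspace \<Rightarrow> 'a set \<Rightarrow> bool" where
  "relatively_compact X A \<longleftrightarrow>
     compactin (Metric_space.mtopology (carrier X) (ndist X))
       (Metric_space.mtopology (carrier X) (ndist X) closure_of A)"

definition ndiam :: "('k::real_or_complex, 'a) nspace \<Rightarrow> 'a set \<Rightarrow> ereal" where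
  "ndiam X A = (SUP (x, y)\<in>A \<times> A. ereal (ndist X x y))"

definition unit_ball :: "('k::real_or_complex, 'a) nspace \<Rightarrow> 'a set" where
  "unit_ball X = {x \<in> carrier X. nrm X x \<le> 1}"

definition bounded_operator ::
  "('k::real_or_complex, 'a) nspace \<Rightarrow> ('k, 'b) nspace \<Rightarrow> ('a \<Rightarrow> 'b) \<Rightarrow> bool" where
  "bounded_operator X Y T \<longleftrightarrow>
     T \<in> carrier X \<rightarrow> carrier Y \<and>
     (\<forall>x\<in>carrier X. \<forall>y\<in>carrier X. T (x \<oplus>\<^bsub>X\<^esub> y) = T x \<oplus>\<^bsub>Y\<^esub> T y) \<and>
     (\<forall>c. \<forall>x\<in>carrier X. T (c \<odot>\<^bsub>X\<^esub> x) = c \<odot>\<^bsub>Y\<^esub> T x) \<and>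
     (\<exists>C. \<forall>x\<in>carrier X. nrm Y (T x) \<le> C * nrm X x)"

definition op_norm ::
  "('k::real_or_complex, 'a) nspace \<Rightarrow> ('k, 'b) nspace \<Rightarrow> ('a \<Rightarrow> 'b) \<Rightarrow> real" where
  "op_norm X Y T = (SUP x\<in>unit_ball X. nrm Y (T x))"


section \<open>Duals and adjoints\<close>

text \<open>Functionals are made extensional, so that equality on the carrier is equality.\<close>

definition dual :: "('k::real_or_complex, 'a) nspace \<Rightarrow> ('k, 'a \<Rightarrow> 'k) nspace" where
  "dual X =
     \<lparr>carrier = {f \<in> extensional (carrier X). bounded_operator X scalars f},
      mult = undefined, one = undefined,
      zero = (\<lambda>x\<in>carrier X. 0),
      add = (\<lambda>f g. \<lambda>x\<in>carrier X. f x + g x),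
      smult = (\<lambda>c f. \<lambda>x\<in>carrier X. c * f x),
      nrm = op_norm X scalars\<rparr>"

definition weak_star :: "('k::real_or_complex, 'a) nspace \<Rightarrow> ('a \<Rightarrow> 'k) topology" where
  "weak_star X =
     subtopology (product_topology (\<lambda>_. euclidean) (carrier X)) (carrier (dual X))"

definition adjoint ::
  "('k::real_or_complex, 'a) nspace \<Rightarrow> ('a \<Rightarrow> 'b) \<Rightarrow> ('b \<Rightarrow> 'k) \<Rightarrow> 'a \<Rightarrow> 'k" where
  "adjoint X T g = (\<lambda>x\<in>carrier X. g (T x))"


section \<open>Ordinals\<close>

unbundle cardinal_syntax

text \<open>The type \<open>'u ordinal\<close> consists of the ordinals below \<open>\<kappa>\<^sup>+\<close>, where \<open>\<kappa>\<close> is the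
  cardinality of \<open>'u\<close>; by \<open>ordinal_represents\<close> below, every well-order on a
  set of elements of \<open>'u\<close> is isomorphic to a proper initial segment.\<close>

typedef 'u ordinal = "Field (cardSuc (card_of (UNIV :: 'u set)))"
proof -
  have "\<not> cardSuc (card_of (UNIV :: 'u set)) \<le>o card_of (UNIV :: 'u set)"
    by (meson cardSuc_greater card_of_Card_order not_ordLess_ordLeq)
  then have "Field (cardSuc (card_of (UNIV :: 'u set))) \<noteq> {}"
    by (metis Field_empty card_of_Card_order card_of_Field_ordIso cardSuc_Card_order
        card_of_empty ordIso_ordLeq_trans ordIso_symmetric)
  then show ?thesis by blast
qed

lemma well_order_cardSuc:
  "well_order_on (Field (cardSuc (card_of (UNIV :: 'u set)))) (cardSuc (card_of (UNIV :: 'u set)))"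
  by (metis card_of_Card_order cardSuc_Card_order card_order_on_well_order_on)

instantiation ordinal :: (type) wellorder
begin

definition less_eq_ordinal :: "'a ordinal \<Rightarrow> 'a ordinal \<Rightarrow> bool" where
  "\<alpha> \<le> \<beta> \<longleftrightarrow> (Rep_ordinal \<alpha>, Rep_ordinal \<beta>) \<in> cardSuc (card_of (UNIV :: 'a set))"

definition less_ordinal :: "'a ordinal \<Rightarrow> 'a ordinal \<Rightarrow> bool" where
  "\<alpha> < \<beta> \<longleftrightarrow> \<alpha> \<le> \<beta> \<and> \<alpha> \<noteq> (\<beta> :: 'a ordinal)"

instance
proof
  have wo: "Well_order (cardSuc (card_of (UNIV :: 'a set)))"
    by (simp add: well_order_cardSuc)
  then have R: "refl_on (Field (cardSuc (card_of (UNIV :: 'a set)))) (cardSuc (card_of (UNIV :: 'a set)))"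
    and T: "trans (cardSuc (card_of (UNIV :: 'a set)))"
    and A: "antisym (cardSuc (card_of (UNIV :: 'a set)))"
    and L: "total_on (Field (cardSuc (card_of (UNIV :: 'a set)))) (cardSuc (card_of (UNIV :: 'a set)))"
    and W: "wf (cardSuc (card_of (UNIV :: 'a set)) - Id)"
    by (simp_all add: order_on_defs)
  fix \<alpha> \<beta> \<gamma> :: "'a ordinal"
  show refl: "\<alpha> \<le> \<alpha>"
    unfolding less_eq_ordinal_def using R Rep_ordinal[of \<alpha>] by (auto simp: refl_on_def)
  show "\<alpha> \<le> \<beta> \<Longrightarrow> \<beta> \<le> \<gamma> \<Longrightarrow> \<alpha> \<le> \<gamma>"
    unfolding less_eq_ordinal_def using T by (meson transD)
  show anti: "\<alpha> \<le> \<beta> \<Longrightarrow> \<beta> \<le> \<alpha> \<Longrightarrow> \<alpha> = \<beta>"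
    unfolding less_eq_ordinal_def using A by (meson Rep_ordinal_inject antisymD)
  show "\<alpha> < \<beta> \<longleftrightarrow> \<alpha> \<le> \<beta> \<and> \<not> \<beta> \<le> \<alpha>"
    unfolding less_ordinal_def using anti refl by blast
  show "\<alpha> \<le> \<beta> \<or> \<beta> \<le> \<alpha>"
    using L R Rep_ordinal[of \<alpha>] Rep_ordinal[of \<beta>] unfolding less_eq_ordinal_def
    by (metis refl_onD total_on_def)
  fix P :: "'a ordinal \<Rightarrow> bool"
  assume step: "\<And>\<alpha>. (\<And>\<beta>. \<beta> < \<alpha> \<Longrightarrow> P \<beta>) \<Longrightarrow> P \<alpha>"
  have "wf {(\<beta> :: 'a ordinal, \<alpha>). \<beta> < \<alpha>}"
    by (rule wf_subset[OF wf_inv_image[OF W, of Rep_ordinal]])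
       (auto simp: inv_image_def less_ordinal_def less_eq_ordinal_def Rep_ordinal_inject)
  then show "P \<alpha>"
    by (induction rule: wf_induct_rule) (blast intro: step)
qed

end

lemma ordinal_represents:
  fixes r :: "'u rel"
  assumes "Well_order r"
  shows "\<exists>(\<alpha> :: 'u ordinal) f. bij_betw f (Field r) {..<\<alpha>} \<and>
           (\<forall>x\<in>Field r. \<forall>y\<in>Field r. (x, y) \<in> r \<longleftrightarrow> f x \<le> f y)"
proof -
  let ?s = "cardSuc (card_of (UNIV :: 'u set))"
  have s: "Well_order ?s" by (simp add: well_order_cardSuc)
  have "\<not> ?s \<le>o r"
  proof
    assume "?s \<le>o r"
    then have "card_of (Field ?s) \<le>o card_of (Field r)"
      by (simp add: card_of_mono2)
    moreover have "card_of (Field r) \<le>o card_of (UNIV :: 'u set)"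
      by (rule card_of_mono1) simp
    moreover have "?s =o card_of (Field ?s)"
      by (metis card_of_Card_order cardSuc_Card_order card_of_Field_ordIso ordIso_symmetric)
    ultimately have "?s \<le>o card_of (UNIV :: 'u set)"
      by (meson ordIso_ordLeq_trans ordLeq_transitive)
    then show False
      by (meson cardSuc_greater card_of_Card_order not_ordLess_ordLeq)
  qed
  then have "r <o ?s" using assms s ordLess_or_ordLeq by blast
  then obtain a where a: "a \<in> Field ?s" and "r =o Restr ?s (underS ?s a)"
    using ordLess_iff_ordIso_Restr[OF s assms] by blast
  then obtain f where "BNF_Wellorder_Embedding.iso r (Restr ?s (underS ?s a)) f" unfolding ordIso_def by blast
  moreover have "Field (Restr ?s (underS ?s a)) = underS ?s a"
    using s by (simp add: Field_Restr_ofilter wo_rel.intro wo_rel.underS_ofilter)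
  ultimately have f: "bij_betw f (Field r) (underS ?s a)"
      "\<forall>x\<in>Field r. \<forall>y\<in>Field r. (x, y) \<in> r \<longleftrightarrow> (f x, f y) \<in> Restr ?s (underS ?s a)"
    unfolding iso_iff2 by auto
  have sub: "underS ?s a \<subseteq> Field ?s" by (auto simp: underS_def Field_def)
  have bij: "bij_betw Abs_ordinal (underS ?s a) {..<Abs_ordinal a}"
  proof (rule bij_betw_byWitness[of _ Rep_ordinal])
    show "\<forall>x\<in>underS ?s a. Rep_ordinal (Abs_ordinal x) = x"
      using sub Abs_ordinal_inverse by blast
    show "\<forall>y\<in>{..<Abs_ordinal a}. Abs_ordinal (Rep_ordinal y) = y"
      by (simp add: Rep_ordinal_inverse)
    show "Abs_ordinal ` underS ?s a \<subseteq> {..<Abs_ordinal a}"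
    proof (rule image_subsetI)
      fix x assume x: "x \<in> underS ?s a"
      then have "x \<in> Field ?s" using sub by blast
      then show "Abs_ordinal x \<in> {..<Abs_ordinal a}"
        using x a by (simp add: less_ordinal_def less_eq_ordinal_def underS_def
            Abs_ordinal_inverse Abs_ordinal_inject)
    qed
    show "Rep_ordinal ` {..<Abs_ordinal a} \<subseteq> underS ?s a"
      using a by (auto simp: less_ordinal_def less_eq_ordinal_def underS_def
          Abs_ordinal_inverse Rep_ordinal_inverse)
  qed
  have "bij_betw (Abs_ordinal \<circ> f) (Field r) {..<Abs_ordinal a}"
    using f(1) bij by (rule bij_betw_trans)
  moreover have "(x, y) \<in> r \<longleftrightarrow> (Abs_ordinal \<circ> f) x \<le> (Abs_ordinal \<circ> f) y"
    if "x \<in> Field r" "y \<in> Field r" for x y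
  proof -
    have u: "f x \<in> underS ?s a" "f y \<in> underS ?s a" using f(1) that by (auto simp: bij_betw_def)
    then have "f x \<in> Field ?s" "f y \<in> Field ?s" using sub by blast+
    then show ?thesis
      using f(2) that u by (simp add: less_eq_ordinal_def Abs_ordinal_inverse)
  qed
  ultimately show ?thesis by blast
qed

unbundle no cardinal_syntax


section \<open>The Szlenk index\<close>

definition szlenk_deriv ::
  "('k::real_or_complex, 'a) nspace \<Rightarrow> real \<Rightarrow> ('a \<Rightarrow> 'k) set \<Rightarrow> ('a \<Rightarrow> 'k) set" where
  "szlenk_deriv X \<epsilon> K =
     {x \<in> K. \<forall>V. openin (weak_star X) V \<longrightarrow> x \<in> V \<longrightarrow> ndiam (dual X) (K \<inter> V) > ereal \<epsilon>}"

function szlenk_iter ::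
  "('k::real_or_complex, 'a) nspace \<Rightarrow> real \<Rightarrow> ('a \<Rightarrow> 'k) set \<Rightarrow> 'o::wellorder \<Rightarrow> ('a \<Rightarrow> 'k) set" where
  "szlenk_iter X \<epsilon> K \<alpha> =
     (if \<forall>\<beta>. \<not> \<beta> < \<alpha> then K
      else if \<exists>\<beta><\<alpha>. \<forall>\<gamma><\<alpha>. \<gamma> \<le> \<beta> then szlenk_deriv X \<epsilon> (szlenk_iter X \<epsilon> K (GREATEST \<beta>. \<beta> < \<alpha>))
      else (\<Inter>\<beta>\<in>{..<\<alpha>}. szlenk_iter X \<epsilon> K \<beta>))"
  by pat_completeness auto
termination
proof (relation "inv_image {(\<beta>, \<alpha>). \<beta> < \<alpha>} (\<lambda>(X, \<epsilon>, K, \<alpha>). \<alpha>)", goal_cases)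
  case 1
  then show ?case by (intro wf_inv_image wf)
next
  case (2 X \<epsilon> K \<alpha>)
  then show ?case by simp (metis (mono_tags, lifting) GreatestI2_order)
qed auto


declare szlenk_iter.simps [simp del]

text \<open>An index is the set of ordinals below it, exactly as for von Neumann ordinals. Hence suprema of
  indices are unions, and the index is \<open>\<infinity>\<close> if and only if it is \<open>UNIV\<close>. The type \<open>'o\<close>
  must be long enough for this. With \<open>'o = 'u ordinal\<close>, where \<open>'u\<close> is infinite and at least as
  large as \<open>K\<close>, it is: the iterates decrease strictly until they become constant, so this happens
  below \<open>\<kappa>\<^sup>+\<close>, and \<open>\<kappa>\<^sup>+\<close> is regular, so the supremum over \<open>\<epsilon> = 1, 1/2, 1/3, \<dots>\<close> of the stages at
  which the iterates become empty is also below \<open>\<kappa>\<^sup>+\<close>.\<close>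

definition Szlenk_eps ::
  "('k::real_or_complex, 'a) nspace \<Rightarrow> real \<Rightarrow> ('a \<Rightarrow> 'k) set \<Rightarrow> 'o::wellorder set" where
  "Szlenk_eps X \<epsilon> K = {\<alpha>. szlenk_iter X \<epsilon> K \<alpha> \<noteq> {}}"

definition Szlenk :: "('k::real_or_complex, 'a) nspace \<Rightarrow> ('a \<Rightarrow> 'k) set \<Rightarrow> 'o::wellorder set" where
  "Szlenk X K = (\<Union>\<epsilon>\<in>{0<..}. Szlenk_eps X \<epsilon> K)"

definition Szlenk_op ::
  "('k::real_or_complex, 'a) nspace \<Rightarrow> ('k, 'b) nspace \<Rightarrow> ('a \<Rightarrow> 'b) \<Rightarrow> 'o::wellorder set" where
  "Szlenk_op X Y T = Szlenk X (adjoint X T ` unit_ball (dual Y))"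


section \<open>Direct sums\<close>

text \<open>The summation index of \<open>lp_sum\<close> ranges over \<open>\<Lambda>\<close>; the values of \<open>E\<close> outside \<open>\<Lambda>\<close> are irrelevant.
  The exponent is meant to satisfy \<open>1 \<le> p \<le> \<infinity>\<close>.\<close>

definition lp_norm :: "ereal \<Rightarrow> 'i set \<Rightarrow> ('i \<Rightarrow> ('k::real_or_complex, 'a) nspace) \<Rightarrow> ('i \<Rightarrow> 'a) \<Rightarrow> real" where
  "lp_norm p \<Lambda> E x =
     (if p = \<infinity> then (SUP l\<in>\<Lambda>. nrm (E l) (x l))
      else (\<Sum>\<^sub>\<infinity>l\<in>\<Lambda>. nrm (E l) (x l) powr real_of_ereal p) powr (1 / real_of_ereal p))"

definition lp_sum ::
  "ereal \<Rightarrow> 'i set \<Rightarrow> ('i \<Rightarrow> ('k::real_or_complex, 'a) nspace) \<Rightarrow> ('k, 'i \<Rightarrow> 'a) nspace" where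
  "lp_sum p \<Lambda> E =
     \<lparr>carrier = {x \<in> (\<Pi>\<^sub>E l\<in>\<Lambda>. carrier (E l)).
        if p = \<infinity> then bdd_above ((\<lambda>l. nrm (E l) (x l)) ` \<Lambda>)
        else (\<lambda>l. nrm (E l) (x l) powr real_of_ereal p) summable_on \<Lambda>},
      mult = undefined, one = undefined,
      zero = (\<lambda>l\<in>\<Lambda>. \<zero>\<^bsub>E l\<^esub>),
      add = (\<lambda>x y. \<lambda>l\<in>\<Lambda>. x l \<oplus>\<^bsub>E l\<^esub> y l),
      smult = (\<lambda>c x. \<lambda>l\<in>\<Lambda>. c \<odot>\<^bsub>E l\<^esub> x l),
      nrm = lp_norm p \<Lambda> E\<rparr>"

definition sum_op :: "'i set \<Rightarrow> ('i \<Rightarrow> 'a \<Rightarrow> 'b) \<Rightarrow> ('i \<Rightarrow> 'a) \<Rightarrow> 'i \<Rightarrow> 'b" where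
  "sum_op \<Lambda> T x = (\<lambda>l\<in>\<Lambda>. T l (x l))"

definition c0 :: "'i set \<Rightarrow> ('i \<Rightarrow> real) set" where
  "c0 \<Lambda> = {a. \<forall>\<epsilon>>0. finite {l\<in>\<Lambda>. \<epsilon> \<le> \<bar>a l\<bar>}}"


section \<open>Asplund operators\<close>

text \<open>The elements of \<open>Linfty M\<close> are classes of measurable functions equal almost everywhere.\<close>

definition Linfty_class :: "'w measure \<Rightarrow> ('w \<Rightarrow> 'k::real_or_complex) \<Rightarrow> ('w \<Rightarrow> 'k) set" where
  "Linfty_class M f = {g \<in> borel_measurable M. AE x in M. g x = f x}"

definition rep :: "('w \<Rightarrow> 'k) set \<Rightarrow> 'w \<Rightarrow> 'k" where
  "rep u = (SOME f. f \<in> u)"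

definition Linfty :: "'w measure \<Rightarrow> ('k::real_or_complex, ('w \<Rightarrow> 'k) set) nspace" where
  "Linfty M =
     \<lparr>carrier = Linfty_class M ` {f \<in> borel_measurable M. \<exists>c. AE x in M. norm (f x) \<le> c},
      mult = undefined, one = undefined,
      zero = Linfty_class M (\<lambda>_. 0),
      add = (\<lambda>u v. Linfty_class M (\<lambda>x. rep u x + rep v x)),
      smult = (\<lambda>c u. Linfty_class M (\<lambda>x. c * rep u x)),
      nrm = (\<lambda>u. Inf {c. 0 \<le> c \<and> (AE x in M. norm (rep u x) \<le> c)})\<rparr>"

text \<open>The underlying set of \<open>M\<close> ranges over subsets of the type \<open>'b \<Rightarrow> 'k\<close> of scalar functions on the
  codomain. This loses no generality. Let \<open>\<mu>\<close> be a finite measure on any set and let \<open>S\<close> be an operator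
  from \<open>Y\<close> into \<open>L\<^sub>\<infinity>(\<mu>)\<close>. Choose a representative \<open>g y\<close> of each \<open>S y\<close>, and \<open>g y = 0\<close> for \<open>y\<close> outside the carrier.
  Push \<open>\<mu>\<close> forward along \<open>\<omega> \<mapsto> (\<lambda>y. g y \<omega>)\<close> to a measure \<open>\<nu>\<close> on the \<open>\<sigma>\<close>-algebra generated by
  evaluations. Composition with this map embeds \<open>L\<^sub>\<infinity>(\<nu>)\<close> isometrically into \<open>L\<^sub>\<infinity>(\<mu>)\<close> and carries
  the operator \<open>y \<mapsto> (evaluation at y)\<close> to \<open>S\<close>, and preimages of sets \<open>B\<close> that work for \<open>\<nu>\<close> work for \<open>\<mu>\<close>.\<close>

definition Asplund_op ::
  "('k::real_or_complex, 'a) nspace \<Rightarrow> ('k, 'b) nspace \<Rightarrow> ('a \<Rightarrow> 'b) \<Rightarrow> bool" where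
  "Asplund_op X Y T \<longleftrightarrow>
     (\<forall>(M :: ('b \<Rightarrow> 'k) measure) S. finite_measure M \<longrightarrow> bounded_operator Y (Linfty M) S \<longrightarrow>
       (\<forall>\<epsilon>>0. \<exists>B\<in>sets M. measure M B > measure M (space M) - \<epsilon> \<and>
          relatively_compact (Linfty M)
            {Linfty_class M (\<lambda>x. rep f x * indicator B x) | f. f \<in> S ` T ` unit_ball X}))"

end

theory Submission
  imports Defs
begin

text \<open>Write \<open>K\<^sub>\<lambda> = T\<^sub>\<lambda>\<^sup>* B\<close>, \<open>T = (\<oplus>T\<^sub>\<lambda>)\<^sub>p\<close> and \<open>K = T\<^sup>* B\<close>. A nonempty set \<open>L \<subseteq> K\<close> contained in its own Szlenk derivative
  forces the index of \<open>K\<close> to be \<open>\<infinity>\<close>; conversely, if the index exceeds the given ordinals, then the iterates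
  become stationary at such an \<open>L\<close>.

  If \<open>(\<parallel>T\<^sub>\<lambda>\<parallel>)\<close> is not in \<open>c\<^sub>0\<close>, Hahn--Banach gives distinct \<open>\<lambda>\<^sub>n\<close>, \<open>f\<^sub>n \<in> K\<^bsub>\<lambda>\<^sub>n\<^esub>\<close> and \<open>u\<^sub>n\<close> in the unit balls with
  \<open>f\<^sub>n u\<^sub>n = c > 0\<close>. For \<open>p = 1\<close> let \<open>L\<close> consist of all sums of the \<open>f\<^sub>n\<close> over sets of indices: flipping a far
  coordinate is a small weak* change of norm at least \<open>c\<close>. For \<open>p = \<infinity>\<close> let \<open>L\<close> be the set of weak* cluster points
  of \<open>(f\<^sub>n)\<close>: the cluster points along two disjoint sets of indices are at distance at least \<open>c\<close>.

  If \<open>(\<parallel>T\<^sub>\<lambda>\<parallel>)\<close> is in \<open>c\<^sub>0\<close>, then the distance of two elements of \<open>K\<close> is controlled, up to a small error, by finitely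
  many coordinates. By upper semicontinuity of the derivation rank, an element of \<open>K\<close> whose coordinates in the \<open>K\<^sub>\<lambda>\<close>
  have ranks \<open>\<beta>\<^sub>\<lambda>\<close> survives at most \<open>\<oplus>\<beta>\<^sub>\<lambda>\<close> (natural sum) derivations. On the other hand an average of \<open>n\<close> elements
  of a convex set that survive \<open>\<beta>\<^sub>1, \<dots>, \<beta>\<^sub>n\<close> derivations survives \<open>\<beta>\<^sub>1 \<oplus> \<dots> \<oplus> \<beta>\<^sub>n\<close> derivations for \<open>\<epsilon>/n\<close>.
  Applied to the coordinate of largest rank, this bounds the index of \<open>K\<close> by that of a single \<open>K\<^sub>\<lambda>\<close>.

  Each \<open>T\<^sub>\<lambda>\<close> has an index: a nonempty \<open>L \<subseteq> szlenk_deriv L\<close> contains a dyadic tree of functionals separated by vectors of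
  the unit ball. Averaging along the tree and a compactness argument give a vector measure with bounded density, thus an
  operator into \<open>L\<^sub>\<infinity>[0, 1)\<close> that maps the separating vectors close to functions jumping on the halves of the dyadic
  intervals, and this is incompatible with relative compactness on a set of positive measure.\<close>

section \<open>Duals of normed spaces\<close>

lemma scalars_simps [simp]:
  "carrier scalars = UNIV" "mult scalars = (*)" "one scalars = 1" "zero scalars = 0"
  "add scalars = (+)" "smult scalars = (*)" "nrm scalars = norm"
  by (simp_all add: scalars_def)

lemma cring_scalars: "cring scalars"
proof (rule cringI)
  show "abelian_group scalars"
    by (rule abelian_groupI) (auto simp: algebra_simps intro: exI[of _ "- _"])
  show "Group.comm_monoid scalars"
    by (rule comm_monoidI) (auto simp: algebra_simps)
qed (auto simp: algebra_simps)

lemma bounded_operator_scalars: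
  "bounded_operator X scalars f \<longleftrightarrow>
     (\<forall>x\<in>carrier X. \<forall>y\<in>carrier X. f (x \<oplus>\<^bsub>X\<^esub> y) = f x + f y) \<and>
     (\<forall>c. \<forall>x\<in>carrier X. f (c \<odot>\<^bsub>X\<^esub> x) = c * f x) \<and>
     (\<exists>C. \<forall>x\<in>carrier X. norm (f x) \<le> C * nrm X x)"
  by (simp add: bounded_operator_def)

lemma dual_simps [simp]:
  "zero (dual X) = (\<lambda>x\<in>carrier X. 0)"
  "add (dual X) = (\<lambda>f g. \<lambda>x\<in>carrier X. f x + g x)"
  "nrm (dual X) = op_norm X scalars"
  by (simp_all add: dual_def)

lemma carrier_dual: "carrier (dual X) = {f \<in> extensional (carrier X). bounded_operator X scalars f}"
  by (simp add: dual_def)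

context normed_space
begin

lemma nrm_zero [simp]: "nrm X \<zero> = 0"
  by (simp add: nrm_eq_0)

lemma smult_0 [simp]: "x \<in> carrier X \<Longrightarrow> 0 \<odot> x = \<zero>"
  using smult_l_null[of x] by simp

lemma smult_1 [simp]: "x \<in> carrier X \<Longrightarrow> 1 \<odot> x = x"
  using smult_one[of x] by simp

lemma minus_eq_smult: "x \<in> carrier X \<Longrightarrow> \<ominus> x = (-1) \<odot> x"
  by (rule M.minus_equality) (use smult_l_distr[of "-1" 1 x] in auto)

lemma nrm_ge_0: "x \<in> carrier X \<Longrightarrow> 0 \<le> nrm X x"
  using nrm_triangle[of x "\<ominus> x"] nrm_smult[of x "-1"] by (simp add: minus_eq_smult[symmetric] M.r_neg)

lemma zero_in_unit_ball [simp]: "\<zero> \<in> unit_ball X"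
  by (simp add: unit_ball_def)

lemma dual_bound_ex:
  assumes "f \<in> carrier (dual X)"
  obtains C where "0 \<le> C" "\<And>x. x \<in> carrier X \<Longrightarrow> norm (f x) \<le> C * nrm X x"
proof -
  from assms obtain C where C: "\<forall>x\<in>carrier X. norm (f x) \<le> C * nrm X x"
    by (auto simp: carrier_dual bounded_operator_scalars)
  have "norm (f x) \<le> max C 0 * nrm X x" if "x \<in> carrier X" for x
    using C that nrm_ge_0[OF that] by (meson max.cobounded1 mult_right_mono order_trans)
  then show ?thesis using that[of "max C 0"] by auto
qed

lemma dual_add: "f \<in> carrier (dual X) \<Longrightarrow> x \<in> carrier X \<Longrightarrow> y \<in> carrier X \<Longrightarrow> f (x \<oplus> y) = f x + f y"
  by (simp add: carrier_dual bounded_operator_scalars)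

lemma dual_smult: "f \<in> carrier (dual X) \<Longrightarrow> x \<in> carrier X \<Longrightarrow> f (c \<odot> x) = c * f x"
  by (simp add: carrier_dual bounded_operator_scalars)

lemma dual_zero: "f \<in> carrier (dual X) \<Longrightarrow> f \<zero> = 0"
  using dual_smult[of f \<zero> 0] by simp

lemma carrier_dualI:
  assumes "f \<in> extensional (carrier X)"
    and "\<And>x y. x \<in> carrier X \<Longrightarrow> y \<in> carrier X \<Longrightarrow> f (x \<oplus> y) = f x + f y"
    and "\<And>c x. x \<in> carrier X \<Longrightarrow> f (c \<odot> x) = c * f x"
    and "\<And>x. x \<in> carrier X \<Longrightarrow> norm (f x) \<le> C * nrm X x"
  shows "f \<in> carrier (dual X)"
  using assms unfolding carrier_dual bounded_operator_scalars by blast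

lemma dual_add_closed:
  assumes "f \<in> carrier (dual X)" "g \<in> carrier (dual X)"
  shows "(\<lambda>x\<in>carrier X. f x + g x) \<in> carrier (dual X)"
proof -
  obtain C D where C: "\<And>x. x \<in> carrier X \<Longrightarrow> norm (f x) \<le> C * nrm X x"
    and D: "\<And>x. x \<in> carrier X \<Longrightarrow> norm (g x) \<le> D * nrm X x"
    using dual_bound_ex assms by metis
  show ?thesis
    by (rule carrier_dualI[where C = "C + D"])
       (use assms C D in \<open>auto simp: dual_add dual_smult algebra_simps intro: norm_triangle_mono\<close>)
qed

lemma dual_smult_closed:
  assumes "f \<in> carrier (dual X)"
  shows "(\<lambda>x\<in>carrier X. c * f x) \<in> carrier (dual X)"
proof -
  obtain C where C: "\<And>x. x \<in> carrier X \<Longrightarrow> norm (f x) \<le> C * nrm X x"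
    using dual_bound_ex assms by metis
  show ?thesis
    by (rule carrier_dualI[where C = "norm c * C"])
       (use assms C in \<open>auto simp: dual_add dual_smult norm_mult distrib_left mult.assoc mult_left_mono\<close>)
qed

lemma dual_zero_closed: "(\<lambda>x\<in>carrier X. 0) \<in> carrier (dual X)"
  by (rule carrier_dualI[where C = 0]) auto

text \<open>\<open>ndist\<close> subtracts with the abstract inverse of \<open>dual X\<close>; the
  group laws identify that subtraction with the pointwise difference.\<close>

lemma dual_abelian_group: "abelian_group (dual X)"
proof (rule abelian_groupI)
  fix f assume f: "f \<in> carrier (dual X)"
  have "(\<lambda>x\<in>carrier X. - 1 * f x) \<in> carrier (dual X)"
    by (rule dual_smult_closed[OF f])
  then show "\<exists>g\<in>carrier (dual X). g \<oplus>\<^bsub>dual X\<^esub> f = \<zero>\<^bsub>dual X\<^esub>"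
    by (rule bexI[rotated]) auto
  show "\<zero>\<^bsub>dual X\<^esub> \<oplus>\<^bsub>dual X\<^esub> f = f"
    using f by (auto simp: carrier_dual extensional_def fun_eq_iff)
qed (auto simp: dual_add_closed dual_zero_closed add_ac cong: restrict_cong)

lemma dual_minus_eq:
  assumes "f \<in> carrier (dual X)" "g \<in> carrier (dual X)"
  shows "f \<ominus>\<^bsub>dual X\<^esub> g = (\<lambda>x\<in>carrier X. f x - g x)"
proof -
  interpret D: abelian_group "dual X" by (rule dual_abelian_group)
  have m: "(\<lambda>x\<in>carrier X. - 1 * g x) \<in> carrier (dual X)"
    by (rule dual_smult_closed[OF assms(2)])
  have "\<ominus>\<^bsub>dual X\<^esub> g = (\<lambda>x\<in>carrier X. - 1 * g x)"
    by (rule D.minus_equality) (use assms m in auto)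
  then show ?thesis by (auto simp: a_minus_def fun_eq_iff)
qed

lemma ndist_dual:
  assumes "f \<in> carrier (dual X)" "g \<in> carrier (dual X)"
  shows "ndist (dual X) f g = (SUP x\<in>unit_ball X. norm (f x - g x))"
  using assms by (auto simp: ndist_def dual_minus_eq op_norm_def unit_ball_def intro!: SUP_cong)

lemma bdd_above_dual:
  assumes "f \<in> carrier (dual X)" "g \<in> carrier (dual X)"
  shows "bdd_above ((\<lambda>x. norm (f x - g x)) ` unit_ball X)"
proof -
  obtain C D where C: "0 \<le> C" "\<And>x. x \<in> carrier X \<Longrightarrow> norm (f x) \<le> C * nrm X x"
    and D: "0 \<le> D" "\<And>x. x \<in> carrier X \<Longrightarrow> norm (g x) \<le> D * nrm X x"
    using dual_bound_ex assms by metis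
  have "norm (f x - g x) \<le> C + D" if "x \<in> unit_ball X" for x
  proof -
    have x: "x \<in> carrier X" "nrm X x \<le> 1" using that by (auto simp: unit_ball_def)
    have "norm (f x) \<le> C" "norm (g x) \<le> D"
      using C D x mult_left_mono[of "nrm X x" 1] by (metis mult.right_neutral order_trans)+
    then show ?thesis using norm_triangle_ineq4[of "f x" "g x"] by linarith
  qed
  then show ?thesis by (rule bdd_aboveI2)
qed

text \<open>A strict lower bound on a supremum is always witnessed, so a diameter above \<epsilon>
  amounts to two functionals and one vector of the unit ball. Later arguments about derivations use
  these witnesses instead of norms.\<close>

lemma ndiam_dual_gt_iff:
  assumes "A \<subseteq> carrier (dual X)"
  shows "ndiam (dual X) A > ereal \<epsilon> \<longleftrightarrow> (\<exists>f\<in>A. \<exists>g\<in>A. \<exists>x\<in>unit_ball X. \<epsilon> < norm (f x - g x))"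
proof -
  have "ndist (dual X) f g > \<epsilon> \<longleftrightarrow> (\<exists>x\<in>unit_ball X. \<epsilon> < norm (f x - g x))" if "f \<in> A" "g \<in> A" for f g
  proof -
    have fg: "f \<in> carrier (dual X)" "g \<in> carrier (dual X)" using assms that by auto
    show ?thesis unfolding ndist_dual[OF fg]
      by (rule less_cSUP_iff[OF _ bdd_above_dual[OF fg]]) (use zero_in_unit_ball in blast)
  qed
  then show ?thesis unfolding ndiam_def by (auto simp: less_SUP_iff)
qed

lemma dual_ball_bound:
  assumes f: "f \<in> unit_ball (dual X)" and x: "x \<in> carrier X"
  shows "norm (f x) \<le> nrm X x"
proof -
  have fc: "f \<in> carrier (dual X)" and f1: "(SUP x\<in>unit_ball X. norm (f x)) \<le> 1"
    using f by (auto simp: unit_ball_def op_norm_def)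
  have b: "bdd_above ((\<lambda>x. norm (f x)) ` unit_ball X)"
    using bdd_above_dual[OF fc dual_zero_closed] by (auto simp: unit_ball_def cong: image_cong_simp)
  show ?thesis
  proof (cases "nrm X x = 0")
    case True
    then show ?thesis using dual_bound_ex[OF fc] x by (metis mult_zero_right)
  next
    case False
    then have pos: "nrm X x > 0" using nrm_ge_0[OF x] by simp
    let ?c = "of_real (1 / nrm X x)"
    have "?c \<odot> x \<in> unit_ball X" using x pos by (simp add: unit_ball_def nrm_smult norm_divide)
    then have "norm (f (?c \<odot> x)) \<le> 1" using f1 cSUP_upper[OF _ b] by fastforce
    then show ?thesis using pos x fc by (simp add: dual_smult norm_mult norm_divide field_simps)
  qed
qed

lemma dual_ballI:
  assumes "f \<in> extensional (carrier X)"
    and "\<And>x y. x \<in> carrier X \<Longrightarrow> y \<in> carrier X \<Longrightarrow> f (x \<oplus> y) = f x + f y"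
    and "\<And>c x. x \<in> carrier X \<Longrightarrow> f (c \<odot> x) = c * f x"
    and "\<And>x. x \<in> carrier X \<Longrightarrow> norm (f x) \<le> nrm X x"
  shows "f \<in> unit_ball (dual X)"
proof -
  have "f \<in> carrier (dual X)" by (rule carrier_dualI[where C = 1]) (use assms in auto)
  moreover have "(SUP x\<in>unit_ball X. norm (f x)) \<le> 1"
    by (rule cSUP_least) (use assms(4) zero_in_unit_ball in \<open>fastforce simp: unit_ball_def\<close>)+
  ultimately show ?thesis by (simp add: unit_ball_def op_norm_def)
qed

end

section \<open>Continuity in the weak* topology\<close>

lemma topspace_weak_star [simp]: "topspace (weak_star X) = carrier (dual X)"
  by (auto simp: weak_star_def carrier_dual PiE_def)

lemma continuous_map_weak_star_eval:
  "x \<in> carrier X \<Longrightarrow> continuous_map (weak_star X) euclidean (\<lambda>f. f x)"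
  unfolding weak_star_def
  by (intro continuous_map_from_subtopology continuous_map_product_projection)

lemma continuous_map_into_weak_star:
  assumes "\<And>z. z \<in> topspace Z \<Longrightarrow> j z \<in> carrier (dual X)"
    and "\<And>x. x \<in> carrier X \<Longrightarrow> continuous_map Z euclidean (\<lambda>z. j z x)"
  shows "continuous_map Z (weak_star X) j"
  unfolding weak_star_def continuous_map_in_subtopology continuous_map_componentwise
  using assms by (auto simp: carrier_dual)

section \<open>Szlenk derivations\<close>

lemma (in normed_space) szlenk_deriv_iff:
  assumes "K \<subseteq> carrier (dual X)"
  shows "f \<in> szlenk_deriv X \<epsilon> K \<longleftrightarrow> f \<in> K \<and> (\<forall>V. openin (weak_star X) V \<longrightarrow> f \<in> V \<longrightarrow>
           (\<exists>g\<in>K \<inter> V. \<exists>h\<in>K \<inter> V. \<exists>x\<in>unit_ball X. \<epsilon> < norm (g x - h x)))"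
proof -
  have "K \<inter> V \<subseteq> carrier (dual X)" for V using assms by auto
  then show ?thesis unfolding szlenk_deriv_def by (simp add: ndiam_dual_gt_iff)
qed

lemma szlenk_deriv_subset: "szlenk_deriv X \<epsilon> K \<subseteq> K"
  by (auto simp: szlenk_deriv_def)

lemma szlenk_deriv_mono:
  assumes "K \<subseteq> L" "\<delta> \<le> \<epsilon>"
  shows "szlenk_deriv X \<epsilon> K \<subseteq> szlenk_deriv X \<delta> L"
proof -
  have "ndiam (dual X) (K \<inter> V) \<le> ndiam (dual X) (L \<inter> V)" for V
    unfolding ndiam_def by (rule SUP_subset_mono) (use assms in auto)
  moreover have "ereal \<delta> \<le> ereal \<epsilon>" using assms by simp
  ultimately show ?thesis
    using assms(1) unfolding szlenk_deriv_def
    by (smt (verit) mem_Collect_eq order.strict_trans1 order.strict_trans2 subset_eq)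
qed

text \<open>One description replaces the cases zero, successor and limit. Iterates decrease, so at a
  successor the last derivative lies in all earlier ones; at a limit every \<beta> < \<alpha> has
  some \<gamma> with \<beta> < \<gamma> < \<alpha>, and the stage \<gamma> already lies in the
  derivative of the stage \<beta>.\<close>

lemma szlenk_iter_eq:
  "szlenk_iter X \<epsilon> K \<alpha> = {f \<in> K. \<forall>\<beta><\<alpha>. f \<in> szlenk_deriv X \<epsilon> (szlenk_iter X \<epsilon> K \<beta>)}"
proof (induction \<alpha> rule: less_induct)
  case (less \<alpha>)
  let ?s = "szlenk_iter X \<epsilon> K" and ?d = "szlenk_deriv X \<epsilon>"
  have anti: "?s \<beta> \<subseteq> ?s \<gamma>" if "\<gamma> \<le> \<beta>" "\<beta> < \<alpha>" for \<beta> \<gamma>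
    unfolding less[OF that(2)] less[OF le_less_trans[OF that]] using that(1) by auto
  consider "\<forall>\<beta>. \<not> \<beta> < \<alpha>" | \<beta> where "\<beta> < \<alpha>" "\<forall>\<gamma><\<alpha>. \<gamma> \<le> \<beta>"
    | "\<exists>\<beta>. \<beta> < \<alpha>" "\<not> (\<exists>\<beta><\<alpha>. \<forall>\<gamma><\<alpha>. \<gamma> \<le> \<beta>)" by blast
  then show ?case
  proof cases
    case 1
    then show ?thesis by (subst szlenk_iter.simps) simp
  next
    case (2 \<beta>)
    have G: "(GREATEST \<beta>. \<beta> < \<alpha>) = \<beta>" by (rule Greatest_equality) (use 2 in auto)
    have "\<not> (\<forall>\<beta>. \<not> \<beta> < \<alpha>)" "\<exists>\<beta><\<alpha>. \<forall>\<gamma><\<alpha>. \<gamma> \<le> \<beta>" using 2 by blast+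
    then have s: "?s \<alpha> = ?d (?s \<beta>)" by (subst szlenk_iter.simps) (simp only: G if_True if_False)
    have "?d (?s \<beta>) \<subseteq> ?d (?s \<gamma>)" if "\<gamma> < \<alpha>" for \<gamma>
      by (rule szlenk_deriv_mono) (use anti 2 that in auto)
    moreover have "?d (?s \<beta>) \<subseteq> K"
      using szlenk_deriv_subset[of X \<epsilon> "?s \<beta>"] less[of \<beta>] 2 by blast
    moreover have "\<beta> < \<alpha>" by fact
    ultimately show ?thesis unfolding s by blast
  next
    case 3
    have s: "?s \<alpha> = (\<Inter>\<beta>\<in>{..<\<alpha>}. ?s \<beta>)"
      using 3 by (subst szlenk_iter.simps, subst if_not_P, blast, subst if_not_P) blast+
    have "f \<in> ?d (?s \<beta>)" if "f \<in> ?s \<alpha>" "\<beta> < \<alpha>" for f \<beta>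
    proof -
      obtain \<gamma> where "\<beta> < \<gamma>" "\<gamma> < \<alpha>" using 3 \<open>\<beta> < \<alpha>\<close> by (meson not_le)
      then have "f \<in> ?s \<gamma>" using that(1) s by blast
      then show ?thesis using \<open>\<beta> < \<gamma>\<close> unfolding less[OF \<open>\<gamma> < \<alpha>\<close>] by blast
    qed
    moreover have "?s \<alpha> \<subseteq> K"
    proof -
      obtain \<beta> where "\<beta> < \<alpha>" using 3 by blast
      then have "?s \<alpha> \<subseteq> ?s \<beta>" using s by blast
      also have "\<dots> \<subseteq> K" unfolding less[OF \<open>\<beta> < \<alpha>\<close>] by blast
      finally show ?thesis .
    qed
    moreover have "f \<in> ?s \<alpha>" if "\<forall>\<beta><\<alpha>. f \<in> ?d (?s \<beta>)" for f
      unfolding s using that szlenk_deriv_subset by blast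
    ultimately show ?thesis by blast
  qed
qed

lemma szlenk_iterD:
  "f \<in> szlenk_iter X \<epsilon> K \<alpha> \<Longrightarrow> \<beta> < \<alpha> \<Longrightarrow> f \<in> szlenk_deriv X \<epsilon> (szlenk_iter X \<epsilon> K \<beta>)"
  using szlenk_iter_eq[of X \<epsilon> K \<alpha>] by blast

lemma szlenk_iter_subset: "szlenk_iter X \<epsilon> K \<alpha> \<subseteq> K"
  by (subst szlenk_iter_eq) auto

lemma szlenk_iter_antimono: "\<beta> \<le> \<alpha> \<Longrightarrow> szlenk_iter X \<epsilon> K \<alpha> \<subseteq> szlenk_iter X \<epsilon> K \<beta>"
  unfolding szlenk_iter_eq[of X \<epsilon> K \<alpha>] szlenk_iter_eq[of X \<epsilon> K \<beta>] by auto

lemma szlenk_iter_eps_mono: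
  assumes "\<delta> \<le> \<epsilon>"
  shows "szlenk_iter X \<epsilon> K \<alpha> \<subseteq> szlenk_iter X \<delta> K \<alpha>"
proof (induction \<alpha> rule: less_induct)
  case (less \<alpha>)
  have "szlenk_deriv X \<epsilon> (szlenk_iter X \<epsilon> K \<beta>) \<subseteq> szlenk_deriv X \<delta> (szlenk_iter X \<delta> K \<beta>)" if "\<beta> < \<alpha>" for \<beta>
    by (rule szlenk_deriv_mono[OF less[OF that] assms])
  then show ?case unfolding szlenk_iter_eq[of X _ K \<alpha>] by blast
qed

text \<open>Derivation is monotone, so no stage can remove a point of a set contained in its own
  derivative.\<close>

lemma self_derived_subset_iter:
  assumes "L \<subseteq> K" "L \<subseteq> szlenk_deriv X \<epsilon> L"
  shows "L \<subseteq> szlenk_iter X \<epsilon> K \<alpha>"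
proof (induction \<alpha> rule: less_induct)
  case (less \<alpha>)
  have "szlenk_deriv X \<epsilon> L \<subseteq> szlenk_deriv X \<epsilon> (szlenk_iter X \<epsilon> K \<beta>)" if "\<beta> < \<alpha>" for \<beta>
    by (rule szlenk_deriv_mono[OF less[OF that]]) simp
  then show ?case unfolding szlenk_iter_eq[of X _ K \<alpha>] using assms by blast
qed

lemma Szlenk_eq_UNIV:
  assumes "L \<subseteq> K" "L \<subseteq> szlenk_deriv X \<epsilon> L" "L \<noteq> {}" "0 < \<epsilon>"
  shows "Szlenk X K = UNIV"
proof -
  have "szlenk_iter X \<epsilon> K \<alpha> \<noteq> {}" for \<alpha>
    using self_derived_subset_iter[OF assms(1,2)] assms(3) by blast
  then show ?thesis using assms(4) by (auto simp: Szlenk_def Szlenk_eps_def)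
qed

text \<open>The stage \<beta> is the derivation rank of \<open>f\<close>, the last stage containing
  \<open>f\<close>. It is found below the least stage that misses \<open>f\<close>.\<close>

lemma szlenk_rank:
  fixes \<alpha> :: "'o::wellorder"
  assumes "f \<in> K" "f \<notin> szlenk_iter X \<epsilon> K \<alpha>"
  shows "\<exists>\<beta>::'o. f \<in> szlenk_iter X \<epsilon> K \<beta> \<and> f \<notin> szlenk_deriv X \<epsilon> (szlenk_iter X \<epsilon> K \<beta>)"
proof -
  obtain \<gamma> :: 'o where \<gamma>: "f \<notin> szlenk_iter X \<epsilon> K \<gamma>" "\<forall>\<beta><\<gamma>. f \<in> szlenk_iter X \<epsilon> K \<beta>"
    using assms(2) exists_least_iff[of "\<lambda>\<gamma>. f \<notin> szlenk_iter X \<epsilon> K \<gamma>"] by blast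
  then obtain \<beta> where "\<beta> < \<gamma>" "f \<notin> szlenk_deriv X \<epsilon> (szlenk_iter X \<epsilon> K \<beta>)"
    using assms(1) szlenk_iter_eq[of X \<epsilon> K \<gamma>] by blast
  then show ?thesis using \<gamma>(2) by blast
qed

text \<open>Weak* continuity pulls a neighbourhood of \<open>j f\<close> back to one of
  \<open>f\<close>; two far apart points found there have images at least as far apart. So
  \<open>j\<close> maps survivors to survivors.\<close>

lemma szlenk_iter_transfer:
  assumes X: "normed_space X" and Y: "normed_space Y"
    and K: "K \<subseteq> carrier (dual X)" and L: "L \<subseteq> carrier (dual Y)"
    and cont: "continuous_map (weak_star X) (weak_star Y) j" and jK: "j ` K \<subseteq> L"
    and dist: "\<And>f g x. f \<in> K \<Longrightarrow> g \<in> K \<Longrightarrow> x \<in> unit_ball X \<Longrightarrow>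
                 \<exists>y\<in>unit_ball Y. norm (f x - g x) \<le> norm (j f y - j g y)"
  shows "j ` szlenk_iter X \<epsilon> K \<alpha> \<subseteq> szlenk_iter Y \<epsilon> L \<alpha>"
proof (induction \<alpha> rule: less_induct)
  case (less \<alpha>)
  have "j f \<in> szlenk_deriv Y \<epsilon> (szlenk_iter Y \<epsilon> L \<beta>)"
    if "\<beta> < \<alpha>" "f \<in> szlenk_deriv X \<epsilon> (szlenk_iter X \<epsilon> K \<beta>)" for \<beta> f
  proof -
    let ?K = "szlenk_iter X \<epsilon> K \<beta>" and ?L = "szlenk_iter Y \<epsilon> L \<beta>"
    have K': "?K \<subseteq> carrier (dual X)" and L': "?L \<subseteq> carrier (dual Y)"
      using K L szlenk_iter_subset[of X \<epsilon> K \<beta>] szlenk_iter_subset[of Y \<epsilon> L \<beta>] by blast+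
    have KL: "j ` ?K \<subseteq> ?L" using less that by simp
    have f: "f \<in> ?K" using that(2) szlenk_deriv_subset[of X \<epsilon> ?K] by blast
    show ?thesis unfolding normed_space.szlenk_deriv_iff[OF Y L']
    proof (intro conjI allI impI)
      show "j f \<in> ?L" using KL f by blast
      fix V assume V: "openin (weak_star Y) V" "j f \<in> V"
      let ?U = "{h \<in> topspace (weak_star X). j h \<in> V}"
      have "openin (weak_star X) ?U" by (rule openin_continuous_map_preimage[OF cont V(1)])
      moreover have "f \<in> ?U" using V(2) K' f by auto
      ultimately have "\<exists>g\<in>?K \<inter> ?U. \<exists>h\<in>?K \<inter> ?U. \<exists>x\<in>unit_ball X. \<epsilon> < norm (g x - h x)"
        using that(2) unfolding normed_space.szlenk_deriv_iff[OF X K'] by meson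
      then obtain g h x where gh: "g \<in> ?K \<inter> ?U" "h \<in> ?K \<inter> ?U" "x \<in> unit_ball X" "\<epsilon> < norm (g x - h x)"
        by meson
      moreover have "g \<in> K" "h \<in> K" using gh szlenk_iter_subset[of X \<epsilon> K \<beta>] by auto
      ultimately obtain y where "y \<in> unit_ball Y" "norm (g x - h x) \<le> norm (j g y - j h y)"
        using dist[of g h x] by meson
      then show "\<exists>g\<in>?L \<inter> V. \<exists>h\<in>?L \<inter> V. \<exists>x\<in>unit_ball Y. \<epsilon> < norm (g x - h x)"
        using gh KL by (intro bexI[of _ "j g"] bexI[of _ "j h"] bexI[of _ y]) auto
    qed
  qed
  then show ?case
    unfolding szlenk_iter_eq[of X _ K \<alpha>] szlenk_iter_eq[of Y _ L \<alpha>] using jK by blast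
qed


section \<open>Cardinalities of sets of ordinals\<close>

unbundle cardinal_syntax

text \<open>The ordinals of this type form the successor cardinal of the cardinality of
  \<open>'u\<close>, so there are strictly more of them than elements of \<open>'u\<close>.\<close>

lemma not_inj_ordinal: "\<not> inj (g :: 'u ordinal \<Rightarrow> 'u)"
proof
  let ?s = "cardSuc (card_of (UNIV :: 'u set))"
  assume "inj g"
  then have "inj_on (g \<circ> Abs_ordinal) (Field ?s)"
    by (intro comp_inj_on inj_onI) (simp_all add: Abs_ordinal_inject inj_eq)
  then have "card_of (Field ?s) \<le>o card_of (UNIV :: 'u set)"
    using card_of_ordLeq[of "Field ?s" "UNIV :: 'u set"] by blast
  moreover have "?s =o card_of (Field ?s)"
    by (metis card_of_Card_order cardSuc_Card_order card_of_Field_ordIso ordIso_symmetric)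
  ultimately show False
    by (meson cardSuc_greater card_of_Card_order not_ordLess_ordLeq ordIso_ordLeq_trans)
qed

text \<open>A proper initial segment of a cardinal is smaller than it, and smaller than a successor
  cardinal means at most its predecessor.\<close>

lemma card_lessThan_ordinal: "card_of {..<\<alpha> :: 'u ordinal} \<le>o card_of (UNIV :: 'u set)"
proof -
  let ?s = "cardSuc (card_of (UNIV :: 'u set))"
  have s: "Card_order ?s" using card_of_Card_order cardSuc_Card_order by blast
  have "Rep_ordinal ` {..<\<alpha>} \<subseteq> underS ?s (Rep_ordinal \<alpha>)"
    by (auto simp: less_ordinal_def less_eq_ordinal_def underS_def Rep_ordinal_inject)
  then have "card_of {..<\<alpha>} \<le>o card_of (underS ?s (Rep_ordinal \<alpha>))"
    using card_of_ordLeq[of "{..<\<alpha>}" "underS ?s (Rep_ordinal \<alpha>)"] Rep_ordinal_inject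
    by (metis inj_onI)
  moreover have "card_of (underS ?s (Rep_ordinal \<alpha>)) <o ?s"
    by (rule card_of_underS[OF s Rep_ordinal])
  ultimately show ?thesis
    by (meson card_of_Card_order cardSuc_ordLess_ordLeq cardSuc_ordLeq_ordLess ordLeq_ordLess_trans)
qed

text \<open>Regularity of a successor cardinal: for infinite \<kappa>, a union of at most \<kappa>
  segments of size at most \<kappa> has size at most \<kappa> and cannot exhaust the
  ordinals.\<close>

lemma ordinal_family_bounded:
  fixes f :: "'j \<Rightarrow> 'u ordinal" and e :: "'j \<Rightarrow> 'u"
  assumes "infinite (UNIV :: 'u set)" "inj_on e J"
  shows "\<exists>\<alpha>. \<forall>j\<in>J. f j \<le> \<alpha>"
proof (rule ccontr)
  assume "\<not> ?thesis"
  then have U: "(UNIV :: 'u ordinal set) = (\<Union>j\<in>J. {..<f j})" by (force simp: not_le)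
  have "card_of J \<le>o card_of (UNIV :: 'u set)"
    using card_of_ordLeq[of J "UNIV :: 'u set"] assms(2) by blast
  then have "card_of (\<Union>j\<in>J. {..<f j}) \<le>o card_of (UNIV :: 'u set)"
    by (intro card_of_UNION_ordLeq_infinite) (use assms card_lessThan_ordinal in auto)
  then show False
    unfolding U[symmetric] using not_inj_ordinal card_of_ordLeq[of "UNIV :: 'u ordinal set" "UNIV :: 'u set"]
    by blast
qed

unbundle no cardinal_syntax

text \<open>If no nonempty subset of \<open>K\<close> were contained in its derivative, each iterate
  could name a point that it loses. As the iterates are nonempty at all stages, this would embed the
  ordinals into the functionals and, through \<open>e\<close>, into \<open>'u\<close>.\<close>

lemma self_derived_exists:
  fixes K :: "('a \<Rightarrow> 'k::real_or_complex) set" and e :: "('a \<Rightarrow> 'k) \<Rightarrow> 'u"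
  assumes U: "Szlenk_eps X \<epsilon> K = (UNIV :: 'u ordinal set)" and e: "inj e"
  shows "\<exists>L. L \<subseteq> K \<and> L \<noteq> {} \<and> L \<subseteq> szlenk_deriv X \<epsilon> L"
proof (rule ccontr)
  assume no: "\<not> ?thesis"
  let ?s = "\<lambda>\<alpha> :: 'u ordinal. szlenk_iter X \<epsilon> K \<alpha>"
  have "\<exists>f. f \<in> ?s \<alpha> \<and> f \<notin> szlenk_deriv X \<epsilon> (?s \<alpha>)" for \<alpha>
  proof -
    have "?s \<alpha> \<noteq> {}" using U unfolding Szlenk_eps_def by blast
    then have "\<not> ?s \<alpha> \<subseteq> szlenk_deriv X \<epsilon> (?s \<alpha>)"
      using no szlenk_iter_subset[of X \<epsilon> K \<alpha>] by blast
    then show ?thesis by blast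
  qed
  then obtain c where c: "\<And>\<alpha>. c \<alpha> \<in> ?s \<alpha>" "\<And>\<alpha>. c \<alpha> \<notin> szlenk_deriv X \<epsilon> (?s \<alpha>)" by metis
  \<comment> \<open>The later point survives the derivation of the stage \<alpha>;
    \<open>c \<alpha>\<close> does not.\<close>
  have "c \<alpha> \<noteq> c \<beta>" if "\<alpha> < \<beta>" for \<alpha> \<beta>
    using c[of \<alpha>] c[of \<beta>] that szlenk_iter_eq[of X \<epsilon> K \<beta>] by auto
  then have "inj c" by (metis injI linorder_neqE)
  then have "inj (e \<circ> c)" using e by (simp add: inj_compose)
  then show False using not_inj_ordinal by blast
qed

text \<open>Countably many values of \<epsilon> suffice, since iterates grow as \<epsilon> shrinks.
  So only the stages at which the iterates of \<open>K l\<close> for \<open>1 / Suc n\<close> become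
  empty must be bounded, and by \<open>e\<close> there are few enough pairs \<open>(l, n)\<close>
  for that.\<close>

lemma Szlenk_UN_neq_UNIV:
  fixes K :: "'l \<Rightarrow> ('a \<Rightarrow> 'k::real_or_complex) set" and e :: "'l \<times> nat \<Rightarrow> 'u"
  assumes inf: "infinite (UNIV :: 'u set)" and e: "inj e"
    and K: "\<And>l \<epsilon>. l \<in> \<Lambda> \<Longrightarrow> 0 < \<epsilon> \<Longrightarrow> Szlenk_eps (X l) \<epsilon> (K l) \<noteq> (UNIV :: 'u ordinal set)"
  shows "(\<Union>l\<in>\<Lambda>. Szlenk (X l) (K l)) \<noteq> (UNIV :: 'u ordinal set)"
proof -
  have "\<exists>\<alpha>. l \<in> \<Lambda> \<longrightarrow> szlenk_iter (X l) (1 / Suc n) (K l) (\<alpha> :: 'u ordinal) = {}" for l n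
    using K[of l "1 / Suc n"] by (auto simp: Szlenk_eps_def)
  then obtain a :: "'l \<Rightarrow> nat \<Rightarrow> 'u ordinal"
    where a: "\<And>l n. l \<in> \<Lambda> \<Longrightarrow> szlenk_iter (X l) (1 / Suc n) (K l) (a l n) = {}" by metis
  obtain \<alpha> where \<alpha>: "\<And>j. (\<lambda>(l, n). a l n) j \<le> \<alpha>"
    using ordinal_family_bounded[OF inf e, of "\<lambda>(l, n). a l n"] by auto
  have "szlenk_iter (X l) \<epsilon> (K l) \<alpha> = {}" if l: "l \<in> \<Lambda>" and pos: "0 < \<epsilon>" for l \<epsilon>
  proof -
    obtain n where n: "1 / Suc n \<le> \<epsilon>" using nat_approx_posE[OF pos] by (metis less_imp_le)
    have "a l n \<le> \<alpha>" using \<alpha>[of "(l, n)"] by simp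
    then show ?thesis
      using a[OF l, of n] szlenk_iter_antimono[of "a l n" \<alpha> "X l" \<epsilon> "K l"]
        szlenk_iter_eps_mono[OF n, of "X l" "K l" "a l n"] by blast
  qed
  then have "\<alpha> \<notin> (\<Union>l\<in>\<Lambda>. Szlenk (X l) (K l))" by (auto simp: Szlenk_def Szlenk_eps_def)
  then show ?thesis by blast
qed

section \<open>The Hahn--Banach theorem\<close>

text \<open>Membership in \<open>extensional\<close> makes all these functionals agree off the
  carrier, so the pointwise order on the whole type is the order on the carrier.\<close>

definition sublinear :: "('k::real_or_complex, 'a) nspace \<Rightarrow> ('a \<Rightarrow> real) \<Rightarrow> bool" where
  "sublinear X q \<longleftrightarrow> (\<forall>x\<in>carrier X. \<forall>y\<in>carrier X. q (x \<oplus>\<^bsub>X\<^esub> y) \<le> q x + q y) \<and>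
     (\<forall>r>0. \<forall>x\<in>carrier X. q (of_real r \<odot>\<^bsub>X\<^esub> x) = r * q x) \<and> q \<in> extensional (carrier X)"

text \<open>The largest sublinear functional below \<open>q\<close> whose value at \<open>\<ominus> v\<close> is \<open>- q v\<close>. At a minimal \<open>q\<close> it is
  \<open>q\<close> itself, which makes \<open>q\<close> additive.\<close>

definition flatten :: "('k::real_or_complex, 'a) nspace \<Rightarrow> ('a \<Rightarrow> real) \<Rightarrow> 'a \<Rightarrow> 'a \<Rightarrow> real" where
  "flatten X q v = (\<lambda>x\<in>carrier X. INF t\<in>{0..}. q (x \<oplus>\<^bsub>X\<^esub> of_real t \<odot>\<^bsub>X\<^esub> v) - t * q v)"

context normed_space
begin

lemma smult_closed' [simp]: "x \<in> carrier X \<Longrightarrow> c \<odot> x \<in> carrier X"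
  by (rule smult_closed) auto

lemma smult_add_l: "x \<in> carrier X \<Longrightarrow> (a + b) \<odot> x = a \<odot> x \<oplus> b \<odot> x"
  using smult_l_distr[of a b x] by simp

lemma smult_add_r: "x \<in> carrier X \<Longrightarrow> y \<in> carrier X \<Longrightarrow> a \<odot> (x \<oplus> y) = a \<odot> x \<oplus> a \<odot> y"
  using smult_r_distr[of a x y] by simp

lemma smult_assoc: "x \<in> carrier X \<Longrightarrow> a \<odot> (b \<odot> x) = (a * b) \<odot> x"
  using smult_assoc1[of a b x] by simp

lemma sublinearD:
  assumes "sublinear X q" "x \<in> carrier X"
  shows "y \<in> carrier X \<Longrightarrow> q (x \<oplus> y) \<le> q x + q y" "r > 0 \<Longrightarrow> q (of_real r \<odot> x) = r * q x"
  using assms by (auto simp: sublinear_def)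

lemma sublinear_zero:
  assumes "sublinear X q"
  shows "q \<zero> = 0"
  using sublinearD(2)[OF assms, of \<zero> 2] smult_r_null[of 2] by simp

lemma sublinear_homogeneous:
  assumes "sublinear X q" "x \<in> carrier X" "r \<ge> 0"
  shows "q (of_real r \<odot> x) = r * q x"
  using sublinearD(2)[OF assms(1,2), of r] assms sublinear_zero by (cases "r = 0") auto

lemma sublinear_minus:
  assumes "sublinear X q" "x \<in> carrier X"
  shows "- q (\<ominus> x) \<le> q x"
  using sublinearD(1)[OF assms, of "\<ominus> x"] sublinear_zero[OF assms(1)] assms by (simp add: M.r_neg)

text \<open>The bound does not depend on \<open>t\<close>, so the infimum defining
  \<open>flatten\<close> is over a set bounded below. It is subadditivity for the decomposition of
  \<open>t v\<close> into \<open>x + t v\<close> and \<open>- x\<close>.\<close>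

lemma flatten_bound:
  assumes q: "sublinear X q" and v: "v \<in> carrier X" and x: "x \<in> carrier X" and t: "t \<ge> 0"
  shows "- q (\<ominus> x) \<le> q (x \<oplus> of_real t \<odot> v) - t * q v"
proof -
  have "q (of_real t \<odot> v) \<le> q (x \<oplus> of_real t \<odot> v) + q (\<ominus> x)"
    using sublinearD(1)[OF q, of "x \<oplus> of_real t \<odot> v" "\<ominus> x"] x v
    by (simp add: M.a_comm[of _ "\<ominus> x"] M.a_assoc[symmetric] M.l_neg)
  then show ?thesis using sublinear_homogeneous[OF q v t] by simp
qed

lemma flatten_le:
  assumes q: "sublinear X q" and v: "v \<in> carrier X" and x: "x \<in> carrier X" and t: "t \<ge> 0"
  shows "flatten X q v x \<le> q (x \<oplus> of_real t \<odot> v) - t * q v"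
  unfolding flatten_def restrict_apply'[OF x]
  by (rule cINF_lower) (use t flatten_bound[OF q v x] in \<open>auto intro!: bdd_belowI2\<close>)

lemma flatten_greatest:
  assumes x: "x \<in> carrier X" and "\<And>t. t \<ge> 0 \<Longrightarrow> c \<le> q (x \<oplus> of_real t \<odot> v) - t * q v"
  shows "c \<le> flatten X q v x"
  unfolding flatten_def restrict_apply'[OF x]
  by (rule cINF_greatest) (use assms in auto)

text \<open>Parameters \<open>t\<close> and \<open>s\<close> for two vectors combine to
  \<open>t + s\<close> for their sum; scaling a vector by \<open>r\<close> scales the parameter by
  \<open>r\<close>.\<close>

lemma sublinear_flatten:
  assumes q: "sublinear X q" and v: "v \<in> carrier X"
  shows "sublinear X (flatten X q v)"
  unfolding sublinear_def
proof (intro conjI ballI allI impI)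
  fix x y assume x: "x \<in> carrier X" and y: "y \<in> carrier X"
  have 1: "flatten X q v (x \<oplus> y) \<le> (q (x \<oplus> of_real t \<odot> v) - t * q v) + (q (y \<oplus> of_real s \<odot> v) - s * q v)"
    if "t \<ge> 0" "s \<ge> 0" for s t
  proof -
    have e: "x \<oplus> y \<oplus> of_real (t + s) \<odot> v = (x \<oplus> of_real t \<odot> v) \<oplus> (y \<oplus> of_real s \<odot> v)"
      using x y v by (simp add: smult_add_l M.a_ac)
    have "flatten X q v (x \<oplus> y) \<le> q (x \<oplus> y \<oplus> of_real (t + s) \<odot> v) - (t + s) * q v"
      by (rule flatten_le[OF q v]) (use x y that in auto)
    also have "q (x \<oplus> y \<oplus> of_real (t + s) \<odot> v) \<le> q (x \<oplus> of_real t \<odot> v) + q (y \<oplus> of_real s \<odot> v)"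
      unfolding e by (rule sublinearD(1)[OF q]) (use x y v in auto)
    finally show ?thesis by (simp add: algebra_simps)
  qed
  have "flatten X q v (x \<oplus> y) - (q (x \<oplus> of_real t \<odot> v) - t * q v) \<le> flatten X q v y" if "t \<ge> 0" for t
    by (rule flatten_greatest[OF y]) (use 1[OF that] in \<open>simp add: algebra_simps\<close>)
  then have "flatten X q v (x \<oplus> y) - flatten X q v y \<le> flatten X q v x"
    by (intro flatten_greatest[OF x]) (simp add: algebra_simps)
  then show "flatten X q v (x \<oplus> y) \<le> flatten X q v x + flatten X q v y" by simp
next
  have le: "flatten X q v (of_real r \<odot> x) \<le> r * flatten X q v x" if r: "r > 0" and x: "x \<in> carrier X" for r x
  proof -
    have "flatten X q v (of_real r \<odot> x) / r \<le> flatten X q v x"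
    proof (rule flatten_greatest[OF x])
      fix t :: real assume t: "t \<ge> 0"
      have "flatten X q v (of_real r \<odot> x) \<le> q (of_real r \<odot> x \<oplus> of_real (r * t) \<odot> v) - (r * t) * q v"
        by (rule flatten_le[OF q v]) (use x r t in auto)
      also have "of_real r \<odot> x \<oplus> of_real (r * t) \<odot> v = of_real r \<odot> (x \<oplus> of_real t \<odot> v)"
        using x v by (simp add: smult_add_r smult_assoc)
      also have "q (of_real r \<odot> (x \<oplus> of_real t \<odot> v)) = r * q (x \<oplus> of_real t \<odot> v)"
        by (rule sublinearD(2)[OF q]) (use x v r in auto)
      finally show "flatten X q v (of_real r \<odot> x) / r \<le> q (x \<oplus> of_real t \<odot> v) - t * q v"
        using r by (simp add: field_simps)
    qed
    then show ?thesis using r by (simp add: field_simps)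
  qed
  fix r :: real and x assume r: "r > 0" and x: "x \<in> carrier X"
  \<comment> \<open>The reverse inequality is the one just shown, applied with \<open>1 / r\<close>
    to the scaled vector.\<close>
  have "flatten X q v (of_real (1 / r) \<odot> (of_real r \<odot> x)) \<le> (1 / r) * flatten X q v (of_real r \<odot> x)"
    by (rule le) (use r x in auto)
  then have "r * flatten X q v x \<le> flatten X q v (of_real r \<odot> x)"
    using r x by (simp add: smult_assoc field_simps flip: of_real_mult)
  then show "flatten X q v (of_real r \<odot> x) = r * flatten X q v x" using le[OF r x] by simp
qed (simp add: flatten_def)

lemma sublinear_nrm: "sublinear X (restrict (nrm X) (carrier X))"
  by (simp add: sublinear_def nrm_triangle nrm_smult)

text \<open>Zorn's lemma gives a minimal sublinear functional below \<open>p\<close>. Flattening it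
  along any \<open>v\<close> cannot lower it, and the parameter \<open>t = 1\<close> then says that
  it is superadditive.\<close>

lemma minimal_sublinear:
  assumes p: "sublinear X p"
  shows "\<exists>u. sublinear X u \<and> (\<forall>x\<in>carrier X. u x \<le> p x) \<and>
    (\<forall>x\<in>carrier X. \<forall>y\<in>carrier X. u (x \<oplus> y) = u x + u y)"
proof -
  let ?A = "{q. sublinear X q \<and> (\<forall>x\<in>carrier X. q x \<le> p x)}"
  let ?P = "\<lambda>a b. \<forall>x. (b x :: real) \<le> a x"
  have "\<exists>m\<in>?A. \<forall>a\<in>?A. ?P m a \<longrightarrow> a = m"
  proof (rule predicate_Zorn)
    show "partial_order_on ?A (relation_of ?P ?A)"
      by (rule partial_order_on_relation_ofI) (auto intro: order_trans simp: fun_eq_iff order_antisym)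
    fix C assume C: "C \<in> Chains (relation_of ?P ?A)"
    then have CA: "C \<subseteq> ?A" and ch: "\<And>a b. a \<in> C \<Longrightarrow> b \<in> C \<Longrightarrow> ?P a b \<or> ?P b a"
      unfolding Chains_def relation_of_def by blast+
    show "\<exists>u\<in>?A. \<forall>a\<in>C. ?P a u"
    proof (cases "C = {}")
      case True
      then show ?thesis using p by blast
    next
      case False
      define u where "u = (\<lambda>x\<in>carrier X. INF q\<in>C. q x)"
      \<comment> \<open>All members of the chain share this lower bound, so the pointwise infimum is
        finite.\<close>
      have low: "- p (\<ominus> x) \<le> q x" if "q \<in> C" "x \<in> carrier X" for q x
      proof -
        have "sublinear X q" "q (\<ominus> x) \<le> p (\<ominus> x)" using CA that by auto
        then show ?thesis using sublinear_minus[of q x] that by linarith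
      qed
      have le: "u x \<le> q x" if "q \<in> C" "x \<in> carrier X" for q x
        unfolding u_def restrict_apply'[OF that(2)]
        by (rule cINF_lower[OF _ that(1)]) (use low that in \<open>auto intro!: bdd_belowI2\<close>)
      have gr: "c \<le> u x" if "\<And>q. q \<in> C \<Longrightarrow> c \<le> q x" "x \<in> carrier X" for c x
        unfolding u_def restrict_apply'[OF that(2)] by (rule cINF_greatest) (use False that in auto)
      have ext: "u x = q x" if "q \<in> C" "x \<notin> carrier X" for q x
        using that CA by (auto simp: u_def sublinear_def extensional_def)
      have "sublinear X u"
        unfolding sublinear_def
      proof (intro conjI ballI allI impI)
        fix x y assume x: "x \<in> carrier X" and y: "y \<in> carrier X"
        \<comment> \<open>Two members of the chain are comparable; subadditivity of the smaller one
          bounds the value at the sum.\<close>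
        have 1: "u (x \<oplus> y) \<le> a x + b y" if "a \<in> C" "b \<in> C" for a b
        proof -
          have s: "sublinear X a" "sublinear X b" using CA that by auto
          show ?thesis
            using ch[OF that]
          proof
            assume "?P a b"
            then have "b x \<le> a x" by blast
            then show ?thesis using le[of b "x \<oplus> y"] sublinearD(1)[OF s(2) x y] that x y by simp
          next
            assume "?P b a"
            then have "a y \<le> b y" by blast
            then show ?thesis using le[of a "x \<oplus> y"] sublinearD(1)[OF s(1) x y] that x y by simp
          qed
        qed
        have "u (x \<oplus> y) - a x \<le> u y" if "a \<in> C" for a
          by (rule gr[OF _ y]) (use 1[OF that] in \<open>simp add: algebra_simps\<close>)
        then have "u (x \<oplus> y) - u y \<le> u x"
          by (intro gr[OF _ x]) (simp add: algebra_simps)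
        then show "u (x \<oplus> y) \<le> u x + u y" by simp
      next
        fix r :: real and x assume r: "r > 0" and x: "x \<in> carrier X"
        have hom: "q (of_real r \<odot> x) = r * q x" if "q \<in> C" for q
          using CA that sublinearD(2)[of q x r] r x by auto
        have "u (of_real r \<odot> x) / r \<le> u x"
          by (rule gr[OF _ x]) (use le[of _ "of_real r \<odot> x"] hom r x in \<open>simp add: field_simps\<close>)
        moreover have "r * u x \<le> u (of_real r \<odot> x)"
        proof (rule gr)
          fix q assume q: "q \<in> C"
          show "r * u x \<le> q (of_real r \<odot> x)"
            unfolding hom[OF q] by (rule mult_left_mono[OF le[OF q x]]) (use r in simp)
        qed (use x in simp)
        ultimately show "u (of_real r \<odot> x) = r * u x" using r by (simp add: field_simps)
      qed (simp add: u_def)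
      moreover have "u x \<le> p x" if "x \<in> carrier X" for x
        using False le[OF _ that] CA that by fastforce
      moreover have "u x \<le> a x" if "a \<in> C" for a x
        using le[OF that] ext[OF that] by (cases "x \<in> carrier X") auto
      ultimately show ?thesis by (intro bexI[of _ u]) auto
    qed
  qed
  then obtain u where u: "sublinear X u" "\<forall>x\<in>carrier X. u x \<le> p x"
    and min: "\<And>a. a \<in> ?A \<Longrightarrow> ?P u a \<Longrightarrow> a = u" by blast
  have "u x + u v \<le> u (x \<oplus> v)" if x: "x \<in> carrier X" and v: "v \<in> carrier X" for x v
  proof -
    have le: "flatten X u v x \<le> u x" if "x \<in> carrier X" for x
      using flatten_le[OF u(1) v that, of 0] that v by simp
    have "flatten X u v = u"
    proof (rule min)
      show "flatten X u v \<in> ?A" using sublinear_flatten[OF u(1) v] le u(2) by fastforce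
      have "flatten X u v x = u x" if "x \<notin> carrier X" for x
        using that u(1) by (auto simp: flatten_def sublinear_def extensional_def)
      then show "?P u (flatten X u v)" using le by (metis order_refl)
    qed
    then show ?thesis using flatten_le[OF u(1) v x, of 1] v by simp
  qed
  then show ?thesis using u sublinearD(1)[OF u(1)] by (intro exI[of _ u]) (auto intro: antisym)
qed

text \<open>Flattening the norm along \<open>x0\<close> before minimizing forces the value at
  \<open>\<ominus> x0\<close> down to \<open>- nrm X x0\<close>, hence the value at
  \<open>x0\<close> up to the norm.\<close>

theorem real_Hahn_Banach:
  assumes x0: "x0 \<in> carrier X"
  shows "\<exists>u. (\<forall>x\<in>carrier X. \<forall>y\<in>carrier X. u (x \<oplus> y) = u x + u y) \<and>
    (\<forall>r. \<forall>x\<in>carrier X. u (of_real r \<odot> x) = r * u x) \<and>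
    (\<forall>x\<in>carrier X. u x \<le> nrm X x) \<and> u x0 = nrm X x0"
proof -
  let ?n = "restrict (nrm X) (carrier X)"
  let ?p = "flatten X ?n x0"
  obtain u where u: "sublinear X u" "\<And>x. x \<in> carrier X \<Longrightarrow> u x \<le> ?p x"
    and add: "\<And>x y. x \<in> carrier X \<Longrightarrow> y \<in> carrier X \<Longrightarrow> u (x \<oplus> y) = u x + u y"
    using minimal_sublinear[OF sublinear_flatten[OF sublinear_nrm x0]] by blast
  have neg: "u (\<ominus> x) = - u x" if "x \<in> carrier X" for x
    using add[of x "\<ominus> x"] sublinear_zero[OF u(1)] that by (simp add: M.r_neg)
  have hom: "u (of_real r \<odot> x) = r * u x" if x: "x \<in> carrier X" for r x
  proof (cases "r \<ge> 0")
    case True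
    then show ?thesis using sublinear_homogeneous[OF u(1) x] by simp
  next
    case False
    have "of_real r \<odot> x = \<ominus> (of_real (- r) \<odot> x)"
      using x by (simp add: minus_eq_smult smult_assoc)
    then show ?thesis using neg[of "of_real (- r) \<odot> x"] sublinear_homogeneous[OF u(1) x, of "- r"] False x
      by simp
  qed
  have le: "u x \<le> nrm X x" if x: "x \<in> carrier X" for x
    using u(2)[OF x] flatten_le[OF sublinear_nrm x0 x, of 0] x x0 by simp
  have "?p (\<ominus> x0) \<le> - nrm X x0"
    using flatten_le[OF sublinear_nrm x0, of "\<ominus> x0" 1] x0 by (simp add: M.l_neg)
  then have "nrm X x0 \<le> u x0" using u(2)[of "\<ominus> x0"] neg[OF x0] x0 by simp
  then have "u x0 = nrm X x0" using le[OF x0] by simp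
  then show ?thesis using add hom le by blast
qed

end

text \<open>A real functional \<open>u\<close> is turned into a scalar one: over the reals it is
  \<open>u\<close> itself, over the complex numbers it is \<open>u(x) - i u(i x)\<close>, which is
  controlled by \<open>u\<close> through a rotation of the argument.\<close>

theorem Hahn_Banach:
  fixes X :: "('k::real_or_complex, 'a) nspace" (structure)
  assumes "normed_space X" and x0: "x0 \<in> carrier X"
  shows "\<exists>f\<in>unit_ball (dual X). f x0 = of_real (nrm X x0)"
proof -
  interpret normed_space X by fact
  obtain u where U: "(\<forall>x\<in>carrier X. \<forall>y\<in>carrier X. u (x \<oplus> y) = u x + u y) \<and>
    (\<forall>r. \<forall>x\<in>carrier X. u (of_real r \<odot> x) = r * u x) \<and>
    (\<forall>x\<in>carrier X. u x \<le> nrm X x) \<and> u x0 = nrm X x0"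
    using real_Hahn_Banach[OF x0] by (rule exE)
  have add: "\<And>x y. x \<in> carrier X \<Longrightarrow> y \<in> carrier X \<Longrightarrow> u (x \<oplus> y) = u x + u y"
    and hom: "\<And>r x. x \<in> carrier X \<Longrightarrow> u (of_real r \<odot> x) = r * u x"
    and le: "\<And>x. x \<in> carrier X \<Longrightarrow> u x \<le> nrm X x" and u0: "u x0 = nrm X x0"
    by (use U in blast)+
  have neg: "u ((- 1) \<odot> x) = - u x" if "x \<in> carrier X" for x
    using hom[OF that, of "- 1"] by simp
  show ?thesis
    using real_or_complex[where 'a='k]
  proof (elim disjE)
    assume real: "\<forall>z::'k. \<exists>a. z = a *\<^sub>R 1"
    let ?f = "\<lambda>x\<in>carrier X. of_real (u x) :: 'k"
    have "?f \<in> unit_ball (dual X)"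
    proof (rule dual_ballI)
      fix c :: 'k and x assume x: "x \<in> carrier X"
      obtain a where "c = of_real a" using real unfolding of_real_def by blast
      then show "?f (c \<odot> x) = c * ?f x" using x hom by simp
      show "norm (?f x) \<le> nrm X x" using x le[OF x] le[of "(- 1) \<odot> x"] neg[OF x] nrm_smult[OF x, of "- 1"] by simp
    qed (auto simp: add)
    then show ?thesis using x0 u0 by (intro bexI[of _ ?f]) auto
  next
    assume "\<exists>i::'k. i * i = - 1 \<and> (\<forall>z. \<exists>a b. z = a *\<^sub>R 1 + b *\<^sub>R i)"
    then obtain i :: 'k where i: "i * i = - 1" and span: "\<And>z. \<exists>a b. z = of_real a + of_real b * i"
      by (auto simp: scaleR_conv_of_real)
    have "(norm i)\<^sup>2 = 1"
      using arg_cong[OF i, of norm] by (simp add: norm_mult power2_eq_square)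
    then have ni: "norm i = 1" by (simp add: power2_eq_1_iff) (use norm_ge_zero[of i] in linarith)
    let ?f = "\<lambda>x\<in>carrier X. of_real (u x) - i * of_real (u (i \<odot> x)) :: 'k"
    have fadd: "?f (x \<oplus> y) = ?f x + ?f y" if "x \<in> carrier X" "y \<in> carrier X" for x y
      using that by (simp add: add smult_add_r algebra_simps)
    have fr: "?f (of_real r \<odot> x) = of_real r * ?f x" if x: "x \<in> carrier X" for r x
    proof -
      have "i \<odot> (of_real r \<odot> x) = of_real r \<odot> (i \<odot> x)" using x by (simp add: smult_assoc mult.commute)
      then show ?thesis using x hom by (simp add: algebra_simps)
    qed
    have fi: "?f (i \<odot> x) = i * ?f x" if x: "x \<in> carrier X" for x
    proof -
      have "i \<odot> (i \<odot> x) = (- 1) \<odot> x" using x by (simp add: smult_assoc i)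
      then have "?f (i \<odot> x) = of_real (u (i \<odot> x)) + i * of_real (u x)" using x neg by simp
      also have "\<dots> = i * of_real (u x) - (i * i) * of_real (u (i \<odot> x))" by (simp add: i)
      finally show ?thesis using x by (simp add: algebra_simps)
    qed
    have fc: "?f (c \<odot> x) = c * ?f x" if x: "x \<in> carrier X" for c :: 'k and x
    proof -
      obtain a b where c: "c = of_real a + of_real b * i" using span by blast
      have "c \<odot> x = of_real a \<odot> x \<oplus> of_real b \<odot> (i \<odot> x)" using x by (simp add: c smult_add_l smult_assoc)
      then have "?f (c \<odot> x) = of_real a * ?f x + of_real b * (i * ?f x)"
        using x fadd[of "of_real a \<odot> x" "of_real b \<odot> (i \<odot> x)"] fr[OF x, of a] fr[of "i \<odot> x" b] fi[OF x] by simp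
      then show ?thesis by (simp add: c algebra_simps)
    qed
    \<comment> \<open>Real and imaginary parts are compared through squares:
      \<open>i * \<beta>\<close> equals the real number \<open>\<alpha> - \<gamma>\<close>, so minus
      the square of \<beta> is the square of \<open>\<alpha> - \<gamma>\<close>, and both
      vanish.\<close>
    have real_part: "\<beta> = 0 \<and> \<alpha> = \<gamma>" if "of_real \<alpha> - i * of_real \<beta> = (of_real \<gamma> :: 'k)" for \<alpha> \<beta> \<gamma>
    proof -
      have "i * of_real \<beta> = (of_real (\<alpha> - \<gamma>) :: 'k)" using that by (simp add: algebra_simps)
      then have "(i * of_real \<beta>) * (i * of_real \<beta>) = (of_real ((\<alpha> - \<gamma>) * (\<alpha> - \<gamma>)) :: 'k)"
        by simp
      then have "(i * i) * of_real (\<beta> * \<beta>) = (of_real ((\<alpha> - \<gamma>) * (\<alpha> - \<gamma>)) :: 'k)"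
        by (simp only: of_real_mult mult_ac)
      then have "of_real (- (\<beta> * \<beta>)) = (of_real ((\<alpha> - \<gamma>) * (\<alpha> - \<gamma>)) :: 'k)" by (simp add: i)
      then have "- (\<beta> * \<beta>) = (\<alpha> - \<gamma>) * (\<alpha> - \<gamma>)" by (simp only: of_real_eq_iff)
      then have "\<beta> * \<beta> + (\<alpha> - \<gamma>) * (\<alpha> - \<gamma>) = 0" by linarith
      then have "\<beta> = 0 \<and> \<alpha> - \<gamma> = 0" by (simp only: sum_squares_eq_zero_iff)
      then show ?thesis by simp
    qed
    have fle: "norm (?f x) \<le> nrm X x" if x: "x \<in> carrier X" for x
    proof (cases "?f x = 0")
      case True
      then show ?thesis using nrm_ge_0[OF x] by simp
    next
      case False
      \<comment> \<open>The rotation makes \<open>?f (\<theta> \<odot> x)\<close> equal to the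
        modulus of \<open>?f x\<close>, a real number, so that \<open>u\<close> alone bounds
        it.\<close>
      define \<theta> where "\<theta> = of_real (norm (?f x)) / ?f x"
      have n\<theta>: "norm \<theta> = 1" using False by (simp add: \<theta>_def norm_divide del: restrict_apply)
      have "?f (\<theta> \<odot> x) = of_real (norm (?f x))" using fc[OF x, of \<theta>] False by (simp add: \<theta>_def del: restrict_apply)
      then have "of_real (u (\<theta> \<odot> x)) - i * of_real (u (i \<odot> (\<theta> \<odot> x))) = (of_real (norm (?f x)) :: 'k)"
        using x by simp
      then have "u (\<theta> \<odot> x) = norm (?f x)" using real_part by blast
      then show ?thesis using le[of "\<theta> \<odot> x"] x nrm_smult[OF x, of \<theta>] n\<theta> by simp
    qed
    have "inner 1 i = 0"
    proof -
      \<comment> \<open>Multiplication by \<open>i\<close> is isometric, so \<open>1 + i\<close> and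
        \<open>1 - i\<close> have equal norms, which is orthogonality of \<open>1\<close> and
        \<open>i\<close>.\<close>
      have "i * (1 - i) = 1 + i" by (simp add: algebra_simps i)
      then have "norm (1 + i) = norm (1 - i)" using ni by (metis norm_mult mult_1)
      then have "(norm (1 + i))\<^sup>2 = (norm (1 - i))\<^sup>2" by simp
      then show ?thesis
        by (simp add: power2_norm_eq_inner inner_add_left inner_add_right inner_diff_left inner_diff_right inner_commute)
    qed
    then have pyth: "(norm (of_real a - i * of_real b))\<^sup>2 = a\<^sup>2 + b\<^sup>2" for a b
    proof -
      have "of_real a - i * of_real b = a *\<^sub>R 1 - b *\<^sub>R i" by (simp add: of_real_def)
      then show ?thesis using \<open>inner 1 i = 0\<close> ni
        by (simp add: power2_norm_eq_inner inner_diff_left inner_diff_right inner_commute)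
           (simp add: dot_square_norm power2_eq_square)
    qed
    \<comment> \<open>The real part of \<open>?f x0\<close> already exhausts the norm bound, so by
      Pythagoras the imaginary part must vanish.\<close>
    let ?b = "u (i \<odot> x0)"
    have "(norm (?f x0))\<^sup>2 \<le> (nrm X x0)\<^sup>2" by (rule power_mono[OF fle[OF x0]]) simp
    then have "?b = 0" using x0 u0 pyth by simp
    then have "?f x0 = of_real (nrm X x0)" using x0 u0 by simp
    moreover have "?f \<in> unit_ball (dual X)"
      by (rule dual_ballI) (use fadd fc fle in \<open>simp_all del: restrict_apply\<close>)
    ultimately show ?thesis by blast
  qed
qed

section \<open>Direct sums\<close>

locale lp_family =
  fixes p :: ereal and \<Lambda> :: "'i set" and E :: "'i \<Rightarrow> ('k::real_or_complex, 'a) nspace"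
  assumes p: "p = 1 \<or> p = \<infinity>" and ne: "\<Lambda> \<noteq> {}" and normed: "\<And>l. l \<in> \<Lambda> \<Longrightarrow> normed_space (E l)"
begin

abbreviation "S \<equiv> lp_sum p \<Lambda> E"

lemma lp_simps [simp]:
  "zero S = (\<lambda>l\<in>\<Lambda>. \<zero>\<^bsub>E l\<^esub>)"
  "add S = (\<lambda>x y. \<lambda>l\<in>\<Lambda>. x l \<oplus>\<^bsub>E l\<^esub> y l)"
  "smult S = (\<lambda>c x. \<lambda>l\<in>\<Lambda>. c \<odot>\<^bsub>E l\<^esub> x l)"
  by (simp_all add: lp_sum_def)

lemma nrm_ge_0: "l \<in> \<Lambda> \<Longrightarrow> x \<in> carrier (E l) \<Longrightarrow> 0 \<le> nrm (E l) x"
  using normed_space.nrm_ge_0[OF normed] by blast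

lemma carrier_1: "p = 1 \<Longrightarrow> x \<in> carrier S \<longleftrightarrow>
    x \<in> (\<Pi>\<^sub>E l\<in>\<Lambda>. carrier (E l)) \<and> (\<lambda>l. nrm (E l) (x l)) summable_on \<Lambda>"
proof -
  have "(\<lambda>l. \<bar>nrm (E l) (x l)\<bar>) summable_on \<Lambda> \<longleftrightarrow> (\<lambda>l. nrm (E l) (x l)) summable_on \<Lambda>"
    if "x \<in> (\<Pi>\<^sub>E l\<in>\<Lambda>. carrier (E l))"
    by (rule summable_on_cong) (use nrm_ge_0[OF _ PiE_mem[OF that]] in simp)
  then show "p = 1 \<Longrightarrow> ?thesis" by (auto simp: lp_sum_def)
qed

lemma nrm_1: "p = 1 \<Longrightarrow> x \<in> carrier S \<Longrightarrow> nrm S x = (\<Sum>\<^sub>\<infinity>l\<in>\<Lambda>. nrm (E l) (x l))"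
proof -
  assume p: "p = 1" and x: "x \<in> carrier S"
  then have nn: "0 \<le> nrm (E l) (x l)" if "l \<in> \<Lambda>" for l
    using nrm_ge_0[OF that] PiE_mem[of x \<Lambda> "\<lambda>l. carrier (E l)", OF _ that] x carrier_1[OF p] by blast
  then have "(\<Sum>\<^sub>\<infinity>l\<in>\<Lambda>. nrm (E l) (x l) powr 1) = (\<Sum>\<^sub>\<infinity>l\<in>\<Lambda>. nrm (E l) (x l))"
    by (intro infsum_cong) simp
  moreover have "0 \<le> (\<Sum>\<^sub>\<infinity>l\<in>\<Lambda>. nrm (E l) (x l))"
    using nn by (intro infsum_nonneg) simp
  ultimately show ?thesis using p by (simp add: lp_sum_def lp_norm_def)
qed

lemma carrier_inf: "p = \<infinity> \<Longrightarrow> x \<in> carrier S \<longleftrightarrow>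
    x \<in> (\<Pi>\<^sub>E l\<in>\<Lambda>. carrier (E l)) \<and> bdd_above ((\<lambda>l. nrm (E l) (x l)) ` \<Lambda>)"
  by (simp add: lp_sum_def)

lemma nrm_inf: "p = \<infinity> \<Longrightarrow> nrm S x = (SUP l\<in>\<Lambda>. nrm (E l) (x l))"
  by (simp add: lp_sum_def lp_norm_def)

lemma carrier_PiE: "x \<in> carrier S \<Longrightarrow> x \<in> (\<Pi>\<^sub>E l\<in>\<Lambda>. carrier (E l))"
  using p by (auto simp: lp_sum_def)

lemma carrier_mem: "x \<in> carrier S \<Longrightarrow> l \<in> \<Lambda> \<Longrightarrow> x l \<in> carrier (E l)"
  using carrier_PiE by (auto dest: PiE_mem)

lemma component_le:
  assumes x: "x \<in> carrier S" and l: "l \<in> \<Lambda>"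
  shows "nrm (E l) (x l) \<le> nrm S x"
  using p
proof
  assume p: "p = 1"
  have "infsum (\<lambda>l. nrm (E l) (x l)) {l} \<le> infsum (\<lambda>l. nrm (E l) (x l)) \<Lambda>"
    using x l carrier_1[OF p] nrm_ge_0 by (intro infsum_mono_neutral) (auto simp: PiE_mem)
  then show ?thesis using nrm_1[OF p x] by simp
next
  assume p: "p = \<infinity>"
  show ?thesis unfolding nrm_inf[OF p] by (rule cSUP_upper) (use x l p carrier_inf in auto)
qed

lemma dominated_sum:
  assumes x: "x \<in> carrier S" and y: "y \<in> carrier S" and z: "z \<in> (\<Pi>\<^sub>E l\<in>\<Lambda>. carrier (E l))"
    and le: "\<And>l. l \<in> \<Lambda> \<Longrightarrow> nrm (E l) (z l) \<le> nrm (E l) (x l) + nrm (E l) (y l)"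
  shows "z \<in> carrier S" "nrm S z \<le> nrm S x + nrm S y"
proof -
  have "z \<in> carrier S \<and> nrm S z \<le> nrm S x + nrm S y"
    using p
  proof
    assume p: "p = 1"
    have xy: "(\<lambda>l. nrm (E l) (x l)) summable_on \<Lambda>" "(\<lambda>l. nrm (E l) (y l)) summable_on \<Lambda>"
      using x y p carrier_1 by auto
    then have s: "(\<lambda>l. nrm (E l) (x l) + nrm (E l) (y l)) summable_on \<Lambda>" by (rule summable_on_add)
    then have zs: "(\<lambda>l. nrm (E l) (z l)) summable_on \<Lambda>"
      by (rule summable_on_comparison_test) (use le z nrm_ge_0 in \<open>auto simp: PiE_mem\<close>)
    then have zS: "z \<in> carrier S" using z p carrier_1 by auto
    have "infsum (\<lambda>l. nrm (E l) (z l)) \<Lambda> \<le> infsum (\<lambda>l. nrm (E l) (x l) + nrm (E l) (y l)) \<Lambda>"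
      by (rule infsum_mono[OF zs s le])
    also have "\<dots> = infsum (\<lambda>l. nrm (E l) (x l)) \<Lambda> + infsum (\<lambda>l. nrm (E l) (y l)) \<Lambda>"
      by (rule infsum_add[OF xy])
    finally show ?thesis using zS nrm_1[OF p] x y by simp
  next
    assume p: "p = \<infinity>"
    have b: "nrm (E l) (z l) \<le> nrm S x + nrm S y" if "l \<in> \<Lambda>" for l
      using le[OF that] component_le[OF x that] component_le[OF y that] by linarith
    then have "z \<in> carrier S" using z p carrier_inf by (auto intro!: bdd_aboveI2)
    then show ?thesis using b by (simp add: nrm_inf[OF p] cSUP_least[OF ne])
  qed
  then show "z \<in> carrier S" "nrm S z \<le> nrm S x + nrm S y" by auto
qed

lemma zero_mem: "zero S \<in> carrier S"
proof -
  have z: "(\<lambda>l\<in>\<Lambda>. \<zero>\<^bsub>E l\<^esub>) \<in> (\<Pi>\<^sub>E l\<in>\<Lambda>. carrier (E l))"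
    using normed_space.zero_in_unit_ball[OF normed] by (auto simp: unit_ball_def)
  have 0: "nrm (E l) \<zero>\<^bsub>E l\<^esub> = 0" if "l \<in> \<Lambda>" for l
    using normed_space.nrm_zero[OF normed[OF that]] .
  have "(\<lambda>l. nrm (E l) ((\<lambda>l\<in>\<Lambda>. \<zero>\<^bsub>E l\<^esub>) l)) summable_on \<Lambda>"
    using summable_on_cong[of \<Lambda> "\<lambda>l. nrm (E l) ((\<lambda>l\<in>\<Lambda>. \<zero>\<^bsub>E l\<^esub>) l)" "\<lambda>_. 0"] 0 by simp
  moreover have "bdd_above ((\<lambda>l. nrm (E l) ((\<lambda>l\<in>\<Lambda>. \<zero>\<^bsub>E l\<^esub>) l)) ` \<Lambda>)"
    by (rule bdd_aboveI2[of _ _ 0]) (simp add: 0)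
  ultimately show ?thesis using p z carrier_1 carrier_inf by auto
qed

end

text \<open>Coordinatewise domination is checked here for both exponents; scalar multiples,
  restrictions to sets of coordinates and sums of operators are all instances.\<close>

lemma lp_dominated:
  assumes "lp_family p \<Lambda> E" "lp_family p \<Lambda> F"
    and x: "x \<in> carrier (lp_sum p \<Lambda> E)" and y: "y \<in> (\<Pi>\<^sub>E l\<in>\<Lambda>. carrier (F l))"
    and le: "\<And>l. l \<in> \<Lambda> \<Longrightarrow> nrm (F l) (y l) \<le> C * nrm (E l) (x l)" and C: "0 \<le> C"
  shows "y \<in> carrier (lp_sum p \<Lambda> F)" "nrm (lp_sum p \<Lambda> F) y \<le> C * nrm (lp_sum p \<Lambda> E) x"
proof -
  interpret E: lp_family p \<Lambda> E by fact
  interpret F: lp_family p \<Lambda> F by fact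
  have "y \<in> carrier F.S \<and> nrm F.S y \<le> C * nrm E.S x"
    using E.p
  proof
    assume p: "p = 1"
    have s: "(\<lambda>l. C * nrm (E l) (x l)) summable_on \<Lambda>"
      using x E.carrier_1[OF p] by (intro summable_on_cmult_right) auto
    then have ys: "(\<lambda>l. nrm (F l) (y l)) summable_on \<Lambda>"
      by (rule summable_on_comparison_test) (use le y F.nrm_ge_0 in \<open>auto simp: PiE_mem\<close>)
    then have yS: "y \<in> carrier F.S" using y F.carrier_1[OF p] by auto
    have "infsum (\<lambda>l. nrm (F l) (y l)) \<Lambda> \<le> infsum (\<lambda>l. C * nrm (E l) (x l)) \<Lambda>"
      by (rule infsum_mono[OF ys s le])
    also have "\<dots> = C * infsum (\<lambda>l. nrm (E l) (x l)) \<Lambda>"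
      by (rule infsum_cmult_right) (use x E.carrier_1[OF p] in auto)
    finally show ?thesis using yS E.nrm_1[OF p x] F.nrm_1[OF p yS] by simp
  next
    assume p: "p = \<infinity>"
    have b: "nrm (F l) (y l) \<le> C * nrm E.S x" if "l \<in> \<Lambda>" for l
      using le[OF that] mult_left_mono[OF E.component_le[OF x that] C] by linarith
    then have "y \<in> carrier F.S" using y F.carrier_inf[OF p] by (auto intro!: bdd_aboveI2)
    then show ?thesis using b by (simp add: F.nrm_inf[OF p] cSUP_least[OF F.ne])
  qed
  then show "y \<in> carrier (lp_sum p \<Lambda> F)" "nrm (lp_sum p \<Lambda> F) y \<le> C * nrm (lp_sum p \<Lambda> E) x" by auto
qed

context lp_family
begin

lemma lp_family: "lp_family p \<Lambda> E" by (rule lp_family_axioms)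

lemma smult_mem:
  assumes x: "x \<in> carrier S"
  shows "c \<odot>\<^bsub>S\<^esub> x \<in> carrier S" "nrm S (c \<odot>\<^bsub>S\<^esub> x) \<le> norm c * nrm S x"
proof -
  have y: "c \<odot>\<^bsub>S\<^esub> x \<in> (\<Pi>\<^sub>E l\<in>\<Lambda>. carrier (E l))"
    using carrier_mem[OF x] normed_space.smult_closed'[OF normed] by auto
  have le: "nrm (E l) ((c \<odot>\<^bsub>S\<^esub> x) l) \<le> norm c * nrm (E l) (x l)" if "l \<in> \<Lambda>" for l
    using that normed_space.nrm_smult[OF normed] carrier_mem[OF x] by simp
  show "c \<odot>\<^bsub>S\<^esub> x \<in> carrier S" "nrm S (c \<odot>\<^bsub>S\<^esub> x) \<le> norm c * nrm S x"
    using lp_dominated[OF lp_family lp_family x y le] norm_ge_zero by blast+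
qed

lemma add_mem:
  assumes x: "x \<in> carrier S" and y: "y \<in> carrier S"
  shows "x \<oplus>\<^bsub>S\<^esub> y \<in> carrier S" "nrm S (x \<oplus>\<^bsub>S\<^esub> y) \<le> nrm S x + nrm S y"
proof -
  have ab: "abelian_group (E l)" if "l \<in> \<Lambda>" for l
    using normed[OF that] by (simp add: normed_space_def module_def)
  have z: "x \<oplus>\<^bsub>S\<^esub> y \<in> (\<Pi>\<^sub>E l\<in>\<Lambda>. carrier (E l))"
    using carrier_mem[OF x] carrier_mem[OF y] abelian_monoid.a_closed[OF abelian_group.axioms(1)[OF ab]] by auto
  have le: "nrm (E l) ((x \<oplus>\<^bsub>S\<^esub> y) l) \<le> nrm (E l) (x l) + nrm (E l) (y l)" if "l \<in> \<Lambda>" for l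
    using that normed_space.nrm_triangle[OF normed] carrier_mem[OF x] carrier_mem[OF y] by simp
  show "x \<oplus>\<^bsub>S\<^esub> y \<in> carrier S" "nrm S (x \<oplus>\<^bsub>S\<^esub> y) \<le> nrm S x + nrm S y"
    using dominated_sum[OF x y z le] by blast+
qed


lemma outside: "x \<in> carrier S \<Longrightarrow> l \<notin> \<Lambda> \<Longrightarrow> x l = undefined"
  using carrier_PiE[of x] by (auto simp: PiE_def extensional_def)

lemma smult_smult: "x \<in> carrier S \<Longrightarrow> a \<odot>\<^bsub>S\<^esub> (b \<odot>\<^bsub>S\<^esub> x) = (a * b) \<odot>\<^bsub>S\<^esub> x"
  using normed_space.smult_assoc[OF normed] carrier_mem by (auto simp: fun_eq_iff)

lemma one_smult: "x \<in> carrier S \<Longrightarrow> 1 \<odot>\<^bsub>S\<^esub> x = x"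
  using normed_space.smult_1[OF normed] carrier_mem outside[of x] by (auto simp: fun_eq_iff)

lemma normed_space_lp_sum: "normed_space S"
proof -
  have ab: "abelian_group (E l)" if "l \<in> \<Lambda>" for l
    using normed[OF that] by (simp add: normed_space_def module_def)
  note am = abelian_group.axioms(1)[OF ab]
  have A: "abelian_group S"
  proof (rule abelian_groupI)
    fix x y z assume x: "x \<in> carrier S" and y: "y \<in> carrier S" and z: "z \<in> carrier S"
    show "x \<oplus>\<^bsub>S\<^esub> y \<in> carrier S" by (rule add_mem[OF x y])
    show "x \<oplus>\<^bsub>S\<^esub> y \<oplus>\<^bsub>S\<^esub> z = x \<oplus>\<^bsub>S\<^esub> (y \<oplus>\<^bsub>S\<^esub> z)"
      using carrier_mem x y z abelian_monoid.a_assoc[OF am] by (auto simp: fun_eq_iff)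
    show "x \<oplus>\<^bsub>S\<^esub> y = y \<oplus>\<^bsub>S\<^esub> x"
      using carrier_mem x y abelian_monoid.a_comm[OF am] by (auto simp: fun_eq_iff)
  next
    fix x assume x: "x \<in> carrier S"
    show "\<zero>\<^bsub>S\<^esub> \<oplus>\<^bsub>S\<^esub> x = x"
      using carrier_mem[OF x] abelian_monoid.l_zero[OF am] outside[OF x] by (auto simp: fun_eq_iff)
    show "\<exists>y\<in>carrier S. y \<oplus>\<^bsub>S\<^esub> x = \<zero>\<^bsub>S\<^esub>"
    proof (rule bexI[OF _ smult_mem(1)[OF x, of "- 1"]])
      show "(- 1) \<odot>\<^bsub>S\<^esub> x \<oplus>\<^bsub>S\<^esub> x = \<zero>\<^bsub>S\<^esub>"
        using carrier_mem[OF x] normed_space.minus_eq_smult[OF normed] abelian_group.l_neg[OF ab]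
        by (auto simp: fun_eq_iff)
    qed
  qed (rule zero_mem)
  have M: "module scalars S"
  proof (rule moduleI[OF cring_scalars A])
    fix a b and x y assume x: "x \<in> carrier S" and y: "y \<in> carrier S"
    show "a \<odot>\<^bsub>S\<^esub> x \<in> carrier S" by (rule smult_mem[OF x])
    show "(a \<oplus>\<^bsub>scalars\<^esub> b) \<odot>\<^bsub>S\<^esub> x = a \<odot>\<^bsub>S\<^esub> x \<oplus>\<^bsub>S\<^esub> b \<odot>\<^bsub>S\<^esub> x"
      using carrier_mem[OF x] normed_space.smult_add_l[OF normed] by (auto simp: fun_eq_iff)
    show "a \<odot>\<^bsub>S\<^esub> (x \<oplus>\<^bsub>S\<^esub> y) = a \<odot>\<^bsub>S\<^esub> x \<oplus>\<^bsub>S\<^esub> a \<odot>\<^bsub>S\<^esub> y"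
      using carrier_mem[OF x] carrier_mem[OF y] normed_space.smult_add_r[OF normed] by (auto simp: fun_eq_iff)
    show "(a \<otimes>\<^bsub>scalars\<^esub> b) \<odot>\<^bsub>S\<^esub> x = a \<odot>\<^bsub>S\<^esub> (b \<odot>\<^bsub>S\<^esub> x)"
      using smult_smult[OF x] by simp
    show "\<one>\<^bsub>scalars\<^esub> \<odot>\<^bsub>S\<^esub> x = x" using one_smult[OF x] by simp
  qed
  show ?thesis
  proof (intro normed_space.intro[OF M] normed_space_axioms.intro)
    fix x assume x: "x \<in> carrier S"
    have "nrm S \<zero>\<^bsub>S\<^esub> \<le> 0 * nrm S x"
    proof (rule lp_dominated(2)[OF lp_family lp_family x])
      show "\<zero>\<^bsub>S\<^esub> \<in> (\<Pi>\<^sub>E l\<in>\<Lambda>. carrier (E l))" by (rule carrier_PiE[OF zero_mem])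
    qed (auto simp: normed_space.nrm_zero[OF normed])
    moreover have "0 \<le> nrm S y" if "y \<in> carrier S" for y
      using ne nrm_ge_0 component_le[OF that] carrier_mem[OF that] by (meson all_not_in_conv order_trans)
    ultimately have 0: "nrm S \<zero>\<^bsub>S\<^esub> = 0" using zero_mem by (metis antisym mult_zero_left)
    show "nrm S x = 0 \<longleftrightarrow> x = \<zero>\<^bsub>S\<^esub>"
    proof
      assume "nrm S x = 0"
      then have "x l = \<zero>\<^bsub>E l\<^esub>" if "l \<in> \<Lambda>" for l
        using that component_le[OF x that] nrm_ge_0[OF that carrier_mem[OF x that]]
          normed_space.nrm_eq_0[OF normed[OF that] carrier_mem[OF x that]] by simp
      then show "x = \<zero>\<^bsub>S\<^esub>" using outside[OF x] by (auto simp: fun_eq_iff)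
    qed (use 0 in simp)
    fix c
    show "nrm S (c \<odot>\<^bsub>S\<^esub> x) = norm c * nrm S x"
    proof (cases "c = 0")
      case True
      have "0 \<odot>\<^bsub>S\<^esub> x = \<zero>\<^bsub>S\<^esub>"
        using carrier_mem[OF x] normed_space.smult_0[OF normed] by (auto simp: fun_eq_iff)
      then show ?thesis using True 0 by simp
    next
      case False
      \<comment> \<open>Scaling back by \<open>inverse c\<close> turns the upper bound for scaled
        vectors into the lower bound.\<close>
      have "x = inverse c \<odot>\<^bsub>S\<^esub> (c \<odot>\<^bsub>S\<^esub> x)" using False smult_smult[OF x] one_smult[OF x] by simp
      then have "nrm S x \<le> norm (inverse c) * nrm S (c \<odot>\<^bsub>S\<^esub> x)"
        using smult_mem(2)[OF smult_mem(1)[OF x, of c], of "inverse c"] by simp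
      then have "norm c * nrm S x \<le> nrm S (c \<odot>\<^bsub>S\<^esub> x)" using False by (simp add: norm_divide field_simps)
      then show ?thesis using smult_mem(2)[OF x, of c] by simp
    qed
  qed (rule add_mem)
qed

end

section \<open>Operators and their adjoints\<close>

locale operator =
  fixes X :: "('k::real_or_complex, 'a) nspace" and Y :: "('k, 'b) nspace" and T
  assumes X: "normed_space X" and Y: "normed_space Y" and T: "bounded_operator X Y T"
begin

sublocale X: normed_space X by (rule X)
sublocale Y: normed_space Y by (rule Y)

abbreviation "K \<equiv> adjoint X T ` unit_ball (dual Y)"

lemma T_mem [simp]: "x \<in> carrier X \<Longrightarrow> T x \<in> carrier Y"
  using T by (auto simp: bounded_operator_def)

lemma T_add: "x \<in> carrier X \<Longrightarrow> y \<in> carrier X \<Longrightarrow> T (x \<oplus>\<^bsub>X\<^esub> y) = T x \<oplus>\<^bsub>Y\<^esub> T y"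
  using T by (auto simp: bounded_operator_def)

lemma T_smult: "x \<in> carrier X \<Longrightarrow> T (c \<odot>\<^bsub>X\<^esub> x) = c \<odot>\<^bsub>Y\<^esub> T x"
  using T by (auto simp: bounded_operator_def)

lemma T_zero: "T \<zero>\<^bsub>X\<^esub> = \<zero>\<^bsub>Y\<^esub>"
  using T_smult[of "\<zero>\<^bsub>X\<^esub>" 0] by simp

lemma bound_ex: obtains C where "0 \<le> C" "\<And>x. x \<in> carrier X \<Longrightarrow> nrm Y (T x) \<le> C * nrm X x"
proof -
  obtain C where C: "\<forall>x\<in>carrier X. nrm Y (T x) \<le> C * nrm X x"
    using T by (auto simp: bounded_operator_def)
  have "nrm Y (T x) \<le> max C 0 * nrm X x" if "x \<in> carrier X" for x
    using C that X.nrm_ge_0[OF that] by (meson max.cobounded1 mult_right_mono order_trans)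
  then show ?thesis using that[of "max C 0"] by auto
qed

lemma bdd_above_op: "bdd_above ((\<lambda>x. nrm Y (T x)) ` unit_ball X)"
proof -
  obtain C where C: "0 \<le> C" "\<And>x. x \<in> carrier X \<Longrightarrow> nrm Y (T x) \<le> C * nrm X x" using bound_ex by metis
  show ?thesis
    by (rule bdd_aboveI2[of _ _ C])
       (use C mult_left_mono[of _ 1 C] in \<open>fastforce simp: unit_ball_def intro: order_trans\<close>)
qed

lemma op_norm_upper: "x \<in> unit_ball X \<Longrightarrow> nrm Y (T x) \<le> op_norm X Y T"
  unfolding op_norm_def by (rule cSUP_upper[OF _ bdd_above_op])

lemma op_norm_ge_0: "0 \<le> op_norm X Y T"
  using op_norm_upper[OF X.zero_in_unit_ball] by (simp add: T_zero)

lemma op_bound: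
  assumes x: "x \<in> carrier X"
  shows "nrm Y (T x) \<le> op_norm X Y T * nrm X x"
proof (cases "nrm X x = 0")
  case True
  then show ?thesis using bound_ex x by (metis mult_zero_right)
next
  case False
  then have pos: "nrm X x > 0" using X.nrm_ge_0[OF x] by simp
  let ?c = "of_real (1 / nrm X x)"
  have "?c \<odot>\<^bsub>X\<^esub> x \<in> unit_ball X" using x pos by (simp add: unit_ball_def X.nrm_smult norm_divide)
  then have "nrm Y (T (?c \<odot>\<^bsub>X\<^esub> x)) \<le> op_norm X Y T" by (rule op_norm_upper)
  then show ?thesis using pos x by (simp add: T_smult Y.nrm_smult norm_divide field_simps)
qed

lemma adjoint_mem:
  assumes "g \<in> carrier (dual Y)"
  shows "adjoint X T g \<in> carrier (dual X)"
proof -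
  obtain C where C: "0 \<le> C" "\<And>x. x \<in> carrier Y \<Longrightarrow> norm (g x) \<le> C * nrm Y x"
    using Y.dual_bound_ex[OF assms] by metis
  have "norm (g (T x)) \<le> C * op_norm X Y T * nrm X x" if "x \<in> carrier X" for x
    using C(2)[OF T_mem[OF that]] mult_left_mono[OF op_bound[OF that] C(1)] by (simp add: mult.assoc)
  then show ?thesis
    by (intro X.carrier_dualI[where C = "C * op_norm X Y T"])
       (use assms in \<open>auto simp: adjoint_def T_add T_smult Y.dual_add Y.dual_smult\<close>)
qed

lemma K_subset: "K \<subseteq> carrier (dual X)"
  using adjoint_mem by (auto simp: unit_ball_def)

text \<open>The dual unit ball is convex and the adjoint is linear, so preimages of the
  \<open>f l\<close> can be averaged in \<open>dual Y\<close>.\<close>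

lemma K_average:
  assumes fin: "finite A" "A \<noteq> {}" and f: "\<And>l. l \<in> A \<Longrightarrow> f l \<in> K"
  shows "(\<lambda>x\<in>carrier X. (\<Sum>l\<in>A. f l x) / of_nat (card A)) \<in> K"
proof -
  define g where "g = (\<lambda>l. SOME g. g \<in> unit_ball (dual Y) \<and> f l = adjoint X T g)"
  have "g l \<in> unit_ball (dual Y) \<and> f l = adjoint X T (g l)" if "l \<in> A" for l
    unfolding g_def by (rule someI_ex[of "\<lambda>g. g \<in> unit_ball (dual Y) \<and> f l = adjoint X T g"])
      (use f[OF that] in blast)
  then have g: "\<And>l. l \<in> A \<Longrightarrow> g l \<in> unit_ball (dual Y)" "\<And>l. l \<in> A \<Longrightarrow> f l = adjoint X T (g l)"
    by auto
  have gd: "g l \<in> carrier (dual Y)" if "l \<in> A" for l using g(1)[OF that] by (simp add: unit_ball_def)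

  let ?g = "\<lambda>y\<in>carrier Y. (\<Sum>l\<in>A. g l y) / of_nat (card A)"
  have n: "card A > 0" using fin by (simp add: card_gt_0_iff)
  have "?g \<in> unit_ball (dual Y)"
  proof (rule Y.dual_ballI)
    fix y assume y: "y \<in> carrier Y"
    have "norm (\<Sum>l\<in>A. g l y) \<le> (\<Sum>l\<in>A. nrm Y y)"
      by (rule sum_norm_le) (rule Y.dual_ball_bound[OF g(1) y])
    then show "norm (?g y) \<le> nrm Y y" using y n by (simp add: norm_divide field_simps)
  next
    fix y z assume yz: "y \<in> carrier Y" "z \<in> carrier Y"
    have "(\<Sum>l\<in>A. g l (y \<oplus>\<^bsub>Y\<^esub> z)) = (\<Sum>l\<in>A. g l y + g l z)"
      by (rule sum.cong) (simp_all add: gd Y.dual_add yz)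
    then show "?g (y \<oplus>\<^bsub>Y\<^esub> z) = ?g y + ?g z" using yz by (simp add: sum.distrib add_divide_distrib)
  next
    fix c :: 'k and y assume y: "y \<in> carrier Y"
    have "(\<Sum>l\<in>A. g l (c \<odot>\<^bsub>Y\<^esub> y)) = (\<Sum>l\<in>A. c * g l y)"
      by (rule sum.cong) (simp_all add: gd Y.dual_smult y)
    then show "?g (c \<odot>\<^bsub>Y\<^esub> y) = c * ?g y" using y by (simp add: sum_distrib_left[symmetric])
  qed simp
  then have "adjoint X T ?g \<in> K" by (rule imageI)
  also have "adjoint X T ?g = (\<lambda>x\<in>carrier X. (\<Sum>l\<in>A. f l x) / of_nat (card A))"
  proof (rule ext)
    fix x
    have "(\<Sum>l\<in>A. f l x) = (\<Sum>l\<in>A. g l (T x))" if "x \<in> carrier X"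
      by (rule sum.cong) (use that g(2) in \<open>simp_all add: adjoint_def\<close>)
    then show "adjoint X T ?g x = (\<lambda>x\<in>carrier X. (\<Sum>l\<in>A. f l x) / of_nat (card A)) x"
      by (simp add: adjoint_def)
  qed
  finally show ?thesis .
qed

end


section \<open>Duals of direct sums\<close>

context lp_family
begin

sublocale S: normed_space S by (rule normed_space_lp_sum)

definition cut :: "'i set \<Rightarrow> ('i \<Rightarrow> 'a) \<Rightarrow> 'i \<Rightarrow> 'a" where
  "cut A x = (\<lambda>l\<in>\<Lambda>. if l \<in> A then x l else \<zero>\<^bsub>E l\<^esub>)"

definition single :: "'i \<Rightarrow> 'a \<Rightarrow> 'i \<Rightarrow> 'a" where
  "single l a = (\<lambda>m\<in>\<Lambda>. if m = l then a else \<zero>\<^bsub>E m\<^esub>)"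

text \<open>The adjoint of the isometric inclusion \<open>single l\<close> of one summand.\<close>

definition dual_restrict :: "'i \<Rightarrow> (('i \<Rightarrow> 'a) \<Rightarrow> 'k) \<Rightarrow> 'a \<Rightarrow> 'k" where
  "dual_restrict l h = (\<lambda>a\<in>carrier (E l). h (single l a))"

text \<open>The adjoint of the projection to the coordinate \<open>l\<close>.\<close>

definition dual_extend :: "'i \<Rightarrow> ('a \<Rightarrow> 'k) \<Rightarrow> ('i \<Rightarrow> 'a) \<Rightarrow> 'k" where
  "dual_extend l f = (\<lambda>x\<in>carrier S. f (x l))"

lemma zero_mem_component [simp]: "l \<in> \<Lambda> \<Longrightarrow> \<zero>\<^bsub>E l\<^esub> \<in> carrier (E l)"
  using normed_space.zero_in_unit_ball[OF normed] by (auto simp: unit_ball_def)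

lemma nrm_zero_component [simp]: "l \<in> \<Lambda> \<Longrightarrow> nrm (E l) \<zero>\<^bsub>E l\<^esub> = 0"
  using normed_space.nrm_zero[OF normed] by blast

lemma zero_add_component [simp]:
  "l \<in> \<Lambda> \<Longrightarrow> a \<in> carrier (E l) \<Longrightarrow> \<zero>\<^bsub>E l\<^esub> \<oplus>\<^bsub>E l\<^esub> a = a"
  "l \<in> \<Lambda> \<Longrightarrow> a \<in> carrier (E l) \<Longrightarrow> a \<oplus>\<^bsub>E l\<^esub> \<zero>\<^bsub>E l\<^esub> = a"
  using normed[of l] abelian_monoid.l_zero[of "E l" a] abelian_monoid.r_zero[of "E l" a]
  by (auto simp: normed_space_def module_def abelian_group_def)

lemma smult_zero_component [simp]: "l \<in> \<Lambda> \<Longrightarrow> c \<odot>\<^bsub>E l\<^esub> \<zero>\<^bsub>E l\<^esub> = \<zero>\<^bsub>E l\<^esub>"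
  using module.smult_r_null[of scalars "E l" c] normed[of l] by (auto simp: normed_space_def)

lemma cut_mem:
  assumes x: "x \<in> carrier S"
  shows "cut A x \<in> carrier S" "nrm S (cut A x) \<le> nrm S x"
proof -
  have "cut A x \<in> (\<Pi>\<^sub>E l\<in>\<Lambda>. carrier (E l))" using carrier_mem[OF x] by (auto simp: cut_def)
  moreover have "nrm (E l) (cut A x l) \<le> 1 * nrm (E l) (x l)" if "l \<in> \<Lambda>" for l
    using that nrm_ge_0[OF that carrier_mem[OF x that]] by (simp add: cut_def)
  ultimately have "cut A x \<in> carrier S \<and> nrm S (cut A x) \<le> 1 * nrm S x"
    using lp_dominated[OF lp_family lp_family x, of "cut A x" 1] by auto
  then show "cut A x \<in> carrier S" "nrm S (cut A x) \<le> nrm S x" by auto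
qed

lemma single_mem:
  assumes l: "l \<in> \<Lambda>" and a: "a \<in> carrier (E l)"
  shows "single l a \<in> carrier S" "nrm S (single l a) = nrm (E l) a"
proof -
  have P: "single l a \<in> (\<Pi>\<^sub>E l\<in>\<Lambda>. carrier (E l))" using l a by (auto simp: single_def)
  have "(\<lambda>m. nrm (E m) (single l a m)) summable_on \<Lambda> \<longleftrightarrow> (\<lambda>m. nrm (E m) (single l a m)) summable_on {l}"
    by (rule summable_on_cong_neutral) (use l in \<open>auto simp: single_def\<close>)
  moreover have "bdd_above ((\<lambda>m. nrm (E m) (single l a m)) ` \<Lambda>)"
    by (rule bdd_aboveI2[of _ _ "nrm (E l) a"]) (use nrm_ge_0[OF l a] in \<open>auto simp: single_def\<close>)
  ultimately show S: "single l a \<in> carrier S" using p P carrier_1 carrier_inf by auto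
  have "nrm S (single l a) \<le> nrm (E l) a"
    using p
  proof
    assume p: "p = 1"
    have "infsum (\<lambda>m. nrm (E m) (single l a m)) \<Lambda> = infsum (\<lambda>m. nrm (E m) (single l a m)) {l}"
      by (rule infsum_cong_neutral) (use l in \<open>auto simp: single_def\<close>)
    then show ?thesis unfolding nrm_1[OF p S] using l by (simp add: single_def)
  next
    assume p: "p = \<infinity>"
    show ?thesis unfolding nrm_inf[OF p]
      by (rule cSUP_least[OF ne]) (use nrm_ge_0[OF l a] in \<open>auto simp: single_def\<close>)
  qed
  then show "nrm S (single l a) = nrm (E l) a"
    using component_le[OF S l] l by (simp add: single_def)
qed

lemma single_add:
  assumes "l \<in> \<Lambda>" "a \<in> carrier (E l)" "b \<in> carrier (E l)"
  shows "single l (a \<oplus>\<^bsub>E l\<^esub> b) = single l a \<oplus>\<^bsub>S\<^esub> single l b"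
  using assms by (auto simp: single_def fun_eq_iff)

lemma single_smult:
  assumes "l \<in> \<Lambda>" "a \<in> carrier (E l)"
  shows "single l (c \<odot>\<^bsub>E l\<^esub> a) = c \<odot>\<^bsub>S\<^esub> single l a"
  using assms by (auto simp: single_def fun_eq_iff)

lemma single_component [simp]: "l \<in> \<Lambda> \<Longrightarrow> single l a l = a" by (simp add: single_def)

lemma cut_split: "x \<in> carrier S \<Longrightarrow> x = cut A x \<oplus>\<^bsub>S\<^esub> cut (- A) x"
  using carrier_mem[of x] outside[of x] by (auto simp: cut_def fun_eq_iff)

lemma cut_insert:
  "x \<in> carrier S \<Longrightarrow> l \<in> \<Lambda> \<Longrightarrow> l \<notin> A \<Longrightarrow> cut (insert l A) x = single l (x l) \<oplus>\<^bsub>S\<^esub> cut A x"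
  using carrier_mem[of x] by (auto simp: cut_def single_def fun_eq_iff)

text \<open>A functional on an infinite sum with \<open>p = \<infinity>\<close> need not be
  determined by its coordinates; on vectors supported in a finite set it is.\<close>

lemma dual_cut:
  assumes h: "h \<in> carrier (dual S)" and x: "x \<in> carrier S" and fin: "finite A" and A: "A \<subseteq> \<Lambda>"
  shows "h (cut A x) = (\<Sum>l\<in>A. dual_restrict l h (x l))"
  using fin A
proof (induction A rule: finite_induct)
  case empty
  have "cut {} x = \<zero>\<^bsub>S\<^esub>" unfolding cut_def lp_simps by (rule restrict_ext) simp
  then show ?case using S.dual_zero[OF h] by (simp del: lp_simps)
next
  case (insert l A)
  then have l: "l \<in> \<Lambda>" by simp
  have "h (cut (insert l A) x) = h (single l (x l)) + h (cut A x)"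
    unfolding cut_insert[OF x l insert.hyps(2)]
    by (rule S.dual_add[OF h single_mem(1)[OF l carrier_mem[OF x l]] cut_mem(1)[OF x]])
  then show ?case using insert carrier_mem[OF x l] by (simp add: dual_restrict_def)
qed

lemma dual_restrict_mem:
  assumes h: "h \<in> carrier (dual S)" and l: "l \<in> \<Lambda>"
  shows "dual_restrict l h \<in> carrier (dual (E l))"
proof -
  obtain C where C: "\<And>x. x \<in> carrier S \<Longrightarrow> norm (h x) \<le> C * nrm S x"
    using S.dual_bound_ex[OF h] by metis
  have E: "normed_space (E l)" by (rule normed[OF l])
  interpret E: normed_space "E l" by (rule E)
  have "norm (h (single l a)) \<le> C * nrm (E l) a" if "a \<in> carrier (E l)" for a
    using C[OF single_mem(1)[OF l that]] single_mem(2)[OF l that] by simp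
  then show ?thesis
    by (intro E.carrier_dualI[where C = C])
       (use single_mem(1)[OF l] h in \<open>auto simp: dual_restrict_def single_add[OF l] single_smult[OF l] S.dual_add S.dual_smult
          simp del: lp_simps\<close>)
qed

lemma dual_restrict_ball:
  assumes h: "h \<in> unit_ball (dual S)" and l: "l \<in> \<Lambda>"
  shows "dual_restrict l h \<in> unit_ball (dual (E l))"
proof -
  interpret E: normed_space "E l" by (rule normed[OF l])
  have h': "h \<in> carrier (dual S)" using h by (simp add: unit_ball_def)
  have "norm (h (single l a)) \<le> nrm (E l) a" if "a \<in> carrier (E l)" for a
    using S.dual_ball_bound[OF h single_mem(1)[OF l that]] single_mem(2)[OF l that] by simp
  then show ?thesis
    by (intro E.dual_ballI)
       (use single_mem(1)[OF l] h' in \<open>auto simp: dual_restrict_def single_add[OF l] single_smult[OF l]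
          S.dual_add S.dual_smult simp del: lp_simps\<close>)
qed

lemma dual_extend_mem:
  assumes f: "f \<in> carrier (dual (E l))" and l: "l \<in> \<Lambda>"
  shows "dual_extend l f \<in> carrier (dual S)"
proof -
  interpret E: normed_space "E l" by (rule normed[OF l])
  obtain C where C: "0 \<le> C" "\<And>x. x \<in> carrier (E l) \<Longrightarrow> norm (f x) \<le> C * nrm (E l) x"
    using E.dual_bound_ex[OF f] by metis
  have "norm (f (x l)) \<le> C * nrm S x" if "x \<in> carrier S" for x
    using C(2)[OF carrier_mem[OF that l]] mult_left_mono[OF component_le[OF that l] C(1)] by linarith
  moreover have "(x \<oplus>\<^bsub>S\<^esub> y) l = x l \<oplus>\<^bsub>E l\<^esub> y l" "(c \<odot>\<^bsub>S\<^esub> x) l = c \<odot>\<^bsub>E l\<^esub> x l" for x y c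
    using l by auto
  ultimately show ?thesis
    by (intro S.carrier_dualI[where C = C])
       (use f l carrier_mem in \<open>auto simp: dual_extend_def E.dual_add E.dual_smult S.smult_closed' simp del: lp_simps\<close>)
qed

lemma dual_extend_ball:
  assumes f: "f \<in> unit_ball (dual (E l))" and l: "l \<in> \<Lambda>"
  shows "dual_extend l f \<in> unit_ball (dual S)"
proof -
  interpret E: normed_space "E l" by (rule normed[OF l])
  have f': "f \<in> carrier (dual (E l))" using f by (simp add: unit_ball_def)
  have m: "dual_extend l f \<in> carrier (dual S)" by (rule dual_extend_mem[OF f' l])
  show ?thesis
  proof (rule S.dual_ballI)
    fix x assume x: "x \<in> carrier S"
    show "norm (dual_extend l f x) \<le> nrm S x"
      using E.dual_ball_bound[OF f carrier_mem[OF x l]] component_le[OF x l] x by (simp add: dual_extend_def)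
  next
    show "dual_extend l f \<in> extensional (carrier S)" by (simp add: dual_extend_def)
  qed (rule S.dual_add[OF m] S.dual_smult[OF m]; assumption)+
qed

lemma continuous_dual_restrict:
  assumes l: "l \<in> \<Lambda>"
  shows "continuous_map (weak_star S) (weak_star (E l)) (dual_restrict l)"
  by (rule continuous_map_into_weak_star)
     (use dual_restrict_mem[OF _ l] continuous_map_weak_star_eval[OF single_mem(1)[OF l]] in
       \<open>auto simp: dual_restrict_def\<close>)

lemma continuous_dual_extend:
  assumes l: "l \<in> \<Lambda>"
  shows "continuous_map (weak_star (E l)) (weak_star S) (dual_extend l)"
  by (rule continuous_map_into_weak_star)
     (use dual_extend_mem[OF _ l] continuous_map_weak_star_eval[OF carrier_mem[OF _ l]] in
       \<open>auto simp: dual_extend_def\<close>)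

end

section \<open>Direct sums of operators\<close>

locale sum_operator = E: lp_family p \<Lambda> E + F: lp_family p \<Lambda> F
  for p \<Lambda> and E :: "'i \<Rightarrow> ('k::real_or_complex, 'a) nspace" and F :: "'i \<Rightarrow> ('k, 'b) nspace" +
  fixes T :: "'i \<Rightarrow> 'a \<Rightarrow> 'b"
  assumes T: "\<And>l. l \<in> \<Lambda> \<Longrightarrow> bounded_operator (E l) (F l) (T l)"
    and bdd: "bdd_above ((\<lambda>l. op_norm (E l) (F l) (T l)) ` \<Lambda>)"
begin

lemma operator: "l \<in> \<Lambda> \<Longrightarrow> operator (E l) (F l) (T l)"
  by (intro operator.intro E.normed F.normed T)

lemma T_bound: "l \<in> \<Lambda> \<Longrightarrow> a \<in> carrier (E l) \<Longrightarrow> nrm (F l) (T l a) \<le> op_norm (E l) (F l) (T l) * nrm (E l) a"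
  by (rule operator.op_bound[OF operator])

lemma T_mem: "l \<in> \<Lambda> \<Longrightarrow> a \<in> carrier (E l) \<Longrightarrow> T l a \<in> carrier (F l)"
  by (rule operator.T_mem[OF operator])

lemma sum_op_bound:
  assumes x: "x \<in> carrier E.S" and c: "\<And>l. l \<in> \<Lambda> \<Longrightarrow> op_norm (E l) (F l) (T l) \<le> c"
  shows "sum_op \<Lambda> T x \<in> carrier F.S" "nrm F.S (sum_op \<Lambda> T x) \<le> c * nrm E.S x"
proof -
  have y: "sum_op \<Lambda> T x \<in> (\<Pi>\<^sub>E l\<in>\<Lambda>. carrier (F l))"
    using T_mem E.carrier_mem[OF x] by (auto simp: sum_op_def)
  have le: "nrm (F l) (sum_op \<Lambda> T x l) \<le> c * nrm (E l) (x l)" if l: "l \<in> \<Lambda>" for l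
    using T_bound[OF l E.carrier_mem[OF x l]] mult_right_mono[OF c[OF l] E.nrm_ge_0[OF l E.carrier_mem[OF x l]]] l
    by (simp add: sum_op_def)
  obtain l where "l \<in> \<Lambda>" using E.ne by blast
  then have "0 \<le> c" using c operator.op_norm_ge_0[OF operator] by (meson order_trans)
  then show "sum_op \<Lambda> T x \<in> carrier F.S" "nrm F.S (sum_op \<Lambda> T x) \<le> c * nrm E.S x"
    using lp_dominated[OF E.lp_family F.lp_family x y le] by blast+
qed

lemma sum_op_cut_bound:
  assumes x: "x \<in> carrier E.S" and c: "\<And>l. l \<in> \<Lambda> \<Longrightarrow> l \<in> A \<Longrightarrow> op_norm (E l) (F l) (T l) \<le> c" and "0 \<le> c"
  shows "nrm F.S (sum_op \<Lambda> T (E.cut A x)) \<le> c * nrm E.S x"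
proof (rule lp_dominated(2)[OF E.lp_family F.lp_family x _ _ \<open>0 \<le> c\<close>])
  show "sum_op \<Lambda> T (E.cut A x) \<in> (\<Pi>\<^sub>E l\<in>\<Lambda>. carrier (F l))"
    using T_mem E.carrier_mem[OF E.cut_mem(1)[OF x]] by (auto simp: sum_op_def)
  fix l assume l: "l \<in> \<Lambda>"
  note xl = E.carrier_mem[OF x l]
  show "nrm (F l) (sum_op \<Lambda> T (E.cut A x) l) \<le> c * nrm (E l) (x l)"
  proof (cases "l \<in> A")
    case True
    then show ?thesis
      using T_bound[OF l xl] mult_right_mono[OF c[OF l True] E.nrm_ge_0[OF l xl]] l
      by (simp add: sum_op_def E.cut_def)
  next
    case False
    then show ?thesis
      using l operator.T_zero[OF operator[OF l]] E.nrm_ge_0[OF l xl] \<open>0 \<le> c\<close>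
      by (simp add: sum_op_def E.cut_def)
  qed
qed

lemma bounded_sum_op: "bounded_operator E.S F.S (sum_op \<Lambda> T)"
  unfolding bounded_operator_def
proof (intro conjI ballI allI)
  let ?C = "SUP l\<in>\<Lambda>. op_norm (E l) (F l) (T l)"
  have C: "op_norm (E l) (F l) (T l) \<le> ?C" if "l \<in> \<Lambda>" for l by (rule cSUP_upper[OF that bdd])
  show "sum_op \<Lambda> T \<in> carrier E.S \<rightarrow> carrier F.S" using sum_op_bound(1)[OF _ C] by auto
  show "\<exists>C. \<forall>x\<in>carrier E.S. nrm F.S (sum_op \<Lambda> T x) \<le> C * nrm E.S x" using sum_op_bound(2)[OF _ C] by blast
  fix x assume x: "x \<in> carrier E.S"
  show "sum_op \<Lambda> T (c \<odot>\<^bsub>E.S\<^esub> x) = c \<odot>\<^bsub>F.S\<^esub> sum_op \<Lambda> T x" for c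
    using operator.T_smult[OF operator] E.carrier_mem[OF x] by (auto simp: sum_op_def fun_eq_iff)
  fix y assume y: "y \<in> carrier E.S"
  show "sum_op \<Lambda> T (x \<oplus>\<^bsub>E.S\<^esub> y) = sum_op \<Lambda> T x \<oplus>\<^bsub>F.S\<^esub> sum_op \<Lambda> T y"
    using operator.T_add[OF operator] E.carrier_mem[OF x] E.carrier_mem[OF y] by (auto simp: sum_op_def fun_eq_iff)
qed

sublocale SO: operator E.S F.S "sum_op \<Lambda> T"
  by (intro operator.intro E.normed_space_lp_sum F.normed_space_lp_sum bounded_sum_op)

abbreviation "K l \<equiv> adjoint (E l) (T l) ` unit_ball (dual (F l))"

lemma sum_op_single: "l \<in> \<Lambda> \<Longrightarrow> sum_op \<Lambda> T (E.single l a) = F.single l (T l a)"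
  using operator.T_zero[OF operator] by (auto simp: sum_op_def E.single_def F.single_def fun_eq_iff)

lemma restrict_adjoint:
  assumes l: "l \<in> \<Lambda>"
  shows "E.dual_restrict l (adjoint E.S (sum_op \<Lambda> T) g) = adjoint (E l) (T l) (F.dual_restrict l g)"
  unfolding E.dual_restrict_def F.dual_restrict_def adjoint_def
  by (rule restrict_ext) (use E.single_mem(1)[OF l] T_mem[OF l] sum_op_single[OF l] in simp)

lemma extend_adjoint:
  assumes l: "l \<in> \<Lambda>"
  shows "E.dual_extend l (adjoint (E l) (T l) g) = adjoint E.S (sum_op \<Lambda> T) (F.dual_extend l g)"
  using E.carrier_mem[OF _ l] SO.T_mem l
  by (auto simp: E.dual_extend_def F.dual_extend_def adjoint_def fun_eq_iff sum_op_def)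

lemma restrict_K: "l \<in> \<Lambda> \<Longrightarrow> h \<in> SO.K \<Longrightarrow> E.dual_restrict l h \<in> K l"
  using restrict_adjoint F.dual_restrict_ball by auto

lemma extend_K: "l \<in> \<Lambda> \<Longrightarrow> f \<in> K l \<Longrightarrow> E.dual_extend l f \<in> SO.K"
  using extend_adjoint F.dual_extend_ball by auto

text \<open>\<open>dual_extend l\<close> embeds \<open>K l\<close> into \<open>SO.K\<close>, weak*
  continuously and without decreasing distances, as a vector of one summand keeps its norm in the
  sum.\<close>

lemma Szlenk_component_subset:
  assumes l: "l \<in> \<Lambda>"
  shows "Szlenk_op (E l) (F l) (T l) \<subseteq> Szlenk_op E.S F.S (sum_op \<Lambda> T)"
proof -
  have "E.dual_extend l ` szlenk_iter (E l) \<epsilon> (K l) \<alpha> \<subseteq> szlenk_iter E.S \<epsilon> SO.K \<alpha>" for \<epsilon> \<alpha>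
  proof (rule szlenk_iter_transfer[OF E.normed[OF l] SO.X operator.K_subset[OF operator[OF l]] SO.K_subset
        E.continuous_dual_extend[OF l]])
    show "E.dual_extend l ` K l \<subseteq> SO.K" using extend_K[OF l] by blast
    fix f g x assume "x \<in> unit_ball (E l)"
    then have x: "x \<in> carrier (E l)" "nrm (E l) x \<le> 1" by (auto simp: unit_ball_def)
    show "\<exists>y\<in>unit_ball E.S. norm (f x - g x) \<le> norm (E.dual_extend l f y - E.dual_extend l g y)"
      by (rule bexI[of _ "E.single l x"])
         (use E.single_mem[OF l x(1)] x l in \<open>auto simp: E.dual_extend_def unit_ball_def\<close>)
  qed
  then show ?thesis unfolding Szlenk_op_def Szlenk_def Szlenk_eps_def by blast
qed

text \<open>The part of \<open>x\<close> on \<open>A\<close> is a finite sum of coordinates. On the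
  rest the operator has norm at most \<eta>, and each of the two functionals contributes \<eta>
  once.\<close>

lemma SO_K_difference:
  assumes h: "h \<in> SO.K" "h' \<in> SO.K" and x: "x \<in> unit_ball E.S" and A: "finite A" "A \<subseteq> \<Lambda>"
    and \<eta>: "\<And>l. l \<in> \<Lambda> - A \<Longrightarrow> op_norm (E l) (F l) (T l) \<le> \<eta>" "0 \<le> \<eta>"
  shows "norm (h x - h' x) \<le> (\<Sum>l\<in>A. norm (E.dual_restrict l h (x l) - E.dual_restrict l h' (x l))) + 2 * \<eta>"
proof -
  have xS: "x \<in> carrier E.S" "nrm E.S x \<le> 1" using x by (auto simp: unit_ball_def)
  have hd: "h \<in> carrier (dual E.S)" "h' \<in> carrier (dual E.S)" using h SO.K_subset by auto
  let ?u = "E.cut A x" and ?v = "E.cut (- A) x"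
  \<comment> \<open>Members of \<open>SO.K\<close> factor through the operator, so smallness of the
    operator on the tail is enough.\<close>
  have small: "norm (k ?v) \<le> \<eta>" if "k \<in> SO.K" for k
  proof -
    obtain g where g: "g \<in> unit_ball (dual F.S)" "k = adjoint E.S (sum_op \<Lambda> T) g" using \<open>k \<in> SO.K\<close> by blast
    have "norm (k ?v) \<le> nrm F.S (sum_op \<Lambda> T ?v)"
      using F.S.dual_ball_bound[OF g(1) SO.T_mem[OF E.cut_mem(1)[OF xS(1)]]] E.cut_mem(1)[OF xS(1)]
      by (simp add: g(2) adjoint_def)
    also have "\<dots> \<le> \<eta> * nrm E.S x" by (rule sum_op_cut_bound[OF xS(1)]) (use \<eta> in auto)
    also have "\<dots> \<le> \<eta>" using mult_left_mono[OF xS(2) \<eta>(2)] by simp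
    finally show ?thesis .
  qed
  have split: "k x = (\<Sum>l\<in>A. E.dual_restrict l k (x l)) + k ?v" if k: "k \<in> carrier (dual E.S)" for k
    using E.S.dual_add[OF k E.cut_mem(1)[OF xS(1), of A] E.cut_mem(1)[OF xS(1), of "- A"]]
      E.cut_split[OF xS(1), of A] E.dual_cut[OF k xS(1) A] by simp
  have "h x - h' x = (\<Sum>l\<in>A. E.dual_restrict l h (x l) - E.dual_restrict l h' (x l)) + (h ?v - h' ?v)"
    by (simp add: split[OF hd(1)] split[OF hd(2)] sum_subtractf)
  also have "norm \<dots> \<le> (\<Sum>l\<in>A. norm (E.dual_restrict l h (x l) - E.dual_restrict l h' (x l))) + norm (h ?v - h' ?v)"
    by (rule norm_triangle_mono[OF norm_sum order_refl])
  also have "norm (h ?v - h' ?v) \<le> 2 * \<eta>"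
    using norm_triangle_ineq4[of "h ?v" "h' ?v"] small[OF h(1)] small[OF h(2)] by linarith
  finally show ?thesis by simp
qed

end


section \<open>Natural sums of ordinals\<close>

text \<open>\<open>le_natural_sum A \<alpha> \<beta>\<close> says that \<open>\<alpha>\<close> is at most the natural (Hessenberg) sum of the ordinals
  \<open>\<beta> l\<close>, \<open>l \<in> A\<close>: that sum is the least ordinal above all those obtained by decreasing one summand.\<close>

inductive le_natural_sum :: "'i set \<Rightarrow> 'o::wellorder \<Rightarrow> ('i \<Rightarrow> 'o) \<Rightarrow> bool" for A where
  "(\<And>\<alpha>'. \<alpha>' < \<alpha> \<Longrightarrow> \<exists>l\<in>A. \<exists>b<\<beta> l. le_natural_sum A \<alpha>' (\<beta>(l := b))) \<Longrightarrow> le_natural_sum A \<alpha> \<beta>"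

lemma le_natural_sum_mono:
  assumes "le_natural_sum A \<alpha> \<beta>" "\<And>l. l \<in> A \<Longrightarrow> \<beta> l \<le> \<gamma> l"
  shows "le_natural_sum A \<alpha> \<gamma>"
  using assms
proof (induction arbitrary: \<gamma> rule: le_natural_sum.induct)
  case (1 \<alpha> \<beta>)
  show ?case
  proof (rule le_natural_sum.intros)
    fix \<alpha>' assume "\<alpha>' < \<alpha>"
    then obtain l b where l: "l \<in> A" "b < \<beta> l" and IH: "\<And>\<gamma>. (\<And>m. m \<in> A \<Longrightarrow> (\<beta>(l := b)) m \<le> \<gamma> m) \<Longrightarrow> le_natural_sum A \<alpha>' \<gamma>"
      using 1(1) by blast
    have "le_natural_sum A \<alpha>' (\<gamma>(l := b))" by (rule IH) (use 1(2) in auto)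
    moreover have "b < \<gamma> l" using l 1(2)[of l] by simp
    ultimately show "\<exists>l\<in>A. \<exists>b<\<gamma> l. le_natural_sum A \<alpha>' (\<gamma>(l := b))" using l(1) by blast
  qed
qed

section \<open>Averages of functionals that survive derivations\<close>

context operator
begin

text \<open>By induction along the natural sum. Below \<alpha>, one summand \<open>\<beta> l\<close>
  drops to \<open>b\<close>, while \<open>f l\<close> survives \<open>\<beta> l\<close> and so has,
  arbitrarily near, points of the stage \<open>b\<close> more than \<epsilon> apart. Putting these
  in the place of \<open>f l\<close> gives nearby averages that are more than
  \<open>\<epsilon> / card A\<close> apart and lie in the stage \<open>\<alpha>'\<close> by
  induction.\<close>

lemma average_iter:
  assumes "le_natural_sum A \<alpha> \<beta>" "finite A" "A \<noteq> {}" "\<And>l. l \<in> A \<Longrightarrow> f l \<in> szlenk_iter X \<epsilon> K (\<beta> l)"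
  shows "(\<lambda>x\<in>carrier X. (\<Sum>l\<in>A. f l x) / of_nat (card A)) \<in> szlenk_iter X (\<epsilon> / card A) K \<alpha>"
  using assms(1,4)
proof (induction arbitrary: f rule: le_natural_sum.induct)
  case (1 \<alpha> \<beta>)
  let ?avg = "\<lambda>f. \<lambda>x\<in>carrier X. (\<Sum>l\<in>A. f l x) / of_nat (card A)"
  let ?s = "szlenk_iter X \<epsilon> K" and ?s' = "szlenk_iter X (\<epsilon> / card A) K"
  have n: "card A > 0" using assms(2,3) by (simp add: card_gt_0_iff)
  have fK: "f l \<in> K" if "l \<in> A" for l using 1(2)[OF that] szlenk_iter_subset[of X \<epsilon> K "\<beta> l"] by blast
  have avgK: "?avg f \<in> K" by (rule K_average[OF assms(2,3) fK])
  have "?avg f \<in> szlenk_deriv X (\<epsilon> / card A) (?s' \<alpha>')" if less: "\<alpha>' < \<alpha>" for \<alpha>'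
  proof -
    obtain l b where l: "l \<in> A" and b: "b < \<beta> l"
      and IH: "\<And>f. (\<And>m. m \<in> A \<Longrightarrow> f m \<in> ?s ((\<beta>(l := b)) m)) \<Longrightarrow> ?avg f \<in> ?s' \<alpha>'"
      using 1(1)[OF less] by blast
    have fd: "f l \<in> carrier (dual X)" "?avg f \<in> carrier (dual X)" using fK[OF l] avgK K_subset by auto
    \<comment> \<open>\<open>j \<phi>\<close> is the average with \<open>f l\<close> replaced by
      \<phi>. In this affine form its weak* continuity in \<phi> is evident.\<close>
    define j where "j = (\<lambda>\<phi>. \<lambda>x\<in>carrier X. ?avg f x + (\<phi> x - f l x) / of_nat (card A))"
    have j_avg: "j \<phi> = ?avg (f(l := \<phi>))" for \<phi>
    proof -
      have "(\<Sum>m\<in>A. (f(l := \<phi>)) m x) = (\<Sum>m\<in>A. f m x) + (\<phi> x - f l x)" for x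
      proof -
        have "(\<Sum>m\<in>A - {l}. (f(l := \<phi>)) m x) = (\<Sum>m\<in>A - {l}. f m x)" by (rule sum.cong) auto
        then show ?thesis using sum.remove[OF assms(2) l, of "\<lambda>m. (f(l := \<phi>)) m x"]
            sum.remove[OF assms(2) l, of "\<lambda>m. f m x"] by simp
      qed
      then show ?thesis by (simp add: j_def add_divide_distrib cong: restrict_cong)
    qed
    have j_mem: "j \<phi> \<in> carrier (dual X)" if "\<phi> \<in> carrier (dual X)" for \<phi>
    proof -
      let ?m = "\<lambda>x\<in>carrier X. \<phi> x + (\<lambda>x\<in>carrier X. - 1 * f l x) x"
      have m: "?m \<in> carrier (dual X)"
        by (intro X.dual_add_closed that X.dual_smult_closed fd)
      have "(\<lambda>x\<in>carrier X. ?avg f x + (\<lambda>x\<in>carrier X. (1 / of_nat (card A)) * ?m x) x) \<in> carrier (dual X)"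
        by (rule X.dual_add_closed[OF fd(2) X.dual_smult_closed[OF m]])
      also have "(\<lambda>x\<in>carrier X. ?avg f x + (\<lambda>x\<in>carrier X. (1 / of_nat (card A)) * ?m x) x) = j \<phi>"
        unfolding j_def by (rule restrict_ext) simp
      finally show ?thesis .
    qed
    have cont: "continuous_map (weak_star X) (weak_star X) j"
    proof (rule continuous_map_into_weak_star)
      fix x assume x: "x \<in> carrier X"
      have "continuous_map euclidean euclidean (\<lambda>z. ?avg f x + (z - f l x) / of_nat (card A))"
        using n by (auto intro!: continuous_intros)
      from continuous_map_compose[OF continuous_map_weak_star_eval[OF x] this]
      have "continuous_map (weak_star X) euclidean (\<lambda>\<phi>. ?avg f x + (\<phi> x - f l x) / of_nat (card A))"
        by (simp only: o_def)
      then show "continuous_map (weak_star X) euclidean (\<lambda>\<phi>. j \<phi> x)" using x by (simp add: j_def)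
    qed (use j_mem in simp)
    have js: "j \<phi> \<in> ?s' \<alpha>'" if "\<phi> \<in> ?s b" for \<phi>
      unfolding j_avg by (rule IH) (use that 1(2) in auto)
    have j_f: "j (f l) = ?avg f" by (simp add: j_avg)
    have sub: "?s b \<subseteq> carrier (dual X)" "?s' \<alpha>' \<subseteq> carrier (dual X)"
      using szlenk_iter_subset K_subset by (meson order_trans)+
    have fl: "f l \<in> szlenk_deriv X \<epsilon> (?s b)" using 1(2)[OF l] b szlenk_iter_eq[of X \<epsilon> K "\<beta> l"] by blast
    show ?thesis
      unfolding X.szlenk_deriv_iff[OF sub(2)]
    proof (intro conjI allI impI)
      have "f l \<in> ?s b" using fl szlenk_deriv_subset by blast
      then show "?avg f \<in> ?s' \<alpha>'" using js[of "f l"] j_f by simp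
      fix V assume V: "openin (weak_star X) V" "?avg f \<in> V"
      let ?U = "{h \<in> topspace (weak_star X). j h \<in> V}"
      have "openin (weak_star X) ?U" by (rule openin_continuous_map_preimage[OF cont V(1)])
      moreover have "f l \<in> ?U" using V(2) j_f fd(1) by simp
      ultimately have "\<exists>g\<in>?s b \<inter> ?U. \<exists>h\<in>?s b \<inter> ?U. \<exists>x\<in>unit_ball X. \<epsilon> < norm (g x - h x)"
        using fl unfolding X.szlenk_deriv_iff[OF sub(1)] by meson
      then obtain g h x where gh: "g \<in> ?s b \<inter> ?U" "h \<in> ?s b \<inter> ?U" "x \<in> unit_ball X" "\<epsilon> < norm (g x - h x)"
        by meson
      have x: "x \<in> carrier X" using gh(3) by (simp add: unit_ball_def)
      have "j g x - j h x = (g x - h x) / of_nat (card A)" using x by (simp add: j_def diff_divide_distrib)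
      then have "\<epsilon> / card A < norm (j g x - j h x)"
        using gh(4) n by (simp add: norm_divide divide_strict_right_mono)
      show "\<exists>g\<in>?s' \<alpha>' \<inter> V. \<exists>h\<in>?s' \<alpha>' \<inter> V. \<exists>x\<in>unit_ball X. \<epsilon> / card A < norm (g x - h x)"
      proof -
        have "j g \<in> ?s' \<alpha>' \<inter> V" "j h \<in> ?s' \<alpha>' \<inter> V" using gh js by auto
        then show ?thesis using gh(3) \<open>\<epsilon> / card A < norm (j g x - j h x)\<close> by blast
      qed
    qed
  qed
  then show ?case unfolding szlenk_iter_eq[of X "\<epsilon> / card A" K \<alpha>] using avgK by blast
qed

end

section \<open>Upper bound for the index when the norms tend to zero\<close>

context sum_operator
begin

text \<open>Near \<open>h\<close>, the ranks of the coordinates do not exceed those of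
  \<open>h\<close>. Two points of the stage \<open>\<alpha>'\<close> near \<open>h\<close> and more
  than \<epsilon> apart cannot both have all coordinates in the stages \<open>\<beta> l\<close>,
  where differences near \<open>h\<close> are at most \<delta> each. So in one of them the rank of
  some coordinate is smaller, and the induction applies to that point.\<close>

lemma iter_rank_le_natural_sum:
  fixes r :: "'i \<Rightarrow> ('a \<Rightarrow> 'k) \<Rightarrow> 'o::wellorder"
  assumes A: "finite A" "A \<subseteq> \<Lambda>"
    and \<eta>: "\<And>l. l \<in> \<Lambda> - A \<Longrightarrow> op_norm (E l) (F l) (T l) \<le> \<eta>" "0 \<le> \<eta>"
    and \<epsilon>: "real (card A) * \<delta> + 2 * \<eta> < \<epsilon>"
    and r: "\<And>l f. l \<in> A \<Longrightarrow> f \<in> K l \<Longrightarrow> f \<in> szlenk_iter (E l) \<delta> (K l) (r l f)"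
    and r': "\<And>l f. l \<in> A \<Longrightarrow> f \<in> K l \<Longrightarrow> f \<notin> szlenk_deriv (E l) \<delta> (szlenk_iter (E l) \<delta> (K l) (r l f))"
    and h: "h \<in> szlenk_iter E.S \<epsilon> SO.K \<alpha>"
  shows "le_natural_sum A \<alpha> (\<lambda>l. r l (E.dual_restrict l h))"
  using h
proof (induction \<alpha> arbitrary: h rule: less_induct)
  case (less \<alpha>)
  let ?\<rho> = E.dual_restrict and ?s = "\<lambda>l. szlenk_iter (E l) \<delta> (K l)"
  define \<beta> where "\<beta> = (\<lambda>l. r l (?\<rho> l h))"
  have hK: "h \<in> SO.K" using less.prems szlenk_iter_subset by blast
  have sub: "?s l \<gamma> \<subseteq> carrier (dual (E l))" if "l \<in> A" for l \<gamma>
    using szlenk_iter_subset operator.K_subset[OF operator] that A by (meson order_trans subsetD)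
  have "\<exists>V. openin (weak_star (E l)) V \<and> ?\<rho> l h \<in> V \<and>
      (\<forall>f\<in>?s l (\<beta> l) \<inter> V. \<forall>g\<in>?s l (\<beta> l) \<inter> V. \<forall>x\<in>unit_ball (E l). norm (f x - g x) \<le> \<delta>)" if l: "l \<in> A" for l
  proof -
    have lL: "l \<in> \<Lambda>" using l A by blast
    have "?\<rho> l h \<in> ?s l (\<beta> l)" "?\<rho> l h \<notin> szlenk_deriv (E l) \<delta> (?s l (\<beta> l))"
      unfolding \<beta>_def using r[OF l] r'[OF l] restrict_K[OF lL hK] by blast+
    then show ?thesis
      unfolding normed_space.szlenk_deriv_iff[OF E.normed[OF lL] sub[OF l]] by (meson not_le)
  qed
  then obtain V where V: "\<And>l. l \<in> A \<Longrightarrow> openin (weak_star (E l)) (V l)" "\<And>l. l \<in> A \<Longrightarrow> ?\<rho> l h \<in> V l"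
    and V_small: "\<And>l f g x. \<lbrakk>l \<in> A; f \<in> ?s l (\<beta> l) \<inter> V l; g \<in> ?s l (\<beta> l) \<inter> V l; x \<in> unit_ball (E l)\<rbrakk> \<Longrightarrow> norm (f x - g x) \<le> \<delta>"
    by metis
  \<comment> \<open>Upper semicontinuity of the rank: a larger rank would put \<open>f\<close> into
    the derivative of the stage \<open>\<beta> l\<close>, but \<open>V l\<close> is a neighbourhood
    of \<open>f\<close> in which that stage has diameter at most \<delta>.\<close>
  have rank_le: "r l f \<le> \<beta> l" if l: "l \<in> A" and f: "f \<in> K l" "f \<in> V l" for l f
  proof (rule ccontr)
    assume "\<not> r l f \<le> \<beta> l"
    then have "\<beta> l < r l f" by simp
    then have d: "f \<in> szlenk_deriv (E l) \<delta> (?s l (\<beta> l))" by (rule szlenk_iterD[OF r[OF l f(1)]])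
    have lL: "l \<in> \<Lambda>" using l A by blast
    show False
      using d V(1)[OF l] f(2) V_small[OF l]
      unfolding normed_space.szlenk_deriv_iff[OF E.normed[OF lL] sub[OF l]] by (meson not_le)
  qed
  \<comment> \<open>The factor \<open>topspace\<close> keeps this a set of functionals if
    \<open>A\<close> is empty.\<close>
  let ?W = "topspace (weak_star E.S) \<inter> (\<Inter>l\<in>A. {k \<in> topspace (weak_star E.S). ?\<rho> l k \<in> V l})"
  have W: "openin (weak_star E.S) ?W"
  proof (cases "A = {}")
    case False
    have "openin (weak_star E.S) (\<Inter>l\<in>A. {k \<in> topspace (weak_star E.S). ?\<rho> l k \<in> V l})"
      by (rule openin_INT2[OF A(1) False])
         (use V(1) A openin_continuous_map_preimage[OF E.continuous_dual_restrict] in blast)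
    then show ?thesis by (rule openin_Int[OF openin_topspace])
  qed (use openin_topspace[of "weak_star E.S"] in simp)
  have hW: "h \<in> ?W" using V(2) hK SO.K_subset by auto
  show ?case
  proof (rule le_natural_sum.intros)
    fix \<alpha>' assume less': "\<alpha>' < \<alpha>"
    let ?S = "szlenk_iter E.S \<epsilon> SO.K \<alpha>'"
    have Ssub: "?S \<subseteq> carrier (dual E.S)" using szlenk_iter_subset SO.K_subset by (meson order_trans)
    have "h \<in> szlenk_deriv E.S \<epsilon> ?S" using less.prems less' szlenk_iter_eq[of E.S \<epsilon> SO.K \<alpha>] by blast
    then have "\<exists>g\<in>?S \<inter> ?W. \<exists>k\<in>?S \<inter> ?W. \<exists>x\<in>unit_ball E.S. \<epsilon> < norm (g x - k x)"
      unfolding E.S.szlenk_deriv_iff[OF Ssub] using W hW by meson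
    then obtain g k x where gk: "g \<in> ?S \<inter> ?W" "k \<in> ?S \<inter> ?W" "x \<in> unit_ball E.S" "\<epsilon> < norm (g x - k x)"
      by meson
    have gkK: "g \<in> SO.K" "k \<in> SO.K" using gk(1,2) szlenk_iter_subset[of E.S \<epsilon> SO.K \<alpha>'] by blast+
    \<comment> \<open>Otherwise the coordinates in \<open>A\<close> contribute at most
      \<open>card A * \<delta>\<close> and the others at most \<open>2 * \<eta>\<close>, together
      less than \<epsilon>.\<close>
    have "\<exists>l\<in>A. ?\<rho> l g \<notin> ?s l (\<beta> l) \<or> ?\<rho> l k \<notin> ?s l (\<beta> l)"
    proof (rule ccontr)
      assume no: "\<not> ?thesis"
      have "norm (?\<rho> l g (x l) - ?\<rho> l k (x l)) \<le> \<delta>" if l: "l \<in> A" for l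
      proof (rule V_small[OF l])
        have xS: "x \<in> carrier E.S" "nrm E.S x \<le> 1" using gk(3) by (auto simp: unit_ball_def)
        then show "x l \<in> unit_ball (E l)"
          using E.carrier_mem[OF xS(1)] E.component_le[OF xS(1)] l A by (force simp: unit_ball_def)
      qed (use no gk l in auto)
      then have "(\<Sum>l\<in>A. norm (?\<rho> l g (x l) - ?\<rho> l k (x l))) \<le> card A * \<delta>"
        using sum_bounded_above[of A "\<lambda>l. norm (?\<rho> l g (x l) - ?\<rho> l k (x l))" \<delta>] by simp
      moreover have "norm (g x - k x) \<le> (\<Sum>l\<in>A. norm (?\<rho> l g (x l) - ?\<rho> l k (x l))) + 2 * \<eta>"
        by (rule SO_K_difference[OF gkK gk(3) A \<eta>])
      ultimately show False using gk(4) \<epsilon> by linarith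
    qed
    then obtain l k where l: "l \<in> A" and k: "k \<in> ?S \<inter> ?W" "?\<rho> l k \<notin> ?s l (\<beta> l)" using gk(1,2) by blast
    have kK: "?\<rho> m k \<in> K m" if "m \<in> A" for m
      using restrict_K[of m k] k(1) that A szlenk_iter_subset[of E.S \<epsilon> SO.K \<alpha>'] by blast
    have le: "r m (?\<rho> m k) \<le> \<beta> m" if "m \<in> A" for m
      by (rule rank_le[OF that kK[OF that]]) (use k(1) that in auto)
    have "r l (?\<rho> l k) \<noteq> \<beta> l" using r[OF l kK[OF l]] k(2) by metis
    then have lt: "r l (?\<rho> l k) < \<beta> l" using le[OF l] by simp
    have "le_natural_sum A \<alpha>' (\<lambda>m. r m (?\<rho> m k))" by (rule less.IH[OF less']) (use k(1) in blast)
    then have "le_natural_sum A \<alpha>' (\<beta>(l := r l (?\<rho> l k)))"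
      by (rule le_natural_sum_mono) (use le in auto)
    then show "\<exists>l\<in>A. \<exists>b<r l (?\<rho> l h). le_natural_sum A \<alpha>' ((\<lambda>l. r l (?\<rho> l h))(l := b))"
      using l lt unfolding \<beta>_def by blast
  qed
qed

text \<open>Only finitely many coordinates matter up to a small error. If their stages at \<alpha>
  are all empty, every coordinate has a rank and \<alpha> is at most the natural sum of the ranks
  for one \<open>h\<close>; averaging then produces a point of the stage \<alpha> in a single
  \<open>K l\<close>, for a smaller \<epsilon>.\<close>

theorem Szlenk_sum_subset:
  assumes c0: "(\<lambda>l. op_norm (E l) (F l) (T l)) \<in> c0 \<Lambda>"
  shows "(Szlenk_op E.S F.S (sum_op \<Lambda> T) :: 'o::wellorder set) \<subseteq> (\<Union>l\<in>\<Lambda>. Szlenk_op (E l) (F l) (T l))"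
proof
  fix \<alpha> :: 'o assume "\<alpha> \<in> Szlenk_op E.S F.S (sum_op \<Lambda> T)"
  then obtain \<epsilon> h where e: "\<epsilon> > 0" and h: "h \<in> szlenk_iter E.S \<epsilon> SO.K \<alpha>"
    unfolding Szlenk_op_def Szlenk_def Szlenk_eps_def by blast
  obtain l0 where l0: "l0 \<in> \<Lambda>" using E.ne by blast
  \<comment> \<open>The index \<open>l0\<close> makes \<open>A\<close> nonempty. Outside
    \<open>A\<close> the norms are below \<open>\<epsilon> / 4\<close>; with the \<delta> chosen
    next, \<open>card A * \<delta> + 2 * (\<epsilon> / 4)\<close> is three quarters of
    \<epsilon>.\<close>
  define A where "A = insert l0 {l \<in> \<Lambda>. \<epsilon> / 4 \<le> \<bar>op_norm (E l) (F l) (T l)\<bar>}"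
  have "\<epsilon> / 4 > 0" using e by simp
  then have "finite {l \<in> \<Lambda>. \<epsilon> / 4 \<le> \<bar>op_norm (E l) (F l) (T l)\<bar>}" using c0 unfolding c0_def by blast
  then have A: "finite A" "A \<subseteq> \<Lambda>" "A \<noteq> {}" using l0 by (auto simp: A_def)
  have n: "card A > 0" using A by (simp add: card_gt_0_iff)
  define \<delta> where "\<delta> = \<epsilon> / (4 * card A)"
  have d: "\<delta> > 0" using e n by (simp add: \<delta>_def)
  show "\<alpha> \<in> (\<Union>l\<in>\<Lambda>. Szlenk_op (E l) (F l) (T l))"
  proof (cases "\<exists>l\<in>A. szlenk_iter (E l) \<delta> (K l) \<alpha> \<noteq> {}")
    case True
    then show ?thesis using d A(2) unfolding Szlenk_op_def Szlenk_def Szlenk_eps_def by blast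
  next
    case False
    define r :: "'i \<Rightarrow> ('a \<Rightarrow> 'k) \<Rightarrow> 'o" where "r = (\<lambda>l f. SOME \<beta>. f \<in> szlenk_iter (E l) \<delta> (K l) \<beta> \<and>
        f \<notin> szlenk_deriv (E l) \<delta> (szlenk_iter (E l) \<delta> (K l) \<beta>))"
    have r: "f \<in> szlenk_iter (E l) \<delta> (K l) (r l f) \<and>
        f \<notin> szlenk_deriv (E l) \<delta> (szlenk_iter (E l) \<delta> (K l) (r l f))" if "l \<in> A" "f \<in> K l" for l f
      unfolding r_def
      by (rule someI_ex[of "\<lambda>\<beta>. f \<in> szlenk_iter (E l) \<delta> (K l) \<beta> \<and>
          f \<notin> szlenk_deriv (E l) \<delta> (szlenk_iter (E l) \<delta> (K l) \<beta>)"])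
        (rule szlenk_rank[of _ _ _ _ \<alpha>], use that False in auto)
    define \<beta> where "\<beta> = (\<lambda>l. r l (E.dual_restrict l h))"
    have ns: "le_natural_sum A \<alpha> \<beta>"
      unfolding \<beta>_def
    proof (rule iter_rank_le_natural_sum[OF A(1,2), of "\<epsilon> / 4" \<delta> \<epsilon> r h])
      fix l assume "l \<in> \<Lambda> - A"
      then show "op_norm (E l) (F l) (T l) \<le> \<epsilon> / 4" by (auto simp: A_def)
    next
      have "real (card A) * \<delta> = \<epsilon> / 4" using n by (simp add: \<delta>_def)
      then show "real (card A) * \<delta> + 2 * (\<epsilon> / 4) < \<epsilon>" using e by simp
    qed (use r h e in auto)
    \<comment> \<open>The coordinate of largest rank survives all the ranks that occur, so copies of
      it can take the place of all summands.\<close>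
    have "Max (\<beta> ` A) \<in> \<beta> ` A" using A by simp
    then obtain l where l: "l \<in> A" "\<beta> l = Max (\<beta> ` A)" by auto
    have max: "\<beta> m \<le> \<beta> l" if "m \<in> A" for m using l(2) A(1) that by simp
    have lL: "l \<in> \<Lambda>" using l(1) A(2) by blast
    have hK: "h \<in> SO.K" using h szlenk_iter_subset[of E.S \<epsilon> SO.K \<alpha>] by blast
    have "E.dual_restrict l h \<in> szlenk_iter (E l) \<delta> (K l) (\<beta> m)" if "m \<in> A" for m
      using r[OF l(1) restrict_K[OF lL hK]] szlenk_iter_antimono[OF max[OF that], of "E l" \<delta> "K l"]
      unfolding \<beta>_def by blast
    then have "(\<lambda>x\<in>carrier (E l). (\<Sum>m\<in>A. E.dual_restrict l h x) / of_nat (card A))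
        \<in> szlenk_iter (E l) (\<delta> / card A) (K l) \<alpha>"
      by (rule operator.average_iter[OF operator[OF lL] ns A(1,3)])
    then have "szlenk_iter (E l) (\<delta> / card A) (K l) \<alpha> \<noteq> {}" by blast
    moreover have "\<delta> / card A > 0" using d n by simp
    ultimately show ?thesis using lL unfolding Szlenk_op_def Szlenk_def Szlenk_eps_def by blast
  qed
qed

end

section \<open>Weak* compactness\<close>

lemma limitin_weak_star:
  assumes "f \<in> carrier (dual X)" "\<And>n. h n \<in> carrier (dual X)"
    and "\<And>x. x \<in> carrier X \<Longrightarrow> ((\<lambda>n. h n x) \<longlongrightarrow> f x) G"
  shows "limitin (weak_star X) h f G"
  unfolding weak_star_def limitin_subtopology limitin_componentwise
  using assms by (auto simp: carrier_dual PiE_def)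

lemma regular_space_weak_star: "regular_space (weak_star X)"
  unfolding weak_star_def
  by (intro regular_space_subtopology) (simp add: regular_space_product_topology regular_space_euclidean)

text \<open>The ball is the intersection of a product of closed balls of scalars, compact by
  Tychonoff's theorem, with the closed conditions of additivity and homogeneity.\<close>

theorem Banach_Alaoglu:
  fixes X :: "('k::real_or_complex, 'a) nspace" (structure)
  assumes "normed_space X"
  shows "compactin (weak_star X) (unit_ball (dual X))"
proof -
  interpret normed_space X by fact
  let ?P = "product_topology (\<lambda>_. euclidean :: 'k topology) (carrier X)"
  let ?B = "\<Pi>\<^sub>E x\<in>carrier X. cball (0 :: 'k) (nrm X x)"
  let ?A = "\<lambda>(x, y). {f \<in> topspace ?P. f (x \<oplus> y) - (f x + f y) \<in> {0}}"
  let ?M = "\<lambda>(c, x). {f \<in> topspace ?P. f (c \<odot> x) - c * f x \<in> {0}}"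
  let ?I = "carrier X \<times> carrier X" and ?J = "(UNIV :: 'k set) \<times> carrier X"
  have ev: "continuous_map ?P euclidean (\<lambda>f. f x)" if "x \<in> carrier X" for x
    using that by (rule continuous_map_product_projection)
  have A: "closedin ?P (?A i)" if i: "i \<in> ?I" for i
  proof -
    obtain x y where xy: "i = (x, y)" "x \<in> carrier X" "y \<in> carrier X" using i by blast
    have "continuous_map ?P euclidean (\<lambda>f. f (x \<oplus> y) - (f x + f y))"
      by (intro continuous_map_add continuous_map_diff ev) (use xy in auto)
    then show ?thesis unfolding xy(1) prod.case by (rule closedin_continuous_map_preimage) simp
  qed
  have M: "closedin ?P (?M i)" if i: "i \<in> ?J" for i
  proof -
    obtain c x where cx: "i = (c, x)" "x \<in> carrier X" using i by blast
    have "continuous_map euclidean euclidean (\<lambda>z. c * z)" by (auto intro!: continuous_intros)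
    from continuous_map_compose[OF ev[OF cx(2)] this]
    have "continuous_map ?P euclidean (\<lambda>f. f (c \<odot> x) - c * f x)"
      by (intro continuous_map_diff ev) (use cx in \<open>auto simp: o_def\<close>)
    then show ?thesis unfolding cx(1) prod.case by (rule closedin_continuous_map_preimage) simp
  qed
  have "compactin ?P ?B" by (simp add: compactin_PiE)
  moreover have "closedin ?P (\<Inter>i\<in>?I. ?A i)" by (rule closedin_INT) (use A zero_closed in auto)
  moreover have "closedin ?P (\<Inter>i\<in>?J. ?M i)" by (rule closedin_INT) (use M zero_closed in auto)
  ultimately have "compactin ?P ((\<Inter>i\<in>?I. ?A i) \<inter> ((\<Inter>i\<in>?J. ?M i) \<inter> ?B))"
    by (intro closed_Int_compactin)
  also have "(\<Inter>i\<in>?I. ?A i) \<inter> ((\<Inter>i\<in>?J. ?M i) \<inter> ?B) = unit_ball (dual X)" (is "?L = ?R")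
  proof (intro equalityI subsetI)
    fix f assume f: "f \<in> ?L"
    show "f \<in> ?R"
    proof (rule dual_ballI)
      show "f \<in> extensional (carrier X)" using f by (auto simp: PiE_def)
      fix x assume x: "x \<in> carrier X"
      show "norm (f x) \<le> nrm X x" using f x by (auto dest: PiE_mem)
      show "f (c \<odot> x) = c * f x" for c using f x by force
      show "f (x \<oplus> y) = f x + f y" if "y \<in> carrier X" for y using f x that by force
    qed
  next
    fix f assume f: "f \<in> ?R"
    then have fc: "f \<in> carrier (dual X)" by (simp add: unit_ball_def)
    have "f \<in> ?B" using dual_ball_bound[OF f] fc by (auto simp: carrier_dual PiE_def)
    moreover have "f \<in> topspace ?P" using fc by (auto simp: carrier_dual PiE_def)
    ultimately show "f \<in> ?L" using dual_add[OF fc] dual_smult[OF fc] by auto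
  qed
  finally show ?thesis unfolding weak_star_def compactin_subtopology by (auto simp: unit_ball_def)
qed

text \<open>Otherwise the open sets visited finitely often cover \<open>K\<close>, and a finite
  subcover would make \<open>N\<close> finite.\<close>

lemma compactin_cluster_point:
  fixes h :: "nat \<Rightarrow> 'z"
  assumes K: "compactin Z K" and h: "\<And>n. n \<in> N \<Longrightarrow> h n \<in> K" and N: "infinite N"
  shows "\<exists>f\<in>K. \<forall>V. openin Z V \<longrightarrow> f \<in> V \<longrightarrow> infinite {n \<in> N. h n \<in> V}"
proof (rule ccontr)
  assume no: "\<not> ?thesis"
  let ?U = "{V. openin Z V \<and> finite {n \<in> N. h n \<in> V}}"
  have "K \<subseteq> \<Union>?U" using no by blast
  then obtain \<F> where F: "finite \<F>" "\<F> \<subseteq> ?U" "K \<subseteq> \<Union>\<F>"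
    using compactinD[OF K, of ?U] by blast
  have "N \<subseteq> (\<Union>V\<in>\<F>. {n \<in> N. h n \<in> V})" using h F(3) by blast
  moreover have "finite (\<Union>V\<in>\<F>. {n \<in> N. h n \<in> V})" using F by blast
  ultimately show False using N finite_subset by blast
qed

lemma (in operator) compactin_K: "compactin (weak_star X) K"
proof (rule image_compactin[OF Banach_Alaoglu[OF Y]])
  show "continuous_map (weak_star Y) (weak_star X) (adjoint X T)"
    by (rule continuous_map_into_weak_star)
       (use adjoint_mem continuous_map_weak_star_eval[OF T_mem] in \<open>auto simp: adjoint_def\<close>)
qed


section \<open>Operators that are not in \<open>c\<^sub>0\<close>\<close>

lemma (in operator) norming_pair:
  assumes c: "0 < c" "c < op_norm X Y T"
  shows "\<exists>u\<in>unit_ball X. \<exists>g\<in>unit_ball (dual Y). g (T u) = of_real c"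
proof -
  have "unit_ball X \<noteq> {}" using X.zero_in_unit_ball by blast
  then obtain x where x: "x \<in> unit_ball X" "c < nrm Y (T x)"
    using c(2) less_cSUP_iff[OF _ bdd_above_op] unfolding op_norm_def by blast
  have xc: "x \<in> carrier X" "nrm X x \<le> 1" using x(1) by (auto simp: unit_ball_def)
  obtain g where g: "g \<in> unit_ball (dual Y)" "g (T x) = of_real (nrm Y (T x))"
    using Hahn_Banach[OF Y T_mem[OF xc(1)]] by blast
  \<comment> \<open>Shrinking \<open>x\<close> makes the value exactly \<open>c\<close>, the same
    for every operator of a family; this lets values at cluster points be computed exactly.\<close>
  let ?r = "c / nrm Y (T x)"
  let ?u = "of_real ?r \<odot>\<^bsub>X\<^esub> x"
  have r: "0 \<le> ?r" "?r \<le> 1" using c x by auto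
  have "nrm X ?u \<le> 1"
    using xc r mult_mono[OF r(2) xc(2)] X.nrm_ge_0[OF xc(1)]
    by (simp only: X.nrm_smult norm_of_real abs_of_nonneg mult_1)
  then have "?u \<in> unit_ball X" using xc by (simp add: unit_ball_def)
  moreover have "g (T ?u) = of_real c"
    using g xc c x by (simp add: T_smult Y.dual_smult unit_ball_def)
  ultimately show ?thesis using g(1) by blast
qed

context sum_operator
begin

text \<open>The value \<open>c\<close> is half the threshold, because the operator norm need not be
  attained.\<close>

lemma norming_family:
  assumes "(\<lambda>l. op_norm (E l) (F l) (T l)) \<notin> c0 \<Lambda>"
  obtains c \<nu> u g where "(c::real) > 0" "inj (\<nu> :: nat \<Rightarrow> 'i)" "range \<nu> \<subseteq> \<Lambda>"
    "\<And>n. u n \<in> unit_ball (E (\<nu> n))" "\<And>n. g n \<in> unit_ball (dual (F (\<nu> n)))"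
    "\<And>n. g n (T (\<nu> n) (u n)) = of_real c"
proof -
  obtain \<epsilon> where e: "\<epsilon> > 0" "infinite {l \<in> \<Lambda>. \<epsilon> \<le> \<bar>op_norm (E l) (F l) (T l)\<bar>}"
    using assms unfolding c0_def by blast
  obtain \<nu> :: "nat \<Rightarrow> 'i" where l: "inj \<nu>" "range \<nu> \<subseteq> {l \<in> \<Lambda>. \<epsilon> \<le> \<bar>op_norm (E l) (F l) (T l)\<bar>}"
    using infinite_countable_subset[OF e(2)] by blast
  have lL: "\<nu> n \<in> \<Lambda>" for n using l(2) by blast
  have "\<epsilon> / 2 < op_norm (E (\<nu> n)) (F (\<nu> n)) (T (\<nu> n))" for n
  proof -
    have "\<epsilon> \<le> \<bar>op_norm (E (\<nu> n)) (F (\<nu> n)) (T (\<nu> n))\<bar>" using l(2) by blast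
    then show ?thesis using operator.op_norm_ge_0[OF operator[OF lL], of n] e(1) by simp
  qed
  then have "\<exists>u g. u \<in> unit_ball (E (\<nu> n)) \<and> g \<in> unit_ball (dual (F (\<nu> n))) \<and> g (T (\<nu> n) u) = of_real (\<epsilon> / 2)" for n
    using operator.norming_pair[OF operator[OF lL], of "\<epsilon> / 2" n] e(1) by auto
  then obtain u g where "\<And>n. u n \<in> unit_ball (E (\<nu> n)) \<and> g n \<in> unit_ball (dual (F (\<nu> n))) \<and>
      g n (T (\<nu> n) (u n)) = of_real (\<epsilon> / 2)" by metis
  then show ?thesis by (intro that[of "\<epsilon> / 2" \<nu> u g]) (use e(1) l(1) lL in auto)
qed

lemma Szlenk_UNIV_p_inf:
  assumes p: "p = \<infinity>" and nc0: "(\<lambda>l. op_norm (E l) (F l) (T l)) \<notin> c0 \<Lambda>"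
  shows "Szlenk_op E.S F.S (sum_op \<Lambda> T) = UNIV"
proof -
  obtain c \<nu> u g where c: "(c::real) > 0" and inj: "inj (\<nu> :: nat \<Rightarrow> 'i)" and \<nu>: "range \<nu> \<subseteq> \<Lambda>"
    and u: "\<And>n. u n \<in> unit_ball (E (\<nu> n))" and g: "\<And>n. g n \<in> unit_ball (dual (F (\<nu> n)))"
    and gu: "\<And>n. g n (T (\<nu> n) (u n)) = of_real c"
    by (rule norming_family[OF nc0], rule that)
  have \<nu>m: "\<nu> n \<in> \<Lambda>" for n using \<nu> by blast
  define h where "h n = adjoint E.S (sum_op \<Lambda> T) (F.dual_extend (\<nu> n) (g n))" for n
  have hK: "h n \<in> SO.K" for n unfolding h_def by (rule imageI[OF F.dual_extend_ball[OF g \<nu>m]])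
  have h_eval: "h n x = g n (T (\<nu> n) (x (\<nu> n)))" if "x \<in> carrier E.S" for n x
    using that SO.T_mem[OF that] \<nu>m by (simp add: h_def adjoint_def F.dual_extend_def sum_op_def)
  \<comment> \<open>Cluster points along the whole sequence; those along any infinite set of indices
    belong to \<open>L\<close> as well.\<close>
  define L where "L = {f \<in> SO.K. \<forall>V. openin (weak_star E.S) V \<longrightarrow> f \<in> V \<longrightarrow> infinite {n. h n \<in> V}}"
  have cluster: "\<exists>f\<in>L. \<forall>V. openin (weak_star E.S) V \<longrightarrow> f \<in> V \<longrightarrow> infinite {n \<in> N. h n \<in> V}"
    if N: "infinite N" for N
  proof -
    have "\<exists>f\<in>SO.K. \<forall>V. openin (weak_star E.S) V \<longrightarrow> f \<in> V \<longrightarrow> infinite {n \<in> N. h n \<in> V}"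
      by (rule compactin_cluster_point[OF SO.compactin_K hK N])
    then obtain f where f: "f \<in> SO.K" "\<forall>V. openin (weak_star E.S) V \<longrightarrow> f \<in> V \<longrightarrow> infinite {n \<in> N. h n \<in> V}"
      by (rule bexE)
    have "infinite {n. h n \<in> V}" if "openin (weak_star E.S) V" "f \<in> V" for V
      by (rule infinite_super[of "{n \<in> N. h n \<in> V}"]) (use f(2) that in auto)
    then show ?thesis using f unfolding L_def by blast
  qed
  have LK: "L \<subseteq> SO.K" by (auto simp: L_def)
  have Ld: "L \<subseteq> carrier (dual E.S)" using LK SO.K_subset by blast
  have "L \<subseteq> szlenk_deriv E.S (c / 2) L"
  proof
    fix f assume f: "f \<in> L"
    show "f \<in> szlenk_deriv E.S (c / 2) L"
      unfolding E.S.szlenk_deriv_iff[OF Ld]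
    proof (intro conjI allI impI f)
      fix V assume V: "openin (weak_star E.S) V" "f \<in> V"
      \<comment> \<open>Cluster points of functionals in \<open>U\<close> need not lie in
        \<open>U\<close>, but they lie in the closed set \<open>C\<close> and so in
        \<open>V\<close>.\<close>
      have "neighbourhood_base_of (closedin (weak_star E.S)) (weak_star E.S)"
        using regular_space_weak_star by (simp add: neighbourhood_base_of_closedin)
      then obtain U C where U: "openin (weak_star E.S) U" "closedin (weak_star E.S) C" "f \<in> U" "U \<subseteq> C" "C \<subseteq> V"
        using V unfolding neighbourhood_base_of by meson
      have "infinite {n. h n \<in> U}" using f U(1,3) unfolding L_def by blast
      then obtain s :: "nat \<Rightarrow> nat" where s: "inj s" "range s \<subseteq> {n. h n \<in> U}"
        using infinite_countable_subset by blast
      let ?N1 = "range (\<lambda>n. s (2 * n))" and ?N2 = "range (\<lambda>n. s (2 * n + 1))"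
      have inf: "infinite ?N1" "infinite ?N2"
        by (rule range_inj_infinite, rule injI, use injD[OF s(1)] in fastforce)+
      have disj: "?N1 \<inter> ?N2 = {}"
      proof -
        have "s (2 * m) \<noteq> s (2 * n + 1)" for m n using injD[OF s(1), of "2 * m" "2 * n + 1"] by presburger
        then show ?thesis by blast
      qed
      obtain f1 where f1: "f1 \<in> L"
          "\<And>V. openin (weak_star E.S) V \<Longrightarrow> f1 \<in> V \<Longrightarrow> infinite {n \<in> ?N1. h n \<in> V}"
        using cluster[OF inf(1)] by blast
      obtain f2 where f2: "f2 \<in> L"
          "\<And>V. openin (weak_star E.S) V \<Longrightarrow> f2 \<in> V \<Longrightarrow> infinite {n \<in> ?N2. h n \<in> V}"
        using cluster[OF inf(2)] by blast
      have in_C: "f' \<in> C"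
        if f': "f' \<in> L" and N: "N \<subseteq> range s"
          and cl: "\<And>V. openin (weak_star E.S) V \<Longrightarrow> f' \<in> V \<Longrightarrow> infinite {n \<in> N. h n \<in> V}" for f' N
      proof (rule ccontr)
        assume "f' \<notin> C"
        then have "f' \<in> topspace (weak_star E.S) - C" using f' Ld by auto
        then have "infinite {n \<in> N. h n \<in> topspace (weak_star E.S) - C}"
          using cl U(2) by blast
        moreover have "{n \<in> N. h n \<in> topspace (weak_star E.S) - C} = {}" using N s(2) U(4) by blast
        ultimately show False by (metis finite.emptyI)
      qed
      have eval: "f' x = z"
        if x: "x \<in> carrier E.S" and f': "f' \<in> L" and hz: "\<And>n. n \<in> N \<Longrightarrow> h n x = z"
          and cl: "\<And>V. openin (weak_star E.S) V \<Longrightarrow> f' \<in> V \<Longrightarrow> infinite {n \<in> N. h n \<in> V}" for f' N x z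
      proof (rule ccontr)
        assume ne: "f' x \<noteq> z"
        let ?V = "{k \<in> topspace (weak_star E.S). k x \<in> - {z}}"
        have "openin (weak_star E.S) ?V"
          by (rule openin_continuous_map_preimage[OF continuous_map_weak_star_eval[OF x]]) auto
        moreover have "f' \<in> ?V" using ne f' Ld by auto
        ultimately have "infinite {n \<in> N. h n \<in> ?V}" by (rule cl)
        moreover have "{n \<in> N. h n \<in> ?V} = {}" using hz by auto
        ultimately show False by (metis finite.emptyI)
      qed
      \<comment> \<open>The vectors \<open>u n\<close> for \<open>n\<close> in \<open>?N1\<close>
        are placed side by side; since \<open>p = \<infinity>\<close>, the result has norm at most
        one. On it \<open>h n\<close> is \<open>c\<close> along \<open>?N1\<close> and
        \<open>0\<close> along \<open>?N2\<close>, and the cluster points inherit these constant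
        values.\<close>
      define x where "x = (\<lambda>l\<in>\<Lambda>. if l \<in> \<nu> ` ?N1 then u (inv_into UNIV \<nu> l) else \<zero>\<^bsub>E l\<^esub>)"
      have xn: "x (\<nu> n) = (if n \<in> ?N1 then u n else \<zero>\<^bsub>E (\<nu> n)\<^esub>)" for n
        using \<nu>m inj by (auto simp: x_def inv_f_f inj_image_mem_iff)
      have xl: "x l \<in> carrier (E l) \<and> nrm (E l) (x l) \<le> 1" if "l \<in> \<Lambda>" for l
      proof (cases "l \<in> range \<nu>")
        case True
        then obtain n where "l = \<nu> n" by blast
        then show ?thesis using xn[of n] u[of n] \<nu>m[of n] by (auto simp: unit_ball_def)
      next
        case False
        then show ?thesis using that by (auto simp: x_def)
      qed
      then have xS: "x \<in> carrier E.S"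
        unfolding E.carrier_inf[OF p] by (auto simp: x_def intro!: bdd_aboveI2[of _ _ 1])
      have x1: "x \<in> unit_ball E.S"
        using xS xl by (simp add: unit_ball_def E.nrm_inf[OF p] cSUP_least[OF E.ne])
      have "f1 x = of_real c"
        by (rule eval[OF xS f1(1) _ f1(2)]) (simp add: h_eval[OF xS] xn gu)
      moreover have "f2 x = 0"
      proof (rule eval[OF xS f2(1) _ f2(2)])
        fix n assume "n \<in> ?N2"
        then have "x (\<nu> n) = \<zero>\<^bsub>E (\<nu> n)\<^esub>" using disj xn by auto
        moreover have "g n \<in> carrier (dual (F (\<nu> n)))" using g[of n] by (simp add: unit_ball_def)
        ultimately show "h n x = 0"
          using normed_space.dual_zero[OF F.normed[OF \<nu>m]] operator.T_zero[OF operator[OF \<nu>m]]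
          by (simp add: h_eval[OF xS])
      qed
      ultimately have "c / 2 < norm (f1 x - f2 x)" using c by simp
      moreover have "f1 \<in> V" "f2 \<in> V"
        using in_C[OF f1(1) _ f1(2)] in_C[OF f2(1) _ f2(2)] U(5) by blast+
      ultimately show "\<exists>g\<in>L \<inter> V. \<exists>h\<in>L \<inter> V. \<exists>x\<in>unit_ball E.S. c / 2 < norm (g x - h x)"
        using f1(1) f2(1) x1 by blast
    qed
  qed
  moreover have "L \<noteq> {}" using cluster[of UNIV] by auto
  ultimately show ?thesis
    unfolding Szlenk_op_def using Szlenk_eq_UNIV[OF LK, of E.S "c / 2"] c by simp
qed

lemma Szlenk_UNIV_p_1:
  assumes p: "p = 1" and nc0: "(\<lambda>l. op_norm (E l) (F l) (T l)) \<notin> c0 \<Lambda>"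
  shows "Szlenk_op E.S F.S (sum_op \<Lambda> T) = UNIV"
proof -
  obtain c \<nu> u g where c: "(c::real) > 0" and inj: "inj (\<nu> :: nat \<Rightarrow> 'i)" and \<nu>: "range \<nu> \<subseteq> \<Lambda>"
    and u: "\<And>n. u n \<in> unit_ball (E (\<nu> n))" and g: "\<And>n. g n \<in> unit_ball (dual (F (\<nu> n)))"
    and gu: "\<And>n. g n (T (\<nu> n) (u n)) = of_real c"
    by (rule norming_family[OF nc0], rule that)
  have \<nu>m: "\<nu> n \<in> \<Lambda>" for n using \<nu> by blast
  have gd: "g n \<in> carrier (dual (F (\<nu> n)))" for n using g[of n] by (simp add: unit_ball_def)
  let ?N = "\<lambda>y n. nrm (F (\<nu> n)) (y (\<nu> n))"
  have N: "?N y summable_on UNIV" "infsum (?N y) UNIV \<le> nrm F.S y" if y: "y \<in> carrier F.S" for y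
  proof -
    let ?f = "\<lambda>l. nrm (F l) (y l)"
    have f: "?f summable_on \<Lambda>" "?f summable_on range \<nu>"
      using y F.carrier_1[OF p] summable_on_subset_banach[OF _ \<nu>] by auto
    have e: "?N y = ?f \<circ> \<nu>" by auto
    show "?N y summable_on UNIV" using f(2) summable_on_reindex[OF inj, of ?f] unfolding e by simp
    have "infsum ?f (range \<nu>) \<le> infsum ?f \<Lambda>"
      by (rule infsum_mono_neutral[OF f(2,1)]) (use \<nu> F.nrm_ge_0[OF _ F.carrier_mem[OF y]] in auto)
    then show "infsum (?N y) UNIV \<le> nrm F.S y"
      using infsum_reindex[OF inj, of ?f] F.nrm_1[OF p y] unfolding e by simp
  qed
  have le: "norm (g n (y (\<nu> n))) \<le> ?N y n" if "y \<in> carrier F.S" for y n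
    by (rule normed_space.dual_ball_bound[OF F.normed[OF \<nu>m] g F.carrier_mem[OF that \<nu>m]])
  have abs: "(\<lambda>n. norm (g n (y (\<nu> n)))) summable_on A" if y: "y \<in> carrier F.S" for y A
    by (rule Infinite_Sum.abs_summable_on_comparison_test'[OF summable_on_subset_banach[OF N(1)[OF y]]]) (use le[OF y] in auto)
  have summ: "(\<lambda>n. g n (y (\<nu> n))) summable_on A" if y: "y \<in> carrier F.S" for y A
    by (rule abs_summable_summable[OF abs[OF y]])
  \<comment> \<open>Any partial sum of the \<open>g n\<close> is again in the dual ball: for
    \<open>p = 1\<close> the bounds by coordinate norms add up to at most the norm.\<close>
  define G where "G A = (\<lambda>y\<in>carrier F.S. \<Sum>\<^sub>\<infinity>n\<in>A. g n (y (\<nu> n)))" for A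
  have G_ball: "G A \<in> unit_ball (dual F.S)" for A
  proof (rule F.S.dual_ballI)
    fix y assume y: "y \<in> carrier F.S"
    have "norm (infsum (\<lambda>n. g n (y (\<nu> n))) A) \<le> infsum (\<lambda>n. norm (g n (y (\<nu> n)))) A"
      by (rule norm_infsum_bound[OF abs[OF y]])
    also have "\<dots> \<le> infsum (?N y) UNIV"
      by (rule infsum_mono_neutral[OF abs[OF y] N(1)[OF y]])
         (use le[OF y] F.nrm_ge_0[OF \<nu>m F.carrier_mem[OF y \<nu>m]] in auto)
    finally show "norm (G A y) \<le> nrm F.S y" using y N(2)[OF y] by (simp add: G_def)
    fix z assume z: "z \<in> carrier F.S"
    have "(\<Sum>\<^sub>\<infinity>n\<in>A. g n ((y \<oplus>\<^bsub>F.S\<^esub> z) (\<nu> n))) = (\<Sum>\<^sub>\<infinity>n\<in>A. g n (y (\<nu> n)) + g n (z (\<nu> n)))"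
      by (rule infsum_cong)
         (use normed_space.dual_add[OF F.normed[OF \<nu>m] gd F.carrier_mem[OF y \<nu>m] F.carrier_mem[OF z \<nu>m]] \<nu>m in simp)
    also have "\<dots> = (\<Sum>\<^sub>\<infinity>n\<in>A. g n (y (\<nu> n))) + (\<Sum>\<^sub>\<infinity>n\<in>A. g n (z (\<nu> n)))"
      by (rule infsum_add[OF summ[OF y] summ[OF z]])
    finally show "G A (y \<oplus>\<^bsub>F.S\<^esub> z) = G A y + G A z"
      using y z F.S.M.a_closed[OF y z] by (simp add: G_def del: F.lp_simps)
  next
    fix a y assume y: "y \<in> carrier F.S"
    have "(\<Sum>\<^sub>\<infinity>n\<in>A. g n ((a \<odot>\<^bsub>F.S\<^esub> y) (\<nu> n))) = (\<Sum>\<^sub>\<infinity>n\<in>A. a * g n (y (\<nu> n)))"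
      by (rule infsum_cong)
         (use normed_space.dual_smult[OF F.normed[OF \<nu>m] gd F.carrier_mem[OF y \<nu>m]] \<nu>m in simp)
    also have "\<dots> = a * (\<Sum>\<^sub>\<infinity>n\<in>A. g n (y (\<nu> n)))"
      by (rule infsum_cmult_right) (rule summ[OF y])
    finally show "G A (a \<odot>\<^bsub>F.S\<^esub> y) = a * G A y"
      using y F.S.smult_closed'[OF y] by (simp add: G_def del: F.lp_simps)
  qed (simp add: G_def)
  have G_insert: "G (insert n A) y = g n (y (\<nu> n)) + G (A - {n}) y" if y: "y \<in> carrier F.S" for n A y
    using infsum_insert[OF summ[OF y, of "A - {n}"], of n] y by (simp add: G_def)
  define h where "h A = adjoint E.S (sum_op \<Lambda> T) (G A)" for A
  define L where "L = range h"
  have LK: "L \<subseteq> SO.K" unfolding L_def h_def using G_ball by blast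
  then have Ld: "L \<subseteq> carrier (dual E.S)" using SO.K_subset by blast
  have h_eval: "h A x = G A (sum_op \<Lambda> T x)" if "x \<in> carrier E.S" for A x
    using that by (simp add: h_def adjoint_def)
  have "L \<subseteq> szlenk_deriv E.S (c / 2) L"
  proof
    fix f assume "f \<in> L"
    then obtain A where A: "f = h A" by (auto simp: L_def)
    \<comment> \<open>The index \<open>n\<close> is switched in or out of \<open>A\<close>, which
      changes the functional by the summand of \<open>g n\<close>, up to sign.\<close>
    define B where "B n = (if n \<in> A then A - {n} else insert n A)" for n
    have diff: "norm (h (B n) x - h A x) = norm (g n (T (\<nu> n) (x (\<nu> n))))" if x: "x \<in> carrier E.S" for n x
    proof -
      have "norm (G (B n) y - G A y) = norm (g n (y (\<nu> n)))" if y: "y \<in> carrier F.S" for y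
        using G_insert[OF y, of n A] by (cases "n \<in> A") (simp_all add: B_def insert_absorb norm_minus_commute)
      then show ?thesis using SO.T_mem[OF x] x \<nu>m by (simp add: h_eval sum_op_def)
    qed
    \<comment> \<open>Switching a far index is a small weak* change, as the coordinate norms of
      \<open>sum_op \<Lambda> T x\<close> along the \<open>\<nu> n\<close> are summable and thus
      tend to zero.\<close>
    have "limitin (weak_star E.S) (\<lambda>n. h (B n)) (h A) sequentially"
    proof (rule limitin_weak_star)
      fix x assume x: "x \<in> carrier E.S"
      note Tx = SO.T_mem[OF x]
      have "summable (?N (sum_op \<Lambda> T x))" by (rule summable_on_imp_summable[OF N(1)[OF Tx]])
      then have "?N (sum_op \<Lambda> T x) \<longlonglongrightarrow> 0" by (rule summable_LIMSEQ_zero)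
      moreover have "norm (h (B n) x - h A x) \<le> ?N (sum_op \<Lambda> T x) n" for n
        using le[OF Tx, of n] diff[OF x, of n] \<nu>m by (simp add: sum_op_def)
      then have "\<forall>\<^sub>F n in sequentially. norm (h (B n) x - h A x) \<le> ?N (sum_op \<Lambda> T x) n"
        by (rule always_eventually[OF allI])
      ultimately have "(\<lambda>n. h (B n) x - h A x) \<longlonglongrightarrow> 0"
        by (rule Lim_null_comparison[rotated])
      then show "(\<lambda>n. h (B n) x) \<longlonglongrightarrow> h A x" by (simp add: LIM_zero_iff)
    qed (use Ld in \<open>auto simp: L_def\<close>)
    then have lim: "\<forall>\<^sub>F n in sequentially. h (B n) \<in> V" if "openin (weak_star E.S) V" "h A \<in> V" for V
      using that by (auto simp: limitin_def)
    show "f \<in> szlenk_deriv E.S (c / 2) L"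
      unfolding E.S.szlenk_deriv_iff[OF Ld]
    proof (intro conjI allI impI \<open>f \<in> L\<close>)
      fix V assume V: "openin (weak_star E.S) V" "f \<in> V"
      have "\<exists>n. h (B n) \<in> V"
        using eventually_happens[OF lim[OF V(1)]] V(2) unfolding A by simp
      then obtain n where n: "h (B n) \<in> V" by (rule exE)
      have un: "u n \<in> carrier (E (\<nu> n))" "nrm (E (\<nu> n)) (u n) \<le> 1" using u[of n] by (auto simp: unit_ball_def)
      let ?x = "E.single (\<nu> n) (u n)"
      have x: "?x \<in> carrier E.S" "?x \<in> unit_ball E.S"
        using E.single_mem[OF \<nu>m un(1)] un(2) by (auto simp: unit_ball_def)
      have "norm (h (B n) ?x - h A ?x) = c" using diff[OF x(1), of n] gu[of n] c \<nu>m by simp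
      then have "c / 2 < norm (h (B n) ?x - h A ?x)" using c by simp
      moreover have "h (B n) \<in> L \<inter> V" "h A \<in> L \<inter> V" using n V(2) A by (auto simp: L_def)
      ultimately show "\<exists>g\<in>L \<inter> V. \<exists>h\<in>L \<inter> V. \<exists>x\<in>unit_ball E.S. c / 2 < norm (g x - h x)"
        using x(2) by blast
    qed
  qed
  moreover have "L \<noteq> {}" by (simp add: L_def)
  ultimately show ?thesis
    unfolding Szlenk_op_def using Szlenk_eq_UNIV[OF LK, of E.S "c / 2"] c by simp
qed

end

section \<open>Densities of dominated set functions\<close>

text \<open>Domination by the measure makes the additive \<nu> continuous at the empty set, hence
  countably additive, and absolutely continuous; the Radon-Nikodym theorem gives the
  density.\<close>

lemma (in finite_measure) dominated_nonneg_density: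
  assumes add: "\<And>A B. A \<in> sets M \<Longrightarrow> B \<in> sets M \<Longrightarrow> A \<inter> B = {} \<Longrightarrow> \<nu> (A \<union> B) = \<nu> A + \<nu> B"
    and nonneg: "\<And>A. A \<in> sets M \<Longrightarrow> 0 \<le> \<nu> A"
    and dom: "\<And>A. A \<in> sets M \<Longrightarrow> \<nu> A \<le> C * measure M A"
  shows "\<exists>f. integrable M f \<and> (\<forall>A\<in>sets M. (LINT x:A|M. f x) = (\<nu> A :: real))"
proof -
  let ?N = "\<lambda>A. ennreal (\<nu> A)"
  have \<nu>0: "\<nu> {} = 0" using add[of "{}" "{}"] by simp
  have pos: "positive (sets M) ?N" by (simp add: positive_def \<nu>0)
  have ca: "countably_additive (sets M) ?N"
  proof (rule sets.empty_continuous_imp_countably_additive[OF pos])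
    show "additive (sets M) ?N"
      by (auto simp: additive_def add nonneg ennreal_plus)
    fix A :: "nat \<Rightarrow> 'a set" assume A: "range A \<subseteq> sets M" "decseq A" "(\<Inter>i. A i) = {}"
    have "(\<lambda>i. measure M (A i)) \<longlonglongrightarrow> measure M (\<Inter>i. A i)"
      by (rule finite_Lim_measure_decseq[OF A(1,2)])
    then have "(\<lambda>i. C * measure M (A i)) \<longlonglongrightarrow> 0"
      using tendsto_mult_right_zero A(3) by auto
    then have "(\<lambda>i. \<nu> (A i)) \<longlonglongrightarrow> 0"
      by (rule tendsto_sandwich[rotated 3, where f = "\<lambda>_. 0"])
         (use A(1) nonneg dom in \<open>auto intro!: always_eventually\<close>)
    then show "(\<lambda>i. ?N (A i)) \<longlonglongrightarrow> 0"
      using tendsto_ennrealI[of "\<lambda>i. \<nu> (A i)" 0] by simp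
  qed simp
  define N where "N = measure_of (space M) (sets M) ?N"
  have sN: "sets N = sets M" "space N = space M"
    unfolding N_def by (simp_all add: sets.sets_measure_of_eq sets.space_measure_of_eq)
  have eN: "emeasure N A = ?N A" if "A \<in> sets M" for A
    unfolding N_def by (rule emeasure_measure_of_sigma[OF sets.sigma_algebra_axioms pos ca that])
  have "absolutely_continuous M N"
    unfolding absolutely_continuous_def
  proof
    fix A assume A: "A \<in> null_sets M"
    then have "A \<in> sets M" "measure M A = 0" by (auto simp: measure_def null_sets_def)
    then have "\<nu> A = 0" using nonneg[of A] dom[of A] by simp
    then show "A \<in> null_sets N" using A eN[of A] sN by (simp add: null_sets_def)
  qed
  then obtain f where f: "f \<in> borel_measurable M" "density M f = N"
    using Radon_Nikodym sN(1) by blast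
  have f_int: "(\<integral>\<^sup>+x. f x * indicator A x \<partial>M) = ennreal (\<nu> A)" if "A \<in> sets M" for A
    using emeasure_density[OF f(1) that] f(2) eN[OF that] by simp
  have "(\<integral>\<^sup>+x. f x \<partial>M) = (\<integral>\<^sup>+x. f x * indicator (space M) x \<partial>M)"
    by (rule nn_integral_cong) simp
  then have "(\<integral>\<^sup>+x. f x \<partial>M) \<noteq> \<infinity>" using f_int[of "space M"] by simp
  then have fin: "AE x in M. f x \<noteq> \<infinity>" using nn_integral_PInf_AE[OF f(1)] by simp
  let ?f = "\<lambda>x. enn2real (f x)"
  have meas: "?f \<in> borel_measurable M" using f(1) by simp
  have nn: "(\<integral>\<^sup>+x. ennreal (indicator A x *\<^sub>R ?f x) \<partial>M) = ennreal (\<nu> A)" if A: "A \<in> sets M" for A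
  proof -
    have "(\<integral>\<^sup>+x. ennreal (indicator A x *\<^sub>R ?f x) \<partial>M) = (\<integral>\<^sup>+x. f x * indicator A x \<partial>M)"
      by (rule nn_integral_cong_AE) (use fin in \<open>auto split: split_indicator simp: less_top\<close>)
    then show ?thesis using f_int[OF A] by simp
  qed
  have "integrable M ?f"
  proof (rule integrableI_nonneg)
    have "(\<integral>\<^sup>+x. ennreal (?f x) \<partial>M) = (\<integral>\<^sup>+x. ennreal (indicator (space M) x *\<^sub>R ?f x) \<partial>M)"
      by (rule nn_integral_cong) simp
    then show "(\<integral>\<^sup>+x. ennreal (?f x) \<partial>M) < \<infinity>" using nn[of "space M"] by simp
  qed (use meas in auto)
  moreover have "(LINT x:A|M. ?f x) = \<nu> A" if A: "A \<in> sets M" for A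
    unfolding set_lebesgue_integral_def
    by (subst integral_eq_nn_integral) (use meas A nn[OF A] nonneg[OF A] in auto)
  ultimately show ?thesis by blast
qed

text \<open>Coordinatewise reduction to the nonnegative case: adding \<open>C * measure M A\<close>
  makes a coordinate nonnegative and at most twice the bound, and subtracting the constant
  \<open>C\<close> from the density undoes it.\<close>

lemma (in finite_measure) dominated_density:
  fixes \<nu> :: "'a set \<Rightarrow> 'k::euclidean_space"
  assumes add: "\<And>A B. A \<in> sets M \<Longrightarrow> B \<in> sets M \<Longrightarrow> A \<inter> B = {} \<Longrightarrow> \<nu> (A \<union> B) = \<nu> A + \<nu> B"
    and dom: "\<And>A. A \<in> sets M \<Longrightarrow> norm (\<nu> A) \<le> C * measure M A"
  shows "\<exists>f. integrable M f \<and> (\<forall>A\<in>sets M. (LINT x:A|M. f x) = \<nu> A)"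
proof -
  have "\<exists>f. integrable M f \<and> (\<forall>A\<in>sets M. (LINT x:A|M. f x) = \<nu> A \<bullet> b)" if b: "b \<in> Basis" for b
  proof -
    have comp: "\<bar>\<nu> A \<bullet> b\<bar> \<le> C * measure M A" if "A \<in> sets M" for A
      using Basis_le_norm[OF b, of "\<nu> A"] dom[OF that] by linarith
    have "\<exists>f. integrable M f \<and> (\<forall>A\<in>sets M. (LINT x:A|M. f x) = \<nu> A \<bullet> b + C * measure M A)"
    proof (rule dominated_nonneg_density[where C = "2 * C"])
      fix A B assume AB: "A \<in> sets M" "B \<in> sets M" "A \<inter> B = {}"
      show "\<nu> (A \<union> B) \<bullet> b + C * measure M (A \<union> B) =
          (\<nu> A \<bullet> b + C * measure M A) + (\<nu> B \<bullet> b + C * measure M B)"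
        using add[OF AB] finite_measure_Union[OF AB] by (simp add: inner_add_left distrib_left)
    next
      fix A assume "A \<in> sets M"
      then show "0 \<le> \<nu> A \<bullet> b + C * measure M A" "\<nu> A \<bullet> b + C * measure M A \<le> 2 * C * measure M A"
        using comp[of A] by auto
    qed
    then obtain f where f: "integrable M f" "\<And>A. A \<in> sets M \<Longrightarrow> (LINT x:A|M. f x) = \<nu> A \<bullet> b + C * measure M A"
      by blast
    have "(LINT x:A|M. f x - C) = \<nu> A \<bullet> b" if A: "A \<in> sets M" for A
    proof -
      have "set_integrable M A f" "set_integrable M A (\<lambda>_. C)"
        unfolding set_integrable_def
        by (rule integrable_mult_indicator[OF A f(1)], rule integrable_mult_indicator[OF A integrable_const])
      then have "(LINT x:A|M. f x - C) = (LINT x:A|M. f x) - (LINT x:A|M. C)"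
        by (rule set_integral_diff)
      then show ?thesis using f(2)[OF A] A by (simp add: set_lebesgue_integral_def)
    qed
    moreover have "integrable M (\<lambda>x. f x - C)" using f(1) by simp
    ultimately show ?thesis by blast
  qed
  then obtain f where f: "\<And>b. b \<in> Basis \<Longrightarrow> integrable M (f b)"
      "\<And>b A. b \<in> Basis \<Longrightarrow> A \<in> sets M \<Longrightarrow> (LINT x:A|M. f b x) = \<nu> A \<bullet> b" by metis
  have "(LINT x:A|M. (\<Sum>b\<in>Basis. f b x *\<^sub>R b)) = \<nu> A" if A: "A \<in> sets M" for A
  proof -
    have i: "integrable M (\<lambda>x. indicator A x *\<^sub>R f b x)" if "b \<in> Basis" for b
      using f(1)[OF that] A by (rule integrable_mult_indicator[rotated])
    have "(LINT x:A|M. (\<Sum>b\<in>Basis. f b x *\<^sub>R b)) = (LINT x|M. (\<Sum>b\<in>Basis. (indicator A x *\<^sub>R f b x) *\<^sub>R b))"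
      unfolding set_lebesgue_integral_def by (simp add: scaleR_sum_right)
    also have "\<dots> = (\<Sum>b\<in>Basis. (LINT x|M. (indicator A x *\<^sub>R f b x) *\<^sub>R b))"
      by (rule Bochner_Integration.integral_sum) (use i in \<open>auto intro!: integrable_scaleR_left\<close>)
    also have "\<dots> = (\<Sum>b\<in>Basis. (\<nu> A \<bullet> b) *\<^sub>R b)"
      by (rule sum.cong) (use i f(2)[OF _ A] in \<open>auto simp: set_lebesgue_integral_def\<close>)
    finally show ?thesis by (simp add: euclidean_representation)
  qed
  moreover have "integrable M (\<lambda>x. \<Sum>b\<in>Basis. f b x *\<^sub>R b)"
    using f(1) by (intro Bochner_Integration.integrable_sum integrable_scaleR_left)
  ultimately show ?thesis by blast
qed

text \<open>If \<open>g - z\<close> exceeded \<delta> in a direction \<open>b\<close> on a subset of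
  \<open>J\<close> of positive measure, its integral over that subset would be too large. Applied to
  basis vectors and their negatives this bounds all coordinates, and the norm is at most the sum of
  their absolute values, whence the factor \<open>DIM('k)\<close>.\<close>

lemma (in finite_measure) AE_near_if_averages_near:
  fixes g :: "'a \<Rightarrow> 'k::euclidean_space" and \<delta> :: real
  assumes g: "integrable M g" and J: "J \<in> sets M"
    and near: "\<And>A. A \<in> sets M \<Longrightarrow> A \<subseteq> J \<Longrightarrow> norm ((LINT x:A|M. g x) - measure M A *\<^sub>R z) \<le> \<delta> * measure M A"
  shows "AE x in M. x \<in> J \<longrightarrow> norm (g x - z) \<le> DIM('k) * \<delta>"
proof -
  have one: "AE x in M. x \<in> J \<longrightarrow> (g x - z) \<bullet> b \<le> \<delta>" if b: "norm b = 1" for b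
  proof -
    let ?A = "{x \<in> space M. x \<in> J \<and> \<delta> < (g x - z) \<bullet> b}"
    have [measurable]: "g \<in> borel_measurable M" using g by simp
    have [measurable]: "J \<in> sets M" by fact
    have A: "?A \<in> sets M" by measurable
    let ?h = "\<lambda>x. indicator ?A x *\<^sub>R ((g x - z) \<bullet> b - \<delta>)"
    have gA: "integrable M (\<lambda>x. indicator ?A x *\<^sub>R g x)" by (rule integrable_mult_indicator[OF A g])
    have iA: "integrable M (\<lambda>x. indicator ?A x :: real)" using A by (simp add: integrable_indicator_iff less_top[symmetric])
    have e: "?h = (\<lambda>x. (indicator ?A x *\<^sub>R g x) \<bullet> b - indicator ?A x * (z \<bullet> b + \<delta>))"
      by (auto simp: fun_eq_iff inner_diff_left split: split_indicator)
    have i1: "integrable M (\<lambda>x. (indicator ?A x *\<^sub>R g x) \<bullet> b)" by (rule integrable_inner_left[OF gA])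
    have i2: "integrable M (\<lambda>x. indicator ?A x * (z \<bullet> b + \<delta>))" by (rule integrable_mult_left[OF iA])
    have hi: "integrable M ?h"
      unfolding e by (rule Bochner_Integration.integrable_diff[OF i1 i2])
    have "(LINT x|M. (indicator ?A x *\<^sub>R g x) \<bullet> b) = (LINT x:?A|M. g x) \<bullet> b"
      unfolding set_lebesgue_integral_def by (rule integral_inner_left[OF gA])
    moreover have "(LINT x|M. indicator ?A x * (z \<bullet> b + \<delta>)) = measure M ?A * (z \<bullet> b + \<delta>)"
      using A by (simp add: Int_absorb2 sets.sets_into_space)
    ultimately have "integral\<^sup>L M ?h = (LINT x:?A|M. g x) \<bullet> b - measure M ?A * (z \<bullet> b + \<delta>)"
      unfolding e by (simp only: Bochner_Integration.integral_diff[OF i1 i2])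
    also have "\<dots> = ((LINT x:?A|M. g x) - measure M ?A *\<^sub>R z) \<bullet> b - \<delta> * measure M ?A"
      by (simp add: inner_diff_left algebra_simps)
    also have "\<dots> \<le> 0"
      using Cauchy_Schwarz_ineq2[of "(LINT x:?A|M. g x) - measure M ?A *\<^sub>R z" b] near[OF A] b by force
    finally have "integral\<^sup>L M ?h \<le> 0" .
    have nn: "0 \<le> ?h x" for x by (auto split: split_indicator)
    have "0 \<le> integral\<^sup>L M ?h" by (rule Bochner_Integration.integral_nonneg) (rule nn)
    with \<open>integral\<^sup>L M ?h \<le> 0\<close> have "integral\<^sup>L M ?h = 0" by (rule antisym)
    then have "AE x in M. ?h x = 0" using integral_nonneg_eq_0_iff_AE[OF hi] nn by simp
    then show ?thesis
      using AE_space by eventually_elim (auto simp: not_le[symmetric] split: split_indicator_asm)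
  qed
  have "AE x in M. \<forall>b\<in>Basis. x \<in> J \<longrightarrow> \<bar>(g x - z) \<bullet> b\<bar> \<le> \<delta>"
  proof (subst AE_ball_countable, simp add: countable_finite, intro ballI)
    fix b :: 'k assume b: "b \<in> Basis"
    show "AE x in M. x \<in> J \<longrightarrow> \<bar>(g x - z) \<bullet> b\<bar> \<le> \<delta>"
    proof -
      have "norm b = 1" "norm (- b) = 1" using b by auto
      from one[OF this(1)] one[OF this(2)] show ?thesis by eventually_elim (auto simp: abs_le_iff)
    qed
  qed
  then show ?thesis
  proof eventually_elim
    case (elim x)
    show ?case
    proof
      assume x: "x \<in> J"
      have "norm (g x - z) \<le> (\<Sum>b\<in>Basis. \<bar>(g x - z) \<bullet> b\<bar>)" by (rule norm_le_l1)
      also have "\<dots> \<le> (\<Sum>b\<in>(Basis::'k set). \<delta>)" by (rule sum_mono) (use elim x in auto)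
      finally show "norm (g x - z) \<le> DIM('k) * \<delta>" by simp
    qed
  qed
qed


section \<open>The space of essentially bounded functions\<close>

lemma Linfty_simps [simp]:
  "zero (Linfty M) = Linfty_class M (\<lambda>_. 0)"
  "add (Linfty M) = (\<lambda>u v. Linfty_class M (\<lambda>x. rep u x + rep v x))"
  "smult (Linfty M) = (\<lambda>c u. Linfty_class M (\<lambda>x. c * rep u x))"
  "nrm (Linfty M) = (\<lambda>u. Inf {c. 0 \<le> c \<and> (AE x in M. norm (rep u x) \<le> c)})"
  by (simp_all add: Linfty_def)

lemma Linfty_class_cong: "AE x in M. f x = g x \<Longrightarrow> Linfty_class M f = Linfty_class M g"
proof -
  assume e: "AE x in M. f x = g x"
  have "(AE x in M. k x = f x) \<longleftrightarrow> (AE x in M. k x = g x)" for k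
  proof
    assume "AE x in M. k x = f x"
    then show "AE x in M. k x = g x" using e by eventually_elim simp
  next
    assume "AE x in M. k x = g x"
    then show "AE x in M. k x = f x" using e by eventually_elim simp
  qed
  then show ?thesis by (simp add: Linfty_class_def)
qed

lemma rep_class:
  assumes "f \<in> borel_measurable M"
  shows "rep (Linfty_class M f) \<in> borel_measurable M" "AE x in M. rep (Linfty_class M f) x = f x"
proof -
  have "rep (Linfty_class M f) \<in> Linfty_class M f"
    unfolding rep_def by (rule someI[of _ f]) (simp add: Linfty_class_def assms)
  then show "rep (Linfty_class M f) \<in> borel_measurable M" "AE x in M. rep (Linfty_class M f) x = f x"
    by (auto simp: Linfty_class_def)
qed

lemma carrier_LinftyI: "f \<in> borel_measurable M \<Longrightarrow> AE x in M. norm (f x) \<le> c \<Longrightarrow> Linfty_class M f \<in> carrier (Linfty M)"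
  by (auto simp: Linfty_def)

lemma carrier_LinftyD:
  assumes "u \<in> carrier (Linfty M)"
  shows "rep u \<in> borel_measurable M" "Linfty_class M (rep u) = u" "\<exists>c. AE x in M. norm (rep u x) \<le> c"
proof -
  obtain f c where f: "f \<in> borel_measurable M" "u = Linfty_class M f" "AE x in M. norm (f x) \<le> c"
    using assms by (auto simp: Linfty_def)
  show "rep u \<in> borel_measurable M" using f rep_class by blast
  have e: "AE x in M. rep u x = f x" using f rep_class by blast
  show "Linfty_class M (rep u) = u" using Linfty_class_cong[OF e] f(2) by simp
  have "AE x in M. norm (rep u x) \<le> c" using e f(3) by eventually_elim simp
  then show "\<exists>c. AE x in M. norm (rep u x) \<le> c" by blast
qed

lemma Linfty_add_class:
  assumes "f \<in> borel_measurable M" "g \<in> borel_measurable M"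
  shows "Linfty_class M f \<oplus>\<^bsub>Linfty M\<^esub> Linfty_class M g = Linfty_class M (\<lambda>x. f x + g x)"
  unfolding Linfty_simps
  by (rule Linfty_class_cong) (use rep_class(2)[OF assms(1)] rep_class(2)[OF assms(2)] in eventually_elim, simp)

lemma Linfty_smult_class:
  assumes "f \<in> borel_measurable M"
  shows "c \<odot>\<^bsub>Linfty M\<^esub> Linfty_class M f = Linfty_class M (\<lambda>x. c * f x)"
  unfolding Linfty_simps
  by (rule Linfty_class_cong) (use rep_class(2)[OF assms] in eventually_elim, simp)

lemma Linfty_cases:
  assumes "u \<in> carrier (Linfty M)"
  obtains f c where "u = Linfty_class M f" "f \<in> borel_measurable M" "AE x in M. norm (f x) \<le> c"
  using assms by (auto simp: Linfty_def)

lemma Linfty_add_closed: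
  assumes "u \<in> carrier (Linfty M)" "v \<in> carrier (Linfty M)"
  shows "u \<oplus>\<^bsub>Linfty M\<^esub> v \<in> carrier (Linfty M)"
proof -
  obtain c d where c: "AE x in M. norm (rep u x) \<le> c" and d: "AE x in M. norm (rep v x) \<le> d"
    using carrier_LinftyD(3) assms by metis
  have "AE x in M. norm (rep u x + rep v x) \<le> c + d"
    using c d by eventually_elim (rule norm_triangle_mono)
  then show ?thesis
    using carrier_LinftyD(1)[OF assms(1)] carrier_LinftyD(1)[OF assms(2)]
    by (auto intro!: carrier_LinftyI)
qed

lemma Linfty_uminus_closed:
  assumes "u \<in> carrier (Linfty M)"
  shows "Linfty_class M (\<lambda>x. - rep u x) \<in> carrier (Linfty M)"
proof -
  obtain c where c: "AE x in M. norm (rep u x) \<le> c" using carrier_LinftyD(3) assms by metis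
  show ?thesis by (rule carrier_LinftyI[where c = c]) (use carrier_LinftyD(1)[OF assms] c in auto)
qed

lemma abelian_group_Linfty: "abelian_group (Linfty M :: ('k::real_or_complex, ('w \<Rightarrow> 'k) set) nspace)"
proof (rule abelian_groupI)
  let ?L = "Linfty M :: ('k, ('w \<Rightarrow> 'k) set) nspace"
  fix u v w assume u: "u \<in> carrier ?L" and v: "v \<in> carrier ?L" and w: "w \<in> carrier ?L"
  show "u \<oplus>\<^bsub>?L\<^esub> v \<in> carrier ?L" by (rule Linfty_add_closed[OF u v])
  obtain f c where f: "u = Linfty_class M f" "f \<in> borel_measurable M" using u by (rule Linfty_cases)
  obtain g c where g: "v = Linfty_class M g" "g \<in> borel_measurable M" using v by (rule Linfty_cases)
  obtain h c where h: "w = Linfty_class M h" "h \<in> borel_measurable M" using w by (rule Linfty_cases)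
  have fg: "(\<lambda>x. f x + g x) \<in> borel_measurable M" "(\<lambda>x. g x + h x) \<in> borel_measurable M"
    using f(2) g(2) h(2) by auto
  show "u \<oplus>\<^bsub>?L\<^esub> v \<oplus>\<^bsub>?L\<^esub> w = u \<oplus>\<^bsub>?L\<^esub> (v \<oplus>\<^bsub>?L\<^esub> w)"
    unfolding f(1) g(1) h(1)
    by (simp add: Linfty_add_class f(2) g(2) h(2) fg add.assoc del: Linfty_simps)
  show "u \<oplus>\<^bsub>?L\<^esub> v = v \<oplus>\<^bsub>?L\<^esub> u" by (simp add: add.commute)
next
  let ?L = "Linfty M :: ('k, ('w \<Rightarrow> 'k) set) nspace"
  fix u assume u: "u \<in> carrier ?L"
  obtain f c where f: "u = Linfty_class M f" "f \<in> borel_measurable M" using u by (rule Linfty_cases)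
  show "\<zero>\<^bsub>?L\<^esub> \<oplus>\<^bsub>?L\<^esub> u = u"
    unfolding f(1) Linfty_simps(1) by (simp add: Linfty_add_class f(2) del: Linfty_simps)
  have m: "rep u \<in> borel_measurable M" by (rule carrier_LinftyD(1)[OF u])
  have "Linfty_class M (\<lambda>x. - rep u x) \<oplus>\<^bsub>?L\<^esub> Linfty_class M (rep u) = \<zero>\<^bsub>?L\<^esub>"
    using m by (subst Linfty_add_class) auto
  then show "\<exists>v\<in>carrier ?L. v \<oplus>\<^bsub>?L\<^esub> u = \<zero>\<^bsub>?L\<^esub>"
    using carrier_LinftyD(2)[OF u] Linfty_uminus_closed[OF u] by (metis (no_types))
next
  show "\<zero>\<^bsub>Linfty M\<^esub> \<in> carrier (Linfty M :: ('k, ('w \<Rightarrow> 'k) set) nspace)"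
    unfolding Linfty_simps by (rule carrier_LinftyI[where c = 0]) auto
qed

lemma Linfty_minus:
  fixes u v :: "('w \<Rightarrow> 'k::real_or_complex) set"
  assumes u: "u \<in> carrier (Linfty M)" and v: "v \<in> carrier (Linfty M)"
  shows "u \<ominus>\<^bsub>Linfty M\<^esub> v = Linfty_class M (\<lambda>x. rep u x - rep v x)"
proof -
  let ?L = "Linfty M :: ('k, ('w \<Rightarrow> 'k) set) nspace"
  interpret L: abelian_group ?L by (rule abelian_group_Linfty)
  have mu: "rep u \<in> borel_measurable M" and mv: "rep v \<in> borel_measurable M"
    using carrier_LinftyD(1) u v by auto
  have m: "Linfty_class M (\<lambda>x. - rep v x) \<in> carrier ?L" by (rule Linfty_uminus_closed[OF v])
  have "Linfty_class M (\<lambda>x. - rep v x) \<oplus>\<^bsub>?L\<^esub> Linfty_class M (rep v) = \<zero>\<^bsub>?L\<^esub>"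
    using mv by (subst Linfty_add_class) auto
  then have "\<ominus>\<^bsub>?L\<^esub> v = Linfty_class M (\<lambda>x. - rep v x)"
    using L.minus_equality[OF _ v m] carrier_LinftyD(2)[OF v] by simp
  then have "u \<ominus>\<^bsub>?L\<^esub> v = Linfty_class M (rep u) \<oplus>\<^bsub>?L\<^esub> Linfty_class M (\<lambda>x. - rep v x)"
    unfolding a_minus_def carrier_LinftyD(2)[OF u] by simp
  then show ?thesis using mu mv by (subst (asm) Linfty_add_class) auto
qed

lemma Linfty_nrm_le: "0 \<le> c \<Longrightarrow> AE x in M. norm (rep u x) \<le> c \<Longrightarrow> nrm (Linfty M) u \<le> c"
  unfolding Linfty_simps by (rule cInf_lower) (auto intro: bdd_belowI[of _ 0])

text \<open>The infimum is attained: each of the countably many bounds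
  \<open>nrm (Linfty M) u + 1 / Suc n\<close> holds almost everywhere, so almost everywhere they
  hold simultaneously.\<close>

lemma Linfty_nrm:
  assumes "u \<in> carrier (Linfty M)"
  shows "0 \<le> nrm (Linfty M) u" "AE x in M. norm (rep u x) \<le> nrm (Linfty M) u"
proof -
  let ?C = "{c. 0 \<le> c \<and> (AE x in M. norm (rep u x) \<le> c)}"
  obtain c where c: "AE x in M. norm (rep u x) \<le> c" using carrier_LinftyD(3)[OF assms] by blast
  have "AE x in M. norm (rep u x) \<le> max c 0" using c by eventually_elim simp
  then have "max c 0 \<in> ?C" by simp
  then have ne: "?C \<noteq> {}" by blast
  then show "0 \<le> nrm (Linfty M) u" unfolding Linfty_simps by (intro cInf_greatest) auto
  have "AE x in M. norm (rep u x) < nrm (Linfty M) u + 1 / Suc n" for n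
  proof -
    have "nrm (Linfty M) u < nrm (Linfty M) u + 1 / Suc n" by simp
    then obtain d where "d \<in> ?C" "d < nrm (Linfty M) u + 1 / Suc n"
      unfolding Linfty_simps using cInf_lessD[OF ne] by blast
    then have "AE x in M. norm (rep u x) \<le> d" by simp
    then show ?thesis by eventually_elim (use \<open>d < nrm (Linfty M) u + 1 / Suc n\<close> in linarith)
  qed
  then have "AE x in M. \<forall>n. norm (rep u x) < nrm (Linfty M) u + 1 / Suc n" by (simp add: AE_all_countable)
  then show "AE x in M. norm (rep u x) \<le> nrm (Linfty M) u"
  proof eventually_elim
    case (elim x)
    have "norm (rep u x) \<le> nrm (Linfty M) u + e" if e: "e > 0" for e
    proof -
      obtain n where "1 / Suc n < e" using nat_approx_posE[OF e] by blast
      then show ?thesis using elim[rule_format, of n] by linarith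
    qed
    then show ?case by (rule field_le_epsilon)
  qed
qed

lemma ndist_Linfty_le:
  assumes "u \<in> carrier (Linfty M)" "v \<in> carrier (Linfty M)" "0 \<le> c" "AE x in M. norm (rep u x - rep v x) \<le> c"
  shows "ndist (Linfty M) u v \<le> c"
proof -
  have m: "(\<lambda>x. rep u x - rep v x) \<in> borel_measurable M"
    using carrier_LinftyD(1) assms by (intro borel_measurable_diff) auto
  have "AE x in M. norm (rep (Linfty_class M (\<lambda>x. rep u x - rep v x)) x) \<le> c"
    using rep_class(2)[OF m] assms(4) by eventually_elim simp
  then have "nrm (Linfty M) (Linfty_class M (\<lambda>x. rep u x - rep v x)) \<le> c" by (rule Linfty_nrm_le[OF assms(3)])
  then show ?thesis using assms(1,2) by (simp add: ndist_def Linfty_minus del: Linfty_simps)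
qed

lemma ndist_Linfty:
  assumes u: "u \<in> carrier (Linfty M)" and v: "v \<in> carrier (Linfty M)"
  shows "0 \<le> ndist (Linfty M) u v" "AE x in M. norm (rep u x - rep v x) \<le> ndist (Linfty M) u v"
proof -
  let ?w = "Linfty_class M (\<lambda>x. rep u x - rep v x)"
  interpret L: abelian_group "Linfty M" by (rule abelian_group_Linfty)
  have m: "(\<lambda>x. rep u x - rep v x) \<in> borel_measurable M"
    using carrier_LinftyD(1) assms by (intro borel_measurable_diff) auto
  have w: "?w \<in> carrier (Linfty M)" using L.minus_closed[OF u v] Linfty_minus[OF u v] by simp
  have d: "ndist (Linfty M) u v = nrm (Linfty M) ?w"
    using u v by (simp add: ndist_def Linfty_minus del: Linfty_simps)
  show "0 \<le> ndist (Linfty M) u v" unfolding d by (rule Linfty_nrm(1)[OF w])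
  show "AE x in M. norm (rep u x - rep v x) \<le> ndist (Linfty M) u v"
    unfolding d using Linfty_nrm(2)[OF w] rep_class(2)[OF m] by eventually_elim simp
qed

lemma Metric_space_Linfty:
  "Metric_space (carrier (Linfty M)) (ndist (Linfty M :: ('k::real_or_complex, ('w \<Rightarrow> 'k) set) nspace))"
proof
  let ?L = "Linfty M :: ('k, ('w \<Rightarrow> 'k) set) nspace"
  have sym_le: "ndist ?L u v \<le> ndist ?L v u" if "u \<in> carrier ?L" "v \<in> carrier ?L" for u v
    by (rule ndist_Linfty_le[OF that]) (use ndist_Linfty[OF that(2,1)] in \<open>auto simp: norm_minus_commute\<close>)
  fix u v w
  show "0 \<le> ndist ?L u v"
  proof (cases "u \<in> carrier ?L \<and> v \<in> carrier ?L")
    case True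
    then show ?thesis using ndist_Linfty(1) by blast
  next
    case False
    then show ?thesis unfolding ndist_def by (simp only: if_False order_refl)
  qed
  show "ndist ?L u v = ndist ?L v u"
  proof (cases "u \<in> carrier ?L \<and> v \<in> carrier ?L")
    case True
    then show ?thesis using sym_le by (blast intro: antisym)
  next
    case False
    then show ?thesis by (auto simp: ndist_def simp del: Linfty_simps)
  qed
  assume u: "u \<in> carrier ?L" and v: "v \<in> carrier ?L"
  show "ndist ?L u v = 0 \<longleftrightarrow> u = v"
  proof
    assume "ndist ?L u v = 0"
    then have "AE x in M. rep u x = rep v x" using ndist_Linfty(2)[OF u v] by simp
    then show "u = v" using Linfty_class_cong carrier_LinftyD(2) u v by metis
  next
    assume "u = v"
    then have "ndist ?L u v \<le> 0" by (intro ndist_Linfty_le u v) auto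
    then show "ndist ?L u v = 0" using ndist_Linfty(1)[OF u v] by simp
  qed
  assume w: "w \<in> carrier ?L"
  show "ndist ?L u w \<le> ndist ?L u v + ndist ?L v w"
  proof (rule ndist_Linfty_le[OF u w])
    show "0 \<le> ndist ?L u v + ndist ?L v w" by (rule add_nonneg_nonneg[OF ndist_Linfty(1)[OF u v] ndist_Linfty(1)[OF v w]])
    show "AE x in M. norm (rep u x - rep w x) \<le> ndist ?L u v + ndist ?L v w"
      using ndist_Linfty(2)[OF u v] ndist_Linfty(2)[OF v w]
      by eventually_elim (metis diff_add_cancel norm_diff_triangle_le)
  qed
qed

text \<open>A compact closure is totally bounded; finite nets are the form in which relative
  compactness is used below.\<close>

lemma relatively_compact_Linfty_net:
  fixes G :: "('w \<Rightarrow> 'k::real_or_complex) set set"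
  assumes G: "relatively_compact (Linfty M) G" "G \<subseteq> carrier (Linfty M)" and d: "\<delta> > 0"
  shows "\<exists>N. finite N \<and> N \<subseteq> carrier (Linfty M) \<and> (\<forall>u\<in>G. \<exists>v\<in>N. AE x in M. norm (rep u x - rep v x) \<le> \<delta>)"
proof -
  let ?L = "Linfty M :: ('k, ('w \<Rightarrow> 'k) set) nspace"
  interpret Metric_space "carrier ?L" "ndist ?L" by (rule Metric_space_Linfty)
  have "mtotally_bounded (mtopology closure_of G)"
    using G(1) unfolding relatively_compact_def by (rule compactin_imp_mtotally_bounded)
  moreover have "G \<subseteq> mtopology closure_of G" using G(2) by (intro closure_of_subset) simp
  ultimately have "mtotally_bounded G" by (rule mtotally_bounded_subset)
  then obtain N where N: "finite N" "N \<subseteq> G" "G \<subseteq> (\<Union>v\<in>N. mball v \<delta>)"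
    using d unfolding mtotally_bounded_def by meson
  have "\<exists>v\<in>N. AE x in M. norm (rep u x - rep v x) \<le> \<delta>" if u: "u \<in> G" for u
  proof -
    obtain v where v: "v \<in> N" "u \<in> mball v \<delta>" using N(3) u by blast
    then have uv: "v \<in> carrier ?L" "u \<in> carrier ?L" "ndist ?L v u < \<delta>" by auto
    have "AE x in M. norm (rep u x - rep v x) \<le> \<delta>"
      using ndist_Linfty(2)[OF uv(1,2)] by eventually_elim (use uv(3) in \<open>simp add: norm_minus_commute\<close>)
    then show ?thesis using v(1) by blast
  qed
  then show ?thesis using N G(2) by (intro exI[of _ N]) auto
qed

section \<open>Dyadic trees\<close>

text \<open>Nodes are lists of bits, the most recent bit first.\<close>

locale dyadic_measure = finite_measure M for M :: "'w measure" +
  fixes I :: "bool list \<Rightarrow> 'w set"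
  assumes I_sets [measurable]: "I s \<in> sets M" and I_Nil: "I [] = space M"
    and I_split: "I (True # s) \<union> I (False # s) = I s"
    and I_disjoint: "I (True # s) \<inter> I (False # s) = {}"
    and I_measure: "measure M (I s) = (1 / 2) ^ length s"
begin

lemma I_Cons: "I (b # s) \<subseteq> I s"
  using I_split[of s] by (cases b) auto

lemma I_append: "I (t @ s) \<subseteq> I s"
  by (induction t) (use I_Cons in fastforce)+

lemma I_disjoint_same_length: "length s = length s' \<Longrightarrow> s \<noteq> s' \<Longrightarrow> I s \<inter> I s' = {}"
proof (induction s s' rule: list_induct2)
  case (Cons b s b' s')
  show ?case
  proof (cases "s = s'")
    case True
    then have "b \<noteq> b'" using Cons.prems by simp
    then show ?thesis using I_disjoint[of s] True by (cases b; cases b') auto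
  next
    case False
    then show ?thesis using Cons.IH I_Cons[of b s] I_Cons[of b' s'] by blast
  qed
qed simp

lemma measure_split:
  assumes [measurable]: "A \<in> sets M"
  shows "measure M (A \<inter> I s) = measure M (A \<inter> I (True # s)) + measure M (A \<inter> I (False # s))"
proof -
  have "A \<inter> I s = (A \<inter> I (True # s)) \<union> (A \<inter> I (False # s))" using I_split[of s] by blast
  moreover have "(A \<inter> I (True # s)) \<inter> (A \<inter> I (False # s)) = {}" using I_disjoint[of s] by blast
  ultimately show ?thesis by (simp add: finite_measure_Union)
qed

lemma finite_level: "finite {s :: bool list. length s = n}"
  using finite_lists_length_eq[of "UNIV :: bool set" n] by simp

lemma level_Suc: "{s :: bool list. length s = Suc n} = (\<Union>b. (#) b ` {s. length s = n})"
  by (auto simp: length_Suc_conv)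

lemma sum_measure_level:
  assumes A: "A \<in> sets M"
  shows "(\<Sum>s | length s = n. measure M (A \<inter> I s)) = measure M A"
proof (induction n)
  case 0
  have "{s :: bool list. length s = 0} = {[]}" by auto
  then show ?case using sets.sets_into_space[OF A] by (simp add: I_Nil Int_absorb2)
next
  case (Suc n)
  let ?L = "{s :: bool list. length s = n}"
  have e: "{s :: bool list. length s = Suc n} = (#) True ` ?L \<union> (#) False ` ?L"
    unfolding level_Suc by (auto simp: UNIV_bool)
  let ?m = "\<lambda>s. measure M (A \<inter> I s)"
  have r: "sum ?m ((#) b ` ?L) = (\<Sum>s\<in>?L. ?m (b # s))" for b
    using sum.reindex[of "(#) b" ?L ?m] by (simp add: o_def)
  have "sum ?m {s. length s = Suc n} = sum ?m ((#) True ` ?L) + sum ?m ((#) False ` ?L)"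
    unfolding e by (rule sum.union_disjoint) (use finite_level in auto)
  also have "\<dots> = (\<Sum>s\<in>?L. ?m (True # s) + ?m (False # s))"
    unfolding r sum.distrib ..
  also have "\<dots> = sum ?m ?L"
    by (rule sum.cong) (simp_all only: measure_split[OF A, symmetric])
  finally show ?case using Suc.IH by simp
qed

text \<open>Otherwise each node passes all of its share of \<open>A\<close> to one child, so
  \<open>A\<close> sits up to null sets in sets \<open>I s\<close> of every length, whose measures
  tend to zero.\<close>

lemma positive_split:
  assumes A: "A \<in> sets M" "0 < measure M A"
  shows "\<exists>r. 0 < measure M (A \<inter> I (True # r)) \<and> 0 < measure M (A \<inter> I (False # r))"
proof (rule ccontr)
  assume no: "\<not> ?thesis"
  have "\<exists>s. length s = n \<and> measure M (A \<inter> I s) = measure M A" for n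
  proof (induction n)
    case 0
    show ?case using sets.sets_into_space[OF A(1)] by (intro exI[of _ "[]"]) (simp add: I_Nil Int_absorb2)
  next
    case (Suc n)
    then obtain s where s: "length s = n" "measure M (A \<inter> I s) = measure M A" by blast
    have "measure M (A \<inter> I (True # s)) = 0 \<or> measure M (A \<inter> I (False # s)) = 0"
      using no by (auto simp: zero_less_measure_iff)
    then have "\<exists>b. measure M (A \<inter> I (b # s)) = measure M A"
      using measure_split[OF A(1), of s] s(2) by (metis add.right_neutral add_0)
    then show ?case using s(1) by (metis length_Cons)
  qed
  then have le: "measure M A \<le> (1 / 2) ^ n" for n
    using finite_measure_mono[of "A \<inter> I _" "I _"] I_measure I_sets by (metis inf_le2)
  have "(\<lambda>n. (1 / 2 :: real) ^ n) \<longlonglongrightarrow> 0" by (rule LIMSEQ_power_zero) simp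
  then have "measure M A \<le> 0" by (rule LIMSEQ_le_const) (use le in auto)
  then show False using A(2) by simp
qed

end

section \<open>Trees of functionals and operators into \<open>L\<^sub>\<infinity>\<close>\<close>

text \<open>The lists \<open>t @ b # r\<close> are the child \<open>b\<close> of \<open>r\<close>
  and all its descendants: at all of them the functional takes nearly the value \<open>z r b\<close>
  on the vector attached to \<open>r\<close>.\<close>

locale functional_tree = dyadic_measure M I + Y: normed_space Y
  for M :: "'w measure" and I and Y :: "('k::real_or_complex, 'b) nspace" +
  fixes G :: "bool list \<Rightarrow> 'b \<Rightarrow> 'k" and y :: "bool list \<Rightarrow> 'b" and z :: "bool list \<Rightarrow> bool \<Rightarrow> 'k" and \<delta> :: real
  assumes G: "G s \<in> unit_ball (dual Y)" and y: "y r \<in> carrier Y"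
    and near: "norm (G (t @ b # r) (y r) - z r b) \<le> \<delta>"
begin

text \<open>The value at \<open>v\<close> of the integral over \<open>A\<close> of the function
  equal to \<open>G s\<close> on \<open>I s\<close> for \<open>s\<close> in level \<open>n\<close>.
  The default \<open>0\<close> makes it a point of a product of balls indexed by all pairs.\<close>

definition level_mean :: "nat \<Rightarrow> 'b \<times> 'w set \<Rightarrow> 'k" where
  "level_mean n = (\<lambda>(v, A). if v \<in> carrier Y \<and> A \<in> sets M
     then \<Sum>s | length s = n. measure M (A \<inter> I s) *\<^sub>R G s v else 0)"

lemma Gd: "G s \<in> carrier (dual Y)"
  using G[of s] by (simp add: unit_ball_def)

lemma level_mean_add:
  "v \<in> carrier Y \<Longrightarrow> w \<in> carrier Y \<Longrightarrow> level_mean n (v \<oplus>\<^bsub>Y\<^esub> w, A) = level_mean n (v, A) + level_mean n (w, A)"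
  by (simp add: level_mean_def Y.dual_add[OF Gd] scaleR_add_right sum.distrib)

lemma level_mean_smult:
  "v \<in> carrier Y \<Longrightarrow> level_mean n (c \<odot>\<^bsub>Y\<^esub> v, A) = c * level_mean n (v, A)"
  by (simp add: level_mean_def Y.dual_smult[OF Gd] sum_distrib_left)

lemma level_mean_Un:
  assumes "A \<in> sets M" "B \<in> sets M" "A \<inter> B = {}"
  shows "level_mean n (v, A \<union> B) = level_mean n (v, A) + level_mean n (v, B)"
proof -
  have "measure M ((A \<union> B) \<inter> I s) = measure M (A \<inter> I s) + measure M (B \<inter> I s)" for s
  proof -
    have "(A \<union> B) \<inter> I s = (A \<inter> I s) \<union> (B \<inter> I s)" by blast
    then show ?thesis using finite_measure_Union[of "A \<inter> I s" "B \<inter> I s"] assms by auto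
  qed
  then show ?thesis using assms by (simp add: level_mean_def scaleR_add_left sum.distrib)
qed

lemma level_mean_bound:
  assumes v: "v \<in> carrier Y" and A: "A \<in> sets M"
  shows "norm (level_mean n (v, A)) \<le> nrm Y v * measure M A"
proof -
  have "norm (\<Sum>s | length s = n. measure M (A \<inter> I s) *\<^sub>R G s v) \<le> (\<Sum>s | length s = n. measure M (A \<inter> I s) * nrm Y v)"
    by (rule sum_norm_le) (simp add: mult_left_mono Y.dual_ball_bound[OF G v])
  also have "\<dots> = nrm Y v * measure M A"
    using sum_measure_level[OF A, of n] by (simp add: sum_distrib_right[symmetric])
  finally show ?thesis using v A by (simp add: level_mean_def)
qed

lemma level_mean_near:
  assumes A: "A \<in> sets M" "A \<subseteq> I (b # r)" and n: "length r < n"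
  shows "norm (level_mean n (y r, A) - measure M A *\<^sub>R z r b) \<le> \<delta> * measure M A"
proof -
  have summand: "norm (measure M (A \<inter> I s) *\<^sub>R (G s (y r) - z r b)) \<le> measure M (A \<inter> I s) * \<delta>"
    if s: "length s = n" for s
  \<comment> \<open>Dropping the \<open>n - Suc (length r)\<close> latest bits gives the ancestor of
    \<open>s\<close> in the level of \<open>b # r\<close>. If it is \<open>b # r\<close>, the tree
    estimate applies; if not, \<open>I s\<close> misses \<open>A\<close>.\<close>
  proof (cases "drop (n - Suc (length r)) s = b # r")
    case True
    then have "s = take (n - Suc (length r)) s @ b # r" by (metis append_take_drop_id)
    then have "norm (G s (y r) - z r b) \<le> \<delta>" using near by metis
    then show ?thesis by (simp add: mult_left_mono)
  next
    case False
    let ?d = "drop (n - Suc (length r)) s"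
    have "I ?d \<inter> I (b # r) = {}" by (rule I_disjoint_same_length) (use False s n in auto)
    moreover have "I s \<subseteq> I ?d" using I_append[of "take (n - Suc (length r)) s" ?d] by simp
    ultimately have "A \<inter> I s = {}" using A(2) by blast
    then show ?thesis by simp
  qed
  have "level_mean n (y r, A) - measure M A *\<^sub>R z r b =
      (\<Sum>s | length s = n. measure M (A \<inter> I s) *\<^sub>R (G s (y r) - z r b))"
    using A(1) y sum_measure_level[OF A(1), of n]
    by (simp add: level_mean_def scaleR_diff_right sum_subtractf scaleR_sum_left[symmetric])
  also have "norm \<dots> \<le> (\<Sum>s | length s = n. measure M (A \<inter> I s) * \<delta>)"
    by (rule sum_norm_le) (use summand in simp)
  also have "\<dots> = \<delta> * measure M A"
    using sum_measure_level[OF A(1), of n] by (simp add: sum_distrib_right[symmetric])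
  finally show ?thesis .
qed

text \<open>A cluster point of the \<open>level_mean\<close>s; it exists by Tychonoff's theorem.\<close>

lemma limit_mean_exists:
  "\<exists>\<nu>. (\<forall>v\<in>carrier Y. \<forall>A\<in>sets M. norm (\<nu> (v, A)) \<le> nrm Y v * measure M A) \<and>
     (\<forall>v\<in>carrier Y. \<forall>w\<in>carrier Y. \<forall>A. \<nu> (v \<oplus>\<^bsub>Y\<^esub> w, A) = \<nu> (v, A) + \<nu> (w, A)) \<and>
     (\<forall>c. \<forall>v\<in>carrier Y. \<forall>A. \<nu> (c \<odot>\<^bsub>Y\<^esub> v, A) = c * \<nu> (v, A)) \<and>
     (\<forall>v. \<forall>A\<in>sets M. \<forall>B\<in>sets M. A \<inter> B = {} \<longrightarrow> \<nu> (v, A \<union> B) = \<nu> (v, A) + \<nu> (v, B)) \<and>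
     (\<forall>r b. \<forall>A\<in>sets M. A \<subseteq> I (b # r) \<longrightarrow> norm (\<nu> (y r, A) - measure M A *\<^sub>R z r b) \<le> \<delta> * measure M A)"
proof -
  define bnd where "bnd = (\<lambda>(v, A). if v \<in> carrier Y \<and> A \<in> sets M then nrm Y v * measure M A else 0)"
  let ?C = "PiE UNIV (\<lambda>i. cball 0 (bnd i)) :: ('b \<times> 'w set \<Rightarrow> 'k) set"
  have "compactin (product_topology (\<lambda>_. euclidean) UNIV) ?C" by (simp add: compactin_PiE)
  then have C: "compact ?C" by (simp add: euclidean_product_topology)
  let ?add = "\<Inter>v\<in>carrier Y. \<Inter>w\<in>carrier Y. \<Inter>A. {\<nu> :: 'b \<times> 'w set \<Rightarrow> 'k. \<nu> (v \<oplus>\<^bsub>Y\<^esub> w, A) = \<nu> (v, A) + \<nu> (w, A)}"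
  let ?hom = "\<Inter>c. \<Inter>v\<in>carrier Y. \<Inter>A. {\<nu> :: 'b \<times> 'w set \<Rightarrow> 'k. \<nu> (c \<odot>\<^bsub>Y\<^esub> v, A) = c * \<nu> (v, A)}"
  let ?un = "\<Inter>v. \<Inter>A\<in>sets M. \<Inter>B\<in>{B \<in> sets M. A \<inter> B = {}}.
      {\<nu> :: 'b \<times> 'w set \<Rightarrow> 'k. \<nu> (v, A \<union> B) = \<nu> (v, A) + \<nu> (v, B)}"
  let ?near = "\<lambda>r. \<Inter>b. \<Inter>A\<in>{A \<in> sets M. A \<subseteq> I (b # r)}.
      {\<nu> :: 'b \<times> 'w set \<Rightarrow> 'k. norm (\<nu> (y r, A) - measure M A *\<^sub>R z r b) \<le> \<delta> * measure M A}"
  let ?D = "\<lambda>r. ?add \<inter> ?hom \<inter> ?un \<inter> ?near r"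
  have ev: "continuous_on UNIV (\<lambda>\<nu> :: 'b \<times> 'w set \<Rightarrow> 'k. \<nu> i)" for i
    by (rule continuous_on_product_coordinates)
  have D: "closed (?D r)" for r
    by (intro closed_Int closed_INT ballI closed_Collect_eq closed_Collect_le continuous_intros ev)
  \<comment> \<open>All conditions are closed, so in the compact product it suffices to meet
    finitely many of them at once.\<close>
  have "?C \<inter> (\<Inter>r. ?D r) \<noteq> {}"
  proof (rule compact_imp_fip_image[OF C D])
    fix R :: "bool list set" assume R: "finite R"
    \<comment> \<open>Linearity and additivity hold at every level; the tree estimate at
      \<open>r\<close> requires a level beyond \<open>r\<close>. The inserted \<open>0\<close>
      covers empty \<open>R\<close>.\<close>
    define n where "n = Suc (Max (insert 0 (length ` R)))"
    have n: "length r < n" if "r \<in> R" for r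
      using R that by (simp add: n_def less_Suc_eq_le Max_ge_iff)
    have "level_mean n \<in> ?C"
    proof (rule PiE_I)
      fix i :: "'b \<times> 'w set"
      obtain v A where i: "i = (v, A)" by (cases i)
      have "norm (level_mean n i) \<le> bnd i"
      proof (cases "v \<in> carrier Y \<and> A \<in> sets M")
        case True
        then show ?thesis using level_mean_bound[of v A n] by (simp add: i bnd_def)
      next
        case False
        then show ?thesis by (auto simp: i bnd_def level_mean_def)
      qed
      then show "level_mean n i \<in> cball 0 (bnd i)" by simp
    qed simp
    moreover have "level_mean n \<in> (\<Inter>r\<in>R. ?D r)"
    proof (rule INT_I)
      fix r assume "r \<in> R"
      then show "level_mean n \<in> ?D r"
        using level_mean_add level_mean_smult level_mean_Un level_mean_near[OF _ _ n] by auto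
    qed
    ultimately have "level_mean n \<in> ?C \<inter> (\<Inter>r\<in>R. ?D r)" by (rule IntI)
    then show "?C \<inter> (\<Inter>r\<in>R. ?D r) \<noteq> {}" by (metis empty_iff)
  qed
  then obtain \<nu> where "\<nu> \<in> ?C \<inter> (\<Inter>r. ?D r)" by (meson ex_in_conv)
  then have \<nu>: "\<nu> \<in> ?C" "\<And>r. \<nu> \<in> ?D r" by (rule IntD1, rule INT_D[OF IntD2 UNIV_I])
  have "norm (\<nu> (v, A)) \<le> nrm Y v * measure M A" if "v \<in> carrier Y" "A \<in> sets M" for v A
    using PiE_mem[OF \<nu>(1), of "(v, A)"] that by (simp add: bnd_def)
  moreover have "\<nu> \<in> ?add" "\<nu> \<in> ?hom" "\<nu> \<in> ?un"
    by (rule IntD1[OF IntD1[OF IntD1[OF \<nu>(2)]]], rule IntD2[OF IntD1[OF IntD1[OF \<nu>(2)]]],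
        rule IntD2[OF IntD1[OF \<nu>(2)]])
  moreover have "norm (\<nu> (y r, A) - measure M A *\<^sub>R z r b) \<le> \<delta> * measure M A"
    if "A \<in> sets M" "A \<subseteq> I (b # r)" for r b A
    using INT_D[OF INT_D[OF IntD2[OF \<nu>(2)[of r]] UNIV_I], of A b] that by simp
  ultimately show ?thesis by (intro exI[of _ \<nu>]) auto
qed

text \<open>For fixed \<open>v\<close> in the carrier the set function
  \<open>A \<mapsto> \<nu> (v, A)\<close> has a density, and \<open>S v\<close> is its class. Since
  a density is determined almost everywhere by its integrals, \<open>S\<close> is linear; bounds on
  averages pass to the density with the factor \<open>DIM('k)\<close>.\<close>

lemma operator_into_Linfty:
  "\<exists>S. bounded_operator Y (Linfty M) S \<and>
     (\<forall>r b. AE x in M. x \<in> I (b # r) \<longrightarrow> norm (rep (S (y r)) x - z r b) \<le> DIM('k) * \<delta>)"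
proof -
  obtain \<nu> where \<nu>: "(\<forall>v\<in>carrier Y. \<forall>A\<in>sets M. norm (\<nu> (v, A)) \<le> nrm Y v * measure M A) \<and>
     (\<forall>v\<in>carrier Y. \<forall>w\<in>carrier Y. \<forall>A. \<nu> (v \<oplus>\<^bsub>Y\<^esub> w, A) = \<nu> (v, A) + \<nu> (w, A)) \<and>
     (\<forall>c. \<forall>v\<in>carrier Y. \<forall>A. \<nu> (c \<odot>\<^bsub>Y\<^esub> v, A) = c * \<nu> (v, A)) \<and>
     (\<forall>v. \<forall>A\<in>sets M. \<forall>B\<in>sets M. A \<inter> B = {} \<longrightarrow> \<nu> (v, A \<union> B) = \<nu> (v, A) + \<nu> (v, B)) \<and>
     (\<forall>r b. \<forall>A\<in>sets M. A \<subseteq> I (b # r) \<longrightarrow> norm (\<nu> (y r, A) - measure M A *\<^sub>R z r b) \<le> \<delta> * measure M A)"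
    using limit_mean_exists by (rule exE)
  have bnd: "\<And>v A. v \<in> carrier Y \<Longrightarrow> A \<in> sets M \<Longrightarrow> norm (\<nu> (v, A)) \<le> nrm Y v * measure M A"
    and add: "\<And>v w A. v \<in> carrier Y \<Longrightarrow> w \<in> carrier Y \<Longrightarrow> \<nu> (v \<oplus>\<^bsub>Y\<^esub> w, A) = \<nu> (v, A) + \<nu> (w, A)"
    and hom: "\<And>c v A. v \<in> carrier Y \<Longrightarrow> \<nu> (c \<odot>\<^bsub>Y\<^esub> v, A) = c * \<nu> (v, A)"
    and un: "\<And>v A B. A \<in> sets M \<Longrightarrow> B \<in> sets M \<Longrightarrow> A \<inter> B = {} \<Longrightarrow> \<nu> (v, A \<union> B) = \<nu> (v, A) + \<nu> (v, B)"
    and nr: "\<And>r b A. A \<in> sets M \<Longrightarrow> A \<subseteq> I (b # r) \<Longrightarrow> norm (\<nu> (y r, A) - measure M A *\<^sub>R z r b) \<le> \<delta> * measure M A"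
    using \<nu>[THEN conjunct1] \<nu>[THEN conjunct2, THEN conjunct1] \<nu>[THEN conjunct2, THEN conjunct2, THEN conjunct1]
      \<nu>[THEN conjunct2, THEN conjunct2, THEN conjunct2, THEN conjunct1]
      \<nu>[THEN conjunct2, THEN conjunct2, THEN conjunct2, THEN conjunct2] by simp_all
  have "\<exists>g. integrable M g \<and> (\<forall>A\<in>sets M. (LINT x:A|M. g x) = \<nu> (v, A))" if v: "v \<in> carrier Y" for v
    by (rule dominated_density[where C = "nrm Y v"]) (use un bnd[OF v] in auto)
  then obtain g where g: "\<And>v. v \<in> carrier Y \<Longrightarrow> integrable M (g v)"
      "\<And>v A. v \<in> carrier Y \<Longrightarrow> A \<in> sets M \<Longrightarrow> (LINT x:A|M. g v x) = \<nu> (v, A)" by metis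
  have gm: "g v \<in> borel_measurable M" if "v \<in> carrier Y" for v using g(1)[OF that] by simp
  have gi: "integrable M (\<lambda>x. indicator A x *\<^sub>R g v x)" if "v \<in> carrier Y" "A \<in> sets M" for v A
    by (rule integrable_mult_indicator[OF that(2) g(1)[OF that(1)]])
  have g_bound: "AE x in M. norm (g v x) \<le> DIM('k) * nrm Y v" if v: "v \<in> carrier Y" for v
  proof -
    have "AE x in M. x \<in> space M \<longrightarrow> norm (g v x - 0) \<le> DIM('k) * nrm Y v"
      by (rule AE_near_if_averages_near[OF g(1)[OF v]]) (use g(2)[OF v] bnd[OF v] in auto)
    then show ?thesis using AE_space by eventually_elim simp
  qed
  have g_near: "AE x in M. x \<in> I (b # r) \<longrightarrow> norm (g (y r) x - z r b) \<le> DIM('k) * \<delta>" for r b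
    by (rule AE_near_if_averages_near[OF g(1)[OF y]]) (use g(2)[OF y] nr in auto)
  \<comment> \<open>The comparison of values with averages, with tolerance zero, applied to the
    difference.\<close>
  have unique: "AE x in M. f x = f' x"
    if f: "integrable M f" "integrable M f'" "\<And>A. A \<in> sets M \<Longrightarrow> (LINT x:A|M. f x) = (LINT x:A|M. f' x)"
    for f f' :: "'w \<Rightarrow> 'k"
  proof -
    have "AE x in M. x \<in> space M \<longrightarrow> norm ((f x - f' x) - 0) \<le> DIM('k) * (0::real)"
    proof (rule AE_near_if_averages_near)
      show "integrable M (\<lambda>x. f x - f' x)" using f(1,2) by simp
      fix A assume A: "A \<in> sets M"
      have "set_integrable M A f" "set_integrable M A f'"
        unfolding set_integrable_def by (rule integrable_mult_indicator[OF A f(1)], rule integrable_mult_indicator[OF A f(2)])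
      then have "(LINT x:A|M. f x - f' x) = 0" using f(3)[OF A] by (simp add: set_integral_diff(2))
      then show "norm ((LINT x:A|M. f x - f' x) - measure M A *\<^sub>R 0) \<le> 0 * measure M A" by simp
    qed simp
    then show ?thesis using AE_space by eventually_elim simp
  qed
  define S where "S v = Linfty_class M (g v)" for v
  have "bounded_operator Y (Linfty M) S"
    unfolding bounded_operator_def
  proof (intro conjI ballI allI)
    show "S \<in> carrier Y \<rightarrow> carrier (Linfty M)"
      using carrier_LinftyI[OF gm g_bound] by (auto simp: S_def)
    have "nrm (Linfty M) (S v) \<le> DIM('k) * nrm Y v" if v: "v \<in> carrier Y" for v
    proof (rule Linfty_nrm_le)
      show "0 \<le> DIM('k) * nrm Y v" using Y.nrm_ge_0[OF v] by simp
      show "AE x in M. norm (rep (S v) x) \<le> DIM('k) * nrm Y v"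
        using rep_class(2)[OF gm[OF v]] g_bound[OF v] unfolding S_def by eventually_elim simp
    qed
    then show "\<exists>C. \<forall>v\<in>carrier Y. nrm (Linfty M) (S v) \<le> C * nrm Y v" by blast
    fix v assume v: "v \<in> carrier Y"
    have "S (c \<odot>\<^bsub>Y\<^esub> v) = Linfty_class M (\<lambda>x. c * g v x)" for c
      unfolding S_def
    proof (rule Linfty_class_cong, rule unique)
      show "integrable M (g (c \<odot>\<^bsub>Y\<^esub> v))" "integrable M (\<lambda>x. c * g v x)" using g(1) v by auto
      fix A assume A: "A \<in> sets M"
      show "(LINT x:A|M. g (c \<odot>\<^bsub>Y\<^esub> v) x) = (LINT x:A|M. c * g v x)"
        using g(2)[OF _ A] v hom[OF v] by simp
    qed
    then show "S (c \<odot>\<^bsub>Y\<^esub> v) = c \<odot>\<^bsub>Linfty M\<^esub> S v" for c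
      using Linfty_smult_class[OF gm[OF v]] by (simp add: S_def del: Linfty_simps)
    fix w assume w: "w \<in> carrier Y"
    have "S (v \<oplus>\<^bsub>Y\<^esub> w) = Linfty_class M (\<lambda>x. g v x + g w x)"
      unfolding S_def
    proof (rule Linfty_class_cong, rule unique)
      show "integrable M (g (v \<oplus>\<^bsub>Y\<^esub> w))" "integrable M (\<lambda>x. g v x + g w x)" using g(1) v w by auto
      fix A assume A: "A \<in> sets M"
      have "set_integrable M A (g v)" "set_integrable M A (g w)"
        unfolding set_integrable_def by (rule gi[OF v A], rule gi[OF w A])
      then show "(LINT x:A|M. g (v \<oplus>\<^bsub>Y\<^esub> w) x) = (LINT x:A|M. g v x + g w x)"
        using g(2)[OF _ A] v w add[OF v w] by (simp add: set_integral_add(2))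
    qed
    then show "S (v \<oplus>\<^bsub>Y\<^esub> w) = S v \<oplus>\<^bsub>Linfty M\<^esub> S w"
      using Linfty_add_class[OF gm[OF v] gm[OF w]] by (simp add: S_def del: Linfty_simps)
  qed
  moreover have "AE x in M. x \<in> I (b # r) \<longrightarrow> norm (rep (S (y r)) x - z r b) \<le> DIM('k) * \<delta>" for r b
    using rep_class(2)[OF gm[OF y[of r]]] g_near[of b r] unfolding S_def by eventually_elim simp
  ultimately show ?thesis by blast
qed

end

section \<open>Measurable functions on small sets of positive measure\<close>

context dyadic_measure
begin

text \<open>Balls around a countable dense set cover the values of \<open>f\<close>, so countably
  many preimages cover \<open>A\<close> and one of them meets it in positive measure.\<close>

lemma constant_up_to:
  fixes f :: "'w \<Rightarrow> 'k::euclidean_space"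
  assumes A: "A \<in> sets M" "0 < measure M A" and f: "f \<in> borel_measurable M" and d: "0 < \<delta>"
  shows "\<exists>w A'. A' \<in> sets M \<and> A' \<subseteq> A \<and> 0 < measure M A' \<and> (\<forall>x\<in>A'. norm (f x - w) \<le> \<delta>)"
proof (rule ccontr)
  assume no: "\<not> ?thesis"
  obtain D :: "'k set" where D: "countable D" "\<And>X. open X \<Longrightarrow> X \<noteq> {} \<Longrightarrow> \<exists>d\<in>D. d \<in> X"
    by (rule countable_dense_setE) blast
  let ?A = "\<lambda>w. A \<inter> (f -` cball w \<delta> \<inter> space M)"
  have m: "?A w \<in> sets M" for w     by (rule sets.Int[OF A(1) measurable_sets[OF f borel_closed[OF closed_cball]]])
  have "\<not> 0 < measure M (?A w)" for w
  proof
    assume "0 < measure M (?A w)"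
    moreover have "\<forall>x\<in>?A w. norm (f x - w) \<le> \<delta>" by (auto simp: dist_norm norm_minus_commute)
    ultimately show False using no m[of w] by blast
  qed
  then have "measure M (?A w) = 0" for w using measure_nonneg[of M "?A w"] by (meson antisym not_le)
  then have "?A w \<in> null_sets M" for w using m[of w] by (simp add: emeasure_eq_measure null_sets_def)
  then have "(\<Union>w\<in>D. ?A w) \<in> null_sets M" using D(1) by (intro null_sets_UN') auto
  moreover have "A \<subseteq> (\<Union>w\<in>D. ?A w)"
  proof
    fix x assume x: "x \<in> A"
    obtain w where "w \<in> D" "w \<in> ball (f x) \<delta>" using D(2)[of "ball (f x) \<delta>"] d by auto
    then show "x \<in> (\<Union>w\<in>D. ?A w)" using x sets.sets_into_space[OF A(1)] by (auto simp: dist_commute intro!: less_imp_le)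
  qed
  ultimately have "A \<in> null_sets M" using null_sets_subset[OF _ A(1)] by blast
  then show False using A(2) by (simp add: measure_def null_sets_def)
qed

lemma constant_up_to_finite:
  fixes f :: "'n \<Rightarrow> 'w \<Rightarrow> 'k::euclidean_space"
  assumes "finite N" and A: "A \<in> sets M" "0 < measure M A"
    and f: "\<And>v. v \<in> N \<Longrightarrow> f v \<in> borel_measurable M" and d: "0 < \<delta>"
  shows "\<exists>A'. A' \<in> sets M \<and> A' \<subseteq> A \<and> 0 < measure M A' \<and> (\<forall>v\<in>N. \<exists>w. \<forall>x\<in>A'. norm (f v x - w) \<le> \<delta>)"
  using assms(1) f
proof (induction N rule: finite_induct)
  case empty
  then show ?case using A by blast
next
  case (insert v N)
  then obtain B where B: "B \<in> sets M" "B \<subseteq> A" "0 < measure M B" "\<forall>v\<in>N. \<exists>w. \<forall>x\<in>B. norm (f v x - w) \<le> \<delta>"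
    by auto
  have "f v \<in> borel_measurable M" using insert.prems by simp
  from constant_up_to[OF B(1,3) this d]
  obtain w B' where B': "B' \<in> sets M" "B' \<subseteq> B" "0 < measure M B'" "\<forall>x\<in>B'. norm (f v x - w) \<le> \<delta>"
    by (elim exE conjE) (rule that)
  have "\<forall>u\<in>insert v N. \<exists>w. \<forall>x\<in>B'. norm (f u x - w) \<le> \<delta>" using B(4) B'(2,4) by blast
  then show ?case using B' B(2) by blast
qed

lemma AE_positive_ex:
  assumes "AE x in M. P x" "A \<in> sets M" "0 < measure M A"
  shows "\<exists>x\<in>A. P x"
proof (rule ccontr)
  assume "\<not> ?thesis"
  with assms(1) have "AE x in M. x \<notin> A" by (auto elim: eventually_mono)
  then have "A \<in> null_sets M" using assms(2) by (simp add: AE_iff_null_sets)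
  then show False using assms(3) by (simp add: measure_def null_sets_def)
qed

end

text \<open>Binary digits with the finest at the head: \<open>True\<close> selects the right half,
  whose left endpoint is shifted by half the length of the parent.\<close>

primrec dyadic_left :: "bool list \<Rightarrow> real" where
  "dyadic_left [] = 0"
| "dyadic_left (b # s) = dyadic_left s + (if b then (1 / 2) ^ Suc (length s) else 0)"

definition dyadic_interval :: "bool list \<Rightarrow> real set" where
  "dyadic_interval s = {dyadic_left s..<dyadic_left s + (1 / 2) ^ length s}"

lemma dyadic_interval_split:
  "dyadic_interval (True # s) \<union> dyadic_interval (False # s) = dyadic_interval s"
  "dyadic_interval (True # s) \<inter> dyadic_interval (False # s) = {}"
proof -
  have "(0::real) < (1 / 2) ^ length s" by simp
  then show "dyadic_interval (True # s) \<union> dyadic_interval (False # s) = dyadic_interval s"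
    "dyadic_interval (True # s) \<inter> dyadic_interval (False # s) = {}"
    by (auto simp: dyadic_interval_def)
qed

lemma dyadic_interval_subset: "dyadic_interval s \<subseteq> {0..<1}"
proof (induction s)
  case (Cons b s)
  have "dyadic_interval (b # s) \<subseteq> dyadic_interval s"
    unfolding dyadic_interval_split(1)[of s, symmetric] by (cases b) simp_all
  then show ?case using Cons.IH by (rule order_trans)
qed (simp add: dyadic_interval_def)

text \<open>Lebesgue measure on \<open>[0, 1)\<close>, carried to scalar functions by \<open>r \<mapsto> (\<lambda>_. r)\<close>: the definition of
  Asplund operators only quantifies over measures on that type.\<close>

lemma dyadic_measure_exists: "\<exists>(M :: ('b \<Rightarrow> 'k::real_or_complex) measure) I. dyadic_measure M I"
proof -
  let ?N = "restrict_space lborel {0..<1::real}"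
  \<comment> \<open>\<open>?\<tau>\<close> is a left inverse of \<open>?\<iota>\<close>. The
    \<sigma>-algebra generated by it makes \<open>?\<iota>\<close> measurable and contains the
    preimages of intervals; the argument \<open>undefined\<close> is an arbitrary fixed point of
    \<open>'b\<close>.\<close>
  let ?\<tau> = "\<lambda>\<phi> :: 'b \<Rightarrow> 'k. \<phi> undefined \<bullet> 1" and ?\<iota> = "\<lambda>r (_ :: 'b). of_real r :: 'k"
  let ?X = "?\<tau> -` {0..<1}"
  let ?V = "vimage_algebra ?X ?\<tau> borel"
  have \<tau>\<iota>: "?\<tau> (?\<iota> r) = r" for r by (simp add: of_real_def dot_square_norm)
  have \<tau>: "?\<tau> \<in> measurable ?V borel" by (rule measurable_vimage_algebra1) simp
  have \<iota>: "?\<iota> \<in> measurable ?N ?V"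
  proof (rule measurable_vimage_algebra2)
    show "(\<lambda>r. ?\<tau> (?\<iota> r)) \<in> borel_measurable ?N" unfolding \<tau>\<iota> by (simp add: measurable_restrict_space1)
  qed (auto simp: \<tau>\<iota> space_restrict_space)
  define M where "M = distr ?N ?V ?\<iota>"
  define I where "I s = ?\<tau> -` dyadic_interval s \<inter> ?X" for s
  have I_sets: "I s \<in> sets ?V" for s
    using measurable_sets[OF \<tau>, of "dyadic_interval s"] by (simp add: I_def dyadic_interval_def)
  have I_meas: "emeasure M (I s) = ennreal ((1 / 2) ^ length s)" for s
  proof -
    have "?\<iota> -` I s \<inter> space ?N = dyadic_interval s"
      using dyadic_interval_subset[of s] by (auto simp: I_def \<tau>\<iota> space_restrict_space)
    then have "emeasure M (I s) = emeasure ?N (dyadic_interval s)"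
      unfolding M_def using emeasure_distr[OF \<iota> I_sets] by simp
    also have "\<dots> = emeasure lborel (dyadic_interval s)"
      by (rule emeasure_restrict_space) (use dyadic_interval_subset in auto)
    finally show ?thesis by (simp add: dyadic_interval_def)
  qed
  have I_Nil: "I [] = space M" by (auto simp: I_def M_def dyadic_interval_def)
  have "dyadic_measure M I"
  proof (intro dyadic_measure.intro finite_measureI dyadic_measure_axioms.intro)
    show "emeasure M (space M) \<noteq> \<infinity>" using I_meas[of "[]"] I_Nil by simp
    show "I s \<in> sets M" for s using I_sets by (simp add: M_def)
    show "I [] = space M" by (rule I_Nil)
    show "I (True # s) \<union> I (False # s) = I s" "I (True # s) \<inter> I (False # s) = {}" for s
      using dyadic_interval_split[of s] unfolding I_def by blast+
    show "measure M (I s) = (1 / 2) ^ length s" for s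
      unfolding measure_def I_meas by simp
  qed
  then show ?thesis by blast
qed


section \<open>Asplund operators have a Szlenk index\<close>

context operator
begin

text \<open>A tree of weak* open sets that meet \<open>L\<close> is built downwards: each of them
  contains two points of \<open>L\<close> more than \<epsilon> apart on some vector, and its
  children restrict the value on that vector to within \<delta> of either. Every functional chosen
  further down inherits all the restrictions above it.\<close>

lemma self_derived_tree:
  assumes L: "L \<subseteq> K" "L \<noteq> {}" "L \<subseteq> szlenk_deriv X \<epsilon> L" and d: "0 < \<delta>"
  shows "\<exists>G x z. (\<forall>s. G s \<in> unit_ball (dual Y)) \<and> (\<forall>r :: bool list. x r \<in> unit_ball X) \<and>
    (\<forall>r. \<epsilon> < norm (z r True - z r False)) \<and> (\<forall>t b r. norm (G (t @ b # r) (T (x r)) - z r b) \<le> \<delta>)"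
proof -
  let ?P = "\<lambda>V. openin (weak_star X) V \<and> V \<inter> L \<noteq> {}"
  have Ld: "L \<subseteq> carrier (dual X)" using L(1) K_subset by blast
  have step: "\<exists>x z W. x \<in> unit_ball X \<and> \<epsilon> < norm (z True - z False) \<and>
      (\<forall>b. ?P (W b) \<and> W b \<subseteq> V \<and> (\<forall>h\<in>W b. norm (h x - z b) \<le> \<delta>))" if V: "?P V" for V
  proof -
    obtain f where f: "f \<in> L" "f \<in> V" using V by blast
    then have "f \<in> szlenk_deriv X \<epsilon> L" using L(3) by blast
    then have "\<exists>g\<in>L \<inter> V. \<exists>h\<in>L \<inter> V. \<exists>x\<in>unit_ball X. \<epsilon> < norm (g x - h x)"
      using V f(2) unfolding X.szlenk_deriv_iff[OF Ld] by meson
    then obtain g h x where gh: "g \<in> L \<inter> V" "h \<in> L \<inter> V" "x \<in> unit_ball X" "\<epsilon> < norm (g x - h x)" by meson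
    define k where "k b = (if b then g else h)" for b
    define W where "W b = V \<inter> {\<phi> \<in> topspace (weak_star X). \<phi> x \<in> ball (k b x) \<delta>}" for b
    have x: "x \<in> carrier X" using gh(3) by (simp add: unit_ball_def)
    have "openin (weak_star X) (W b)" for b
      unfolding W_def
      by (intro openin_Int openin_continuous_map_preimage[OF continuous_map_weak_star_eval[OF x]])
         (use V in auto)
    moreover have "k b \<in> W b \<inter> L" for b using gh(1,2) Ld d by (auto simp: W_def k_def)
    ultimately have "?P (W b)" for b by blast
    moreover have "W b \<subseteq> V" for b by (auto simp: W_def)
    moreover have "\<forall>\<phi>\<in>W b. norm (\<phi> x - k b x) \<le> \<delta>" for b
      by (auto simp: W_def dist_norm norm_minus_commute)
    ultimately show ?thesis
      using gh(3,4) by (intro exI[of _ x] exI[of _ "\<lambda>b. k b x"] exI[of _ W]) (auto simp: k_def)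
  qed
  then obtain cx cz cW where c: "\<And>V. ?P V \<Longrightarrow> cx V \<in> unit_ball X \<and> \<epsilon> < norm (cz V True - cz V False) \<and>
      (\<forall>b. ?P (cW V b) \<and> cW V b \<subseteq> V \<and> (\<forall>h\<in>cW V b. norm (h (cx V) - cz V b) \<le> \<delta>))"
    by metis
  define U where "U = rec_list (topspace (weak_star X)) (\<lambda>b s V. cW V b)"
  have U: "U [] = topspace (weak_star X)" "U (b # s) = cW (U s) b" for b s by (simp_all add: U_def)
  have P: "?P (U s)" for s
  proof (induction s)
    case Nil
    show ?case unfolding U using L(2) Ld openin_topspace[of "weak_star X"] by auto
  next
    case (Cons b s)
    then show ?case unfolding U using c by blast
  qed
  have mono: "U (t @ s) \<subseteq> U s" for t s
  proof (induction t)
    case (Cons b t)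
    then show ?case using c[OF P[of "t @ s"]] by (simp add: U) blast
  qed simp
  have "\<exists>g. g \<in> unit_ball (dual Y) \<and> adjoint X T g \<in> U s" for s
    using P[of s] L(1) by blast
  then obtain G where G: "\<And>s. G s \<in> unit_ball (dual Y)" "\<And>s. adjoint X T (G s) \<in> U s" by metis
  have "norm (G (t @ b # r) (T (cx (U r))) - cz (U r) b) \<le> \<delta>" for t b r
  proof -
    have "adjoint X T (G (t @ b # r)) \<in> cW (U r) b" using G(2) mono[of t "b # r"] U(2) by blast
    then have "norm (adjoint X T (G (t @ b # r)) (cx (U r)) - cz (U r) b) \<le> \<delta>" using c[OF P] by blast
    moreover have "cx (U r) \<in> carrier X" using c[OF P[of r]] by (simp add: unit_ball_def)
    ultimately show ?thesis by (simp add: adjoint_def)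
  qed
  then show ?thesis
    using G(1) c[OF P] by (intro exI[of _ G] exI[of _ "\<lambda>r. cx (U r)"] exI[of _ "\<lambda>r. cz (U r)"]) blast
qed

text \<open>The tree yields an operator \<open>S\<close> for which \<open>S (T (x r))\<close> is
  near \<open>z r True\<close> on one half of \<open>I r\<close> and near \<open>z r False\<close>
  on the other. Relative compactness on \<open>B\<close> gives a smaller set of positive measure on
  which all these functions are nearly constant, and that set meets both halves of some
  \<open>I r\<close> in positive measure.\<close>

theorem Asplund_self_derived:
  assumes asp: "Asplund_op X Y T" and L: "L \<subseteq> K" "L \<subseteq> szlenk_deriv X \<epsilon> L" and e: "0 < \<epsilon>"
  shows "L = {}"
proof (rule ccontr)
  assume ne: "L \<noteq> {}"
  let ?d = "real DIM('k)"
  \<comment> \<open>On each half the deviation is at most \<open>?d * \<delta>\<close> from the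
    operator, \<delta> from the net and \<delta> from near constancy; the two halves add up to
    exactly \<epsilon>.\<close>
  define \<delta> where "\<delta> = \<epsilon> / (2 * ?d + 4)"
  have dp: "0 < 2 * ?d + 4" by (simp add: add_nonneg_pos)
  have d: "0 < \<delta>" "(2 * ?d + 4) * \<delta> = \<epsilon>" using e dp by (simp_all add: \<delta>_def)
  obtain G x z where Gxz: "(\<forall>s. G s \<in> unit_ball (dual Y)) \<and> (\<forall>r :: bool list. x r \<in> unit_ball X) \<and>
    (\<forall>r. \<epsilon> < norm (z r True - z r False)) \<and> (\<forall>t b r. norm (G (t @ b # r) (T (x r)) - z r b) \<le> \<delta>)"
    using self_derived_tree[OF L(1) ne L(2) d(1)] by (elim exE)
  have G: "\<And>s. G s \<in> unit_ball (dual Y)" and x: "\<And>r. x r \<in> unit_ball X"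
    and z: "\<And>r. \<epsilon> < norm (z r True - z r False)"
    and near: "\<And>t b r. norm (G (t @ b # r) (T (x r)) - z r b) \<le> \<delta>"
    using Gxz by simp_all
  obtain M :: "('b \<Rightarrow> 'k) measure" and I where MI: "dyadic_measure M I" using dyadic_measure_exists by blast
  interpret dyadic_measure M I by (rule MI)
  have xc: "x r \<in> carrier X" for r using x[of r] by (simp add: unit_ball_def)
  interpret functional_tree M I Y G "\<lambda>r. T (x r)" z \<delta>
    by (intro functional_tree.intro[OF MI Y] functional_tree_axioms.intro G near T_mem xc)
  obtain S where S: "bounded_operator Y (Linfty M) S"
    and S_near: "\<And>r b. AE \<omega> in M. \<omega> \<in> I (b # r) \<longrightarrow> norm (rep (S (T (x r))) \<omega> - z r b) \<le> ?d * \<delta>"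
    using operator_into_Linfty by blast
  have total: "measure M (space M) = 1" using I_measure[of "[]"] by (simp add: I_Nil)
  let ?cut = "\<lambda>B u. Linfty_class M (\<lambda>\<omega>. rep u \<omega> * indicator B \<omega>)"
  \<comment> \<open>The total mass is 1, so the tolerance 1 asks exactly for positive
    measure.\<close>
  have "\<exists>B\<in>sets M. measure M B > measure M (space M) - 1 \<and>
      relatively_compact (Linfty M) {?cut B u | u. u \<in> S ` T ` unit_ball X}"
    using asp S finite_measure_axioms zero_less_one unfolding Asplund_op_def by blast
  then obtain B where B: "B \<in> sets M" "0 < measure M B"
    and rc: "relatively_compact (Linfty M) {?cut B u | u. u \<in> S ` T ` unit_ball X}"
    unfolding total by auto
  have ST: "S (T v) \<in> carrier (Linfty M)" if "v \<in> unit_ball X" for v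
    using S that by (auto simp: bounded_operator_def unit_ball_def)
  have meas: "(\<lambda>\<omega>. rep (S (T v)) \<omega> * indicator B \<omega>) \<in> borel_measurable M" if "v \<in> unit_ball X" for v
    using carrier_LinftyD(1)[OF ST[OF that]] B(1) by (intro borel_measurable_times borel_measurable_indicator)
  have cut_mem: "?cut B (S (T v)) \<in> carrier (Linfty M)" if v: "v \<in> unit_ball X" for v
  proof -
    obtain c where c: "AE \<omega> in M. norm (rep (S (T v)) \<omega>) \<le> c" using carrier_LinftyD(3)[OF ST[OF v]] by blast
    show ?thesis
      by (rule carrier_LinftyI[OF meas[OF v], where c = "max c 0"])
         (use c in \<open>eventually_elim, auto split: split_indicator\<close>)
  qed
  define R where "R = {?cut B u | u. u \<in> S ` T ` unit_ball X}"
  have R_sub: "R \<subseteq> carrier (Linfty M)" unfolding R_def using cut_mem by blast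
  from relatively_compact_Linfty_net[OF rc[folded R_def] R_sub d(1)]
  obtain N where N: "finite N" "N \<subseteq> carrier (Linfty M)"
    and net: "\<forall>u\<in>R. \<exists>v\<in>N. AE \<omega> in M. norm (rep u \<omega> - rep v \<omega>) \<le> \<delta>"
    by (elim exE conjE)
  have Nm: "rep v \<in> borel_measurable M" if "v \<in> N" for v by (rule carrier_LinftyD(1)[OF subsetD[OF N(2) that]])
  have "\<exists>A. A \<in> sets M \<and> A \<subseteq> B \<and> 0 < measure M A \<and>
      (\<forall>v\<in>N. \<exists>w. \<forall>\<omega>\<in>A. norm (rep v \<omega> - w) \<le> \<delta>)"
    by (rule constant_up_to_finite[OF N(1) B Nm d(1)])
  then obtain A where A: "A \<in> sets M" "A \<subseteq> B" "0 < measure M A"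
    and flat: "\<forall>v\<in>N. \<exists>w. \<forall>\<omega>\<in>A. norm (rep v \<omega> - w) \<le> \<delta>"
    by (elim exE conjE)
  \<comment> \<open>The node is chosen after \<open>A\<close>: the net is finite, so one set
    \<open>A\<close> serves all nodes.\<close>
  obtain r where r: "0 < measure M (A \<inter> I (True # r))" "0 < measure M (A \<inter> I (False # r))"
    using positive_split[OF A(1,3)] by blast
  let ?u = "?cut B (S (T (x r)))"
  have u_mem: "?u \<in> R" unfolding R_def using x[of r] by blast
  obtain v where v: "v \<in> N" "AE \<omega> in M. norm (rep ?u \<omega> - rep v \<omega>) \<le> \<delta>"
    using bspec[OF net u_mem] by (elim bexE)
  obtain w where w: "\<forall>\<omega>\<in>A. norm (rep v \<omega> - w) \<le> \<delta>" using flat v(1) by blast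
  have close: "norm (z r b - w) \<le> (?d + 2) * \<delta>" for b
  proof -
    have "AE \<omega> in M. norm (rep ?u \<omega> - rep v \<omega>) \<le> \<delta> \<and> rep ?u \<omega> = rep (S (T (x r))) \<omega> * indicator B \<omega> \<and>
        (\<omega> \<in> I (b # r) \<longrightarrow> norm (rep (S (T (x r))) \<omega> - z r b) \<le> ?d * \<delta>)"
      using v(2) rep_class(2)[OF meas[OF x[of r]]] S_near[of b r] by eventually_elim blast
    moreover have "A \<inter> I (b # r) \<in> sets M" using A(1) I_sets by blast
    moreover have "0 < measure M (A \<inter> I (b # r))" using r by (cases b) auto
    ultimately have "\<exists>\<omega>\<in>A \<inter> I (b # r). norm (rep ?u \<omega> - rep v \<omega>) \<le> \<delta> \<and>
        rep ?u \<omega> = rep (S (T (x r))) \<omega> * indicator B \<omega> \<and>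
        (\<omega> \<in> I (b # r) \<longrightarrow> norm (rep (S (T (x r))) \<omega> - z r b) \<le> ?d * \<delta>)"
      by (rule AE_positive_ex)
    then obtain \<omega> where \<omega>: "\<omega> \<in> A \<inter> I (b # r)" "norm (rep ?u \<omega> - rep v \<omega>) \<le> \<delta>"
        "rep ?u \<omega> = rep (S (T (x r))) \<omega> * indicator B \<omega>" "norm (rep (S (T (x r))) \<omega> - z r b) \<le> ?d * \<delta>"
      by blast
    have u: "rep ?u \<omega> = rep (S (T (x r))) \<omega>" using \<omega>(1,3) A(2) by auto
    have "norm (z r b - w) \<le> norm (z r b - rep ?u \<omega>) + norm (rep ?u \<omega> - rep v \<omega>) + norm (rep v \<omega> - w)"
      using norm_triangle_ineq[of "z r b - rep ?u \<omega>" "rep ?u \<omega> - rep v \<omega>"]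
        norm_triangle_ineq[of "z r b - rep v \<omega>" "rep v \<omega> - w"] by simp
    also have "\<dots> \<le> ?d * \<delta> + \<delta> + \<delta>"
      using \<omega>(1,2,4) w u by (intro add_mono) (auto simp: norm_minus_commute)
    finally show ?thesis by (simp add: algebra_simps)
  qed
  have "norm (z r True - z r False) \<le> norm (z r True - w) + norm (z r False - w)"
    using norm_triangle_ineq4[of "z r True - w" "z r False - w"] by simp
  also have "\<dots> \<le> (2 * ?d + 4) * \<delta>"
    using close[of True] close[of False] by (simp add: algebra_simps)
  finally show False using z[of r] d(2) by simp
qed

corollary Asplund_Szlenk_eps_neq_UNIV:
  fixes e :: "('a \<Rightarrow> 'k) \<Rightarrow> 'u"
  assumes "Asplund_op X Y T" "0 < \<epsilon>" "inj e"
  shows "Szlenk_eps X \<epsilon> K \<noteq> (UNIV :: 'u ordinal set)"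
proof
  assume "Szlenk_eps X \<epsilon> K = (UNIV :: 'u ordinal set)"
  from self_derived_exists[OF this assms(3)]
  obtain L where "L \<subseteq> K" "L \<noteq> {}" "L \<subseteq> szlenk_deriv X \<epsilon> L" by (elim exE conjE)
  then show False using Asplund_self_derived[OF assms(1) _ _ assms(2)] by blast
qed

text \<open>The only vector is zero, so functionals cannot differ and the first derivative is empty.
  This covers spaces over a one-element type, where pairs of an index and a natural number need not
  embed into the functionals on the sum.\<close>

lemma Szlenk_op_trivial:
  fixes \<alpha> \<beta> :: "'o::wellorder"
  assumes triv: "\<And>a b :: 'a. a = b" and less: "\<beta> < \<alpha>"
  shows "\<alpha> \<notin> Szlenk_op X Y T"
proof
  assume "\<alpha> \<in> Szlenk_op X Y T"
  then obtain \<epsilon> f where e: "\<epsilon> > 0" and f: "f \<in> szlenk_iter X \<epsilon> K \<alpha>"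
    unfolding Szlenk_op_def Szlenk_def Szlenk_eps_def by blast
  let ?s = "szlenk_iter X \<epsilon> K \<beta>"
  have sub: "?s \<subseteq> carrier (dual X)" using szlenk_iter_subset[of X \<epsilon> K \<beta>] K_subset by (rule order_trans)
  have "f \<in> szlenk_deriv X \<epsilon> ?s" by (rule szlenk_iterD[OF f less])
  then have fs: "f \<in> ?s" and "\<exists>g\<in>?s \<inter> topspace (weak_star X). \<exists>h\<in>?s \<inter> topspace (weak_star X). \<exists>x\<in>unit_ball X. \<epsilon> < norm (g x - h x)"
    unfolding X.szlenk_deriv_iff[OF sub] using sub openin_topspace[of "weak_star X"] by auto
  then obtain g h x where gh: "g \<in> ?s" "h \<in> ?s" "\<epsilon> < norm (g x - h x)" by blast
  have "g x = 0" "h x = 0"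
    using X.dual_zero[of g] X.dual_zero[of h] gh(1,2) sub triv[of x "\<zero>\<^bsub>X\<^esub>"] by auto
  then show False using gh(3) e by simp
qed

end

theorem proposition2p1:
  fixes \<Lambda> :: "'i set"
    and E :: "'i \<Rightarrow> ('k::real_or_complex, 'a) nspace"
    and F :: "'i \<Rightarrow> ('k, 'b) nspace"
    and T :: "'i \<Rightarrow> 'a \<Rightarrow> 'b"
    and p :: ereal
  assumes "\<Lambda> \<noteq> {}"
    and "\<And>l. l \<in> \<Lambda> \<Longrightarrow> banach_space (E l)"
    and "\<And>l. l \<in> \<Lambda> \<Longrightarrow> banach_space (F l)"
    and "\<And>l. l \<in> \<Lambda> \<Longrightarrow> bounded_operator (E l) (F l) (T l)"
    and "\<And>l. l \<in> \<Lambda> \<Longrightarrow> Asplund_op (E l) (F l) (T l)"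
    and "bdd_above ((\<lambda>l. op_norm (E l) (F l) (T l)) ` \<Lambda>)"
    and "p = 1 \<or> p = \<infinity>"
  shows "let SzT = (Szlenk_op (lp_sum p \<Lambda> E) (lp_sum p \<Lambda> F) (sum_op \<Lambda> T)
                      :: (('i \<Rightarrow> 'a) \<Rightarrow> 'k) ordinal set);
             supSz = (SUP l\<in>\<Lambda>. Szlenk_op (E l) (F l) (T l))
         in (SzT \<noteq> UNIV \<longleftrightarrow> SzT = supSz) \<and>
            (SzT = supSz \<longleftrightarrow> (\<lambda>l. op_norm (E l) (F l) (T l)) \<in> c0 \<Lambda>)"
proof -
  have "lp_family p \<Lambda> E" "lp_family p \<Lambda> F"
    by (intro lp_family.intro assms(1,7) banach_space.axioms(1)[OF assms(2)] banach_space.axioms(1)[OF assms(3)];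
        assumption)+
  then interpret sum_operator p \<Lambda> E F T
    by (intro sum_operator.intro sum_operator_axioms.intro assms(4,6))
  let ?SzT = "Szlenk_op (lp_sum p \<Lambda> E) (lp_sum p \<Lambda> F) (sum_op \<Lambda> T) :: (('i \<Rightarrow> 'a) \<Rightarrow> 'k) ordinal set"
  let ?sup = "(\<Union>l\<in>\<Lambda>. Szlenk_op (E l) (F l) (T l)) :: (('i \<Rightarrow> 'a) \<Rightarrow> 'k) ordinal set"
  \<comment> \<open>This separates the two cases of the theorem: the index of the sum will be either
    the supremum or \<open>UNIV\<close>, and these are now different.\<close>
  have sup_neq: "?sup \<noteq> UNIV"
  proof (cases "\<exists>a b :: 'a. a \<noteq> b")
    case True
    then obtain a b :: 'a where ab: "a \<noteq> b" by blast
    \<comment> \<open>\<open>n\<close> is read off at the constant function \<open>a\<close>, and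
      \<open>i\<close> at a function that takes the value \<open>a\<close> only at \<open>i\<close>.
      The successor keeps the values apart from \<open>0\<close>.\<close>
    define e :: "'i \<times> nat \<Rightarrow> ('i \<Rightarrow> 'a) \<Rightarrow> 'k" where
      "e = (\<lambda>(i, n) z. if z i = a then of_nat (Suc n) else 0)"
    have e: "inj e"
    proof (rule injI, clarify)
      fix i j m n assume eq: "e (i, m) = e (j, n)"
      have "of_nat (Suc m) = (of_nat (Suc n) :: 'k)" using fun_cong[OF eq, of "\<lambda>_. a"] by (simp add: e_def del: of_nat_Suc)
      then have mn: "m = n" by (simp only: of_nat_eq_iff nat.inject)
      have "i = j"
      proof (rule ccontr)
        assume "i \<noteq> j"
        then have "of_nat (Suc m) = (0 :: 'k)" using fun_cong[OF eq, of "(\<lambda>_. b)(i := a)"] ab by (simp add: e_def del: of_nat_Suc)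
        then show False by (simp only: of_nat_eq_0_iff nat.distinct)
      qed
      then show "i = j \<and> m = n" using mn by blast
    qed
    have inf: "infinite (UNIV :: (('i \<Rightarrow> 'a) \<Rightarrow> 'k) set)"
    proof
      assume "finite (UNIV :: (('i \<Rightarrow> 'a) \<Rightarrow> 'k) set)"
      then have "finite (UNIV :: ('i \<times> nat) set)" using e by (metis finite_imageD finite_subset subset_UNIV)
      then show False by (simp add: finite_prod)
    qed
    obtain i :: 'i where "i \<in> \<Lambda>" using assms(1) by blast
    \<comment> \<open>Functions on \<open>'a\<close> embed into functions on
      \<open>'i \<Rightarrow> 'a\<close> by composition with the evaluation at \<open>i\<close>,
      which is surjective.\<close>
    define e' :: "('a \<Rightarrow> 'k) \<Rightarrow> ('i \<Rightarrow> 'a) \<Rightarrow> 'k" where "e' f = (\<lambda>z. f (z i))" for f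
    have e': "inj e'"
    proof (rule injI)
      fix f g assume eq: "e' f = e' g"
      show "f = g"
      proof
        fix x show "f x = g x" using fun_cong[OF eq, of "\<lambda>_. x"] by (simp add: e'_def)
      qed
    qed
    show ?thesis
      unfolding Szlenk_op_def
      by (rule Szlenk_UN_neq_UNIV[OF inf e])
         (rule operator.Asplund_Szlenk_eps_neq_UNIV[OF operator assms(5) _ e'])
  next
    case False
    then have triv: "a = b" for a b :: 'a by blast
    \<comment> \<open>A single ordinal would inject into any type.\<close>
    have "\<exists>\<alpha> \<beta> :: (('i \<Rightarrow> 'a) \<Rightarrow> 'k) ordinal. \<beta> < \<alpha>"
    proof (rule ccontr)
      assume "\<not> ?thesis"
      then have "\<alpha> = \<beta>" for \<alpha> \<beta> :: "(('i \<Rightarrow> 'a) \<Rightarrow> 'k) ordinal" by (meson linorder_neqE)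
      then have "inj (\<lambda>\<alpha> :: (('i \<Rightarrow> 'a) \<Rightarrow> 'k) ordinal. undefined :: ('i \<Rightarrow> 'a) \<Rightarrow> 'k)" by (intro injI) blast
      then show False using not_inj_ordinal by blast
    qed
    then obtain \<alpha> \<beta> :: "(('i \<Rightarrow> 'a) \<Rightarrow> 'k) ordinal" where less: "\<beta> < \<alpha>" by blast
    have "\<alpha> \<notin> ?sup" using operator.Szlenk_op_trivial[OF operator triv less] by blast
    then show ?thesis by blast
  qed
  have sub: "?sup \<subseteq> ?SzT" using Szlenk_component_subset by blast
  have c0: "?SzT = ?sup" if "(\<lambda>l. op_norm (E l) (F l) (T l)) \<in> c0 \<Lambda>"
    using sub Szlenk_sum_subset[OF that] by (rule antisym[rotated])
  have nc0: "?SzT = UNIV" if "(\<lambda>l. op_norm (E l) (F l) (T l)) \<notin> c0 \<Lambda>"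
    using assms(7) Szlenk_UNIV_p_1[OF _ that] Szlenk_UNIV_p_inf[OF _ that] by blast
  show ?thesis
    unfolding Let_def
  proof (cases "(\<lambda>l. op_norm (E l) (F l) (T l)) \<in> c0 \<Lambda>")
    case True
    with c0[OF True] sup_neq show "(?SzT \<noteq> UNIV \<longleftrightarrow> ?SzT = ?sup) \<and>
        (?SzT = ?sup \<longleftrightarrow> (\<lambda>l. op_norm (E l) (F l) (T l)) \<in> c0 \<Lambda>)" by simp
  next
    case False
    with nc0[OF False] sup_neq show "(?SzT \<noteq> UNIV \<longleftrightarrow> ?SzT = ?sup) \<and>
        (?SzT = ?sup \<longleftrightarrow> (\<lambda>l. op_norm (E l) (F l) (T l)) \<in> c0 \<Lambda>)" by auto
  qed
qed

end
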